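(* Let $U$ be a connected open subset of $\mathbb C$ containing $0$ and invariant under complex conjugation, let $x\in\mathbb Q[[T]]$ satisfy $x(0)=0$ and $x'(0)=1$, and let $\varphi$ be a holomorphic map from a neighbourhood of the closed unit disk $\overline D(0;1)$ to $U$ such that $\varphi(\overline z)=\overline{\varphi(z)}$, $\varphi(0)=0$ and $|\varphi'(0)|>1$. Let $f$ be a non-constant element of $\mathcal H(U,x,\mathbb Z)$. Then the $\mathbb Q(f)$-algebra $\mathcal H(U,x,\mathbb Z)\otimes_{\mathbb Z[f]}\mathbb Q(f)$ is finite-dimensional; in particular, it may be identified with the field $\operatorname{Frac}\mathcal H(U,x,\mathbb Z)$. The dimension of this $\mathbb Q(f)$-algebra is bounded above by $$\bigl(\log|\varphi'(0)|\bigr)^{-1}\int_{[0,1]^2}\log\bigl|(f\circ\varphi)(e^{2i\pi t_1})-(f\circ\varphi)(e^{2i\pi t_2})\bigr|\,dt_1\,dt_2 .$$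
   Context: $\mathcal H(U,x,\mathbb Z)$ is the set of power series $f\in\mathbb Q[[X]]$ such that: (i) $f\circ x\in\mathbb Z[[T]]$; (ii) $f$ is holonomic on $U$, i.e. there is a non-zero linear differential operator $L\in\mathbb C(X)[d/dX]$, without singularities on $U$, with $L(f)=0$. It is a $\mathbb Z$-subalgebra of $\mathbb Q[[X]]$. Condition (ii) implies that $f$ converges near $0$ and that the germ at $0$ of $f\circ\varphi$ continues analytically to a holomorphic function on a neighbourhood of $\overline D(0;1)$; this continuation is still denoted $f\circ\varphi$. *)

theory Defs
  imports
    "HOL-Complex_Analysis.Complex_Analysis"
    "HOL-Library.Poly_Mapping"
    "HOL-Computational_Algebra.Computational_Algebra"
    "HOL-Algebra.Algebraic_Closure_Type"
begin

section \<open>Holonomic power series with an integrality condition\<close>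

definition complexify :: "rat fps \<Rightarrow> complex fps" where
  "complexify f = Abs_fps (\<lambda>n. of_rat (fps_nth f n))"

text \<open>
  The field of rational functions is \<^typ>\<open>complex poly fract\<close>.
  \<^const>\<open>quot_of_fract\<close> yields its elements in lowest terms, so that the poles
  are exactly the roots of the denominator.
\<close>

definition regular_at :: "complex poly fract \<Rightarrow> complex \<Rightarrow> bool" where
  "regular_at a z \<longleftrightarrow> poly (snd (quot_of_fract a)) z \<noteq> 0"

definition ratfun_to_fls :: "complex poly fract \<Rightarrow> complex fls" where
  "ratfun_to_fls a =
     fps_to_fls (fps_of_poly (fst (quot_of_fract a))) /
     fps_to_fls (fps_of_poly (snd (quot_of_fract a)))"

text \<open>
  The type \<^typ>\<open>complex poly fract poly\<close> serves as the underlying additive group of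
  the ring of linear differential operators: \<open>L\<close> stands for the sum of the
  \<open>Polynomial.coeff L i * (d/dX)^i\<close>. The (non-commutative) composition of operators is never used.
\<close>

definition apply_diffop :: "complex poly fract poly \<Rightarrow> complex fps \<Rightarrow> complex fls" where
  "apply_diffop L F =
     (\<Sum>i\<le>Polynomial.degree L. ratfun_to_fls (Polynomial.coeff L i) * fps_to_fls ((fps_deriv ^^ i) F))"

text \<open>
  An operator has no singularity at \<open>z\<close> if, once it is made monic, all of its coefficients
  are regular at \<open>z\<close>.
\<close>

definition nonsingular_on :: "complex poly fract poly \<Rightarrow> complex set \<Rightarrow> bool" where
  "nonsingular_on L U \<longleftrightarrow>
     (\<forall>z\<in>U. \<forall>i\<le>Polynomial.degree L. regular_at (Polynomial.coeff L i / Polynomial.lead_coeff L) z)"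

definition holonomic_on :: "rat fps \<Rightarrow> complex set \<Rightarrow> bool" where
  "holonomic_on f U \<longleftrightarrow>
     (\<exists>L. L \<noteq> 0 \<and> nonsingular_on L U \<and> apply_diffop L (complexify f) = 0)"

definition holonomic_algebra :: "complex set \<Rightarrow> rat fps \<Rightarrow> rat fps set" where
  "holonomic_algebra U x =
     {f. (\<forall>n. fps_nth (fps_compose f x) n \<in> \<int>) \<and> holonomic_on f U}"

text \<open>
  \<open>g\<close> is the analytic continuation, to a neighbourhood of the closed unit disk, of the germ
  at \<open>0\<close> of \<open>f \<circ> \<phi>\<close>; its restriction to the closed disk is uniquely determined.
\<close>

definition continues_composite :: "rat fps \<Rightarrow> (complex \<Rightarrow> complex) \<Rightarrow> (complex \<Rightarrow> complex) \<Rightarrow> bool" where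
  "continues_composite f \<phi> g \<longleftrightarrow>
     fps_conv_radius (complexify f) > 0 \<and>
     g analytic_on cball 0 1 \<and>
     (\<forall>\<^sub>F z in nhds 0. g z = eval_fps (complexify f) (\<phi> z))"


section \<open>Tensor products of commutative algebras\<close>

text \<open>
  \<open>A\<close> and \<open>B\<close> are algebras over a ring with set of elements \<open>R\<close>, via the structure maps
  \<open>\<alpha>\<close> and \<open>\<beta>\<close>. The tensor product is the free abelian group on the pairs modulo the
  subgroup generated by the bilinearity and balancing relations, with the multiplication
  determined by \<open>(a \<otimes> b)(a' \<otimes> b') = aa' \<otimes> bb'\<close>.
\<close>

definition pair_ring :: "('a, 'c) ring_scheme \<Rightarrow> ('b, 'd) ring_scheme \<Rightarrow> ('a \<times> 'b \<Rightarrow>\<^sub>0 int) ring" where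
  "pair_ring A B =
     \<lparr>carrier = {c. Poly_Mapping.keys c \<subseteq> carrier A \<times> carrier B},
      monoid.mult = (\<lambda>c d. frag_extend (\<lambda>(a, b). frag_extend (\<lambda>(a', b').
                 frag_of (a \<otimes>\<^bsub>A\<^esub> a', b \<otimes>\<^bsub>B\<^esub> b')) d) c),
      one = frag_of (\<one>\<^bsub>A\<^esub>, \<one>\<^bsub>B\<^esub>),
      zero = 0,
      add = (+)\<rparr>"

definition tensor_relations ::
  "('a, 'c) ring_scheme \<Rightarrow> ('b, 'd) ring_scheme \<Rightarrow> 'r set \<Rightarrow> ('r \<Rightarrow> 'a) \<Rightarrow> ('r \<Rightarrow> 'b) \<Rightarrow>
   ('a \<times> 'b \<Rightarrow>\<^sub>0 int) set" where
  "tensor_relations A B R \<alpha> \<beta> =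
     {frag_of (a \<oplus>\<^bsub>A\<^esub> a', b) - frag_of (a, b) - frag_of (a', b) | a a' b.
        a \<in> carrier A \<and> a' \<in> carrier A \<and> b \<in> carrier B} \<union>
     {frag_of (a, b \<oplus>\<^bsub>B\<^esub> b') - frag_of (a, b) - frag_of (a, b') | a b b'.
        a \<in> carrier A \<and> b \<in> carrier B \<and> b' \<in> carrier B} \<union>
     {frag_of (\<alpha> r \<otimes>\<^bsub>A\<^esub> a, b) - frag_of (a, \<beta> r \<otimes>\<^bsub>B\<^esub> b) | r a b.
        r \<in> R \<and> a \<in> carrier A \<and> b \<in> carrier B}"

definition tensor_kernel ::
  "('a, 'c) ring_scheme \<Rightarrow> ('b, 'd) ring_scheme \<Rightarrow> 'r set \<Rightarrow> ('r \<Rightarrow> 'a) \<Rightarrow> ('r \<Rightarrow> 'b) \<Rightarrow>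
   ('a \<times> 'b \<Rightarrow>\<^sub>0 int) set" where
  "tensor_kernel A B R \<alpha> \<beta> =
     generate (add_monoid (pair_ring A B)) (tensor_relations A B R \<alpha> \<beta>)"

definition tensor_algebra ::
  "('a, 'c) ring_scheme \<Rightarrow> ('b, 'd) ring_scheme \<Rightarrow> 'r set \<Rightarrow> ('r \<Rightarrow> 'a) \<Rightarrow> ('r \<Rightarrow> 'b) \<Rightarrow>
   ('a \<times> 'b \<Rightarrow>\<^sub>0 int) set ring" where
  "tensor_algebra A B R \<alpha> \<beta> = pair_ring A B Quot tensor_kernel A B R \<alpha> \<beta>"

definition pure_tensor ::
  "('a, 'c) ring_scheme \<Rightarrow> ('b, 'd) ring_scheme \<Rightarrow> 'r set \<Rightarrow> ('r \<Rightarrow> 'a) \<Rightarrow> ('r \<Rightarrow> 'b) \<Rightarrow>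
   'a \<Rightarrow> 'b \<Rightarrow> ('a \<times> 'b \<Rightarrow>\<^sub>0 int) set" where
  "pure_tensor A B R \<alpha> \<beta> a b = tensor_kernel A B R \<alpha> \<beta> +>\<^bsub>pair_ring A B\<^esub> frag_of (a, b)"


section \<open>The generic fibre of the algebra over the subring generated by a series\<close>

definition int_polys_in :: "rat fps \<Rightarrow> rat fps set" where
  "int_polys_in f = range (\<lambda>p :: int poly. poly (map_poly of_int p) f)"

text \<open>The field of fractions of a subring of the power series ring, inside the field of
  formal Laurent series.\<close>

definition frac_carrier :: "rat fps set \<Rightarrow> rat fls set" where
  "frac_carrier S = {fps_to_fls a / fps_to_fls b | a b. a \<in> S \<and> b \<in> S \<and> b \<noteq> 0}"

definition fps_subring :: "rat fps set \<Rightarrow> rat fps ring" where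
  "fps_subring S = (ring_of_type_algebra :: rat fps ring)\<lparr>carrier := S\<rparr>"

definition frac_field :: "rat fps set \<Rightarrow> rat fls ring" where
  "frac_field S = (ring_of_type_algebra :: rat fls ring)\<lparr>carrier := frac_carrier S\<rparr>"

text \<open>
  \<open>generic_fibre U x f\<close> is the tensor product, over \<open>\<int>[f]\<close>, of \<open>holonomic_algebra U x\<close> with
  \<open>\<rat>(f) = Frac \<int>[f]\<close>; \<open>generic_tensor U x f a q\<close> is its element \<open>a \<otimes> q\<close>, and
  \<open>generic_scalars U x f\<close> is the image of \<open>\<rat>(f)\<close> under \<open>q \<mapsto> 1 \<otimes> q\<close>.
\<close>

definition generic_fibre :: "complex set \<Rightarrow> rat fps \<Rightarrow> rat fps \<Rightarrow> (rat fps \<times> rat fls \<Rightarrow>\<^sub>0 int) set ring" where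
  "generic_fibre U x f =
     tensor_algebra (fps_subring (holonomic_algebra U x)) (frac_field (int_polys_in f))
       (int_polys_in f) id fps_to_fls"

definition generic_tensor ::
  "complex set \<Rightarrow> rat fps \<Rightarrow> rat fps \<Rightarrow> rat fps \<Rightarrow> rat fls \<Rightarrow> (rat fps \<times> rat fls \<Rightarrow>\<^sub>0 int) set" where
  "generic_tensor U x f =
     pure_tensor (fps_subring (holonomic_algebra U x)) (frac_field (int_polys_in f))
       (int_polys_in f) id fps_to_fls"

definition generic_scalars :: "complex set \<Rightarrow> rat fps \<Rightarrow> rat fps \<Rightarrow> (rat fps \<times> rat fls \<Rightarrow>\<^sub>0 int) set set" where
  "generic_scalars U x f = generic_tensor U x f 1 ` frac_carrier (int_polys_in f)"

end

theory Submission
  imports Defs "HOL-Real_Asymp.Real_Asymp" "Jordan_Normal_Form.Determinant"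
begin

text \<open>
  Write \<open>F\<close> for the continuation of \<open>f \<circ> \<phi>\<close> and \<open>\<alpha> = \<bar>\<phi>'(0)\<bar>\<close>. Everything rests on one inequality: if
  \<open>h\<^sub>1, \<dots>, h\<^sub>m\<close> in the holonomic algebra are linearly independent over \<open>\<int>[f]\<close>, then
  \<open>m * ln \<alpha>\<close> is at most the double integral. It says that the rank of the algebra over \<open>\<int>[f]\<close> is finite,
  and the statements about tensor products follow from it by commutative algebra.

  The inequality is a comparison of two estimates of a determinant. Take the \<open>N = D * m\<close> series
  \<open>f^k h\<^sub>i\<close> with \<open>k < D\<close>. After substituting \<open>x\<close>, they have integral coefficients and are independent,
  so some \<open>N \<times> N\<close> minor of their coefficient matrix is a non-zero integer. For the rows that Gaussian
  elimination singles out, the substitution of \<open>\<phi>\<close> for \<open>x\<close> acts on the minor through leading terms only and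
  multiplies it by at least \<open>\<alpha>^(N(N-1)/2)\<close> (\<open>lattice_determinant_inequality\<close>).
  For an upper bound, replace the powers \<open>f^k\<close> by monic polynomials \<open>P\<^sub>k(f)\<close>, which does not change the
  determinant, and multiply all functions by one zero-free function \<open>exp (- D * P)\<close>, whose effect on
  the determinant is known. Cauchy's estimate then bounds the determinant by \<open>N!\<close> times the product of the
  suprema of \<open>P\<^sub>k(F) exp (- D * P)\<close> on the unit circle. Let the zeros of \<open>P\<^sub>k\<close> be the values of
  \<open>F\<close> at the first \<open>k\<close> points of a greedy (Leja) sequence for the weight \<open>exp (- D * Re P)\<close>. Then
  the product of the suprema is a weighted Vandermonde product of \<open>D\<close> points on the image of the circle.

  Vandermonde products are exponentials of logarithmic energies, and the logarithmic
  energy is negative on charges of total mass zero. Comparing the charge of the \<open>D\<close> points with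
  \<open>D\<close> times the image of the uniform measure on the circle shows that, when \<open>Re P\<close> is
  the logarithmic potential of that image measure, the weighted Vandermonde product is at most
  \<open>exp (- D\<^sup>2 I / 2)\<close>, up to lower order terms, where \<open>I\<close> is the double integral
  (\<open>energy_comparison\<close>). Also \<open>Re P(0)\<close>, the mean of \<open>Re P\<close> over the circle, is \<open>I\<close>. The two
  estimates give \<open>(m D)\<^sup>2 ln \<alpha> / 2 \<le> m D\<^sup>2 I - m D\<^sup>2 I / 2\<close> to leading order, which is the claim.
  To avoid all questions about singularities, the logarithm \<open>ln \<bar>w\<bar>\<close> is first replaced by
  \<open>ln (\<bar>w\<bar>\<^sup>2 + s) / 2\<close> with \<open>s > 0\<close>. It is larger, continuous, and still negative on charges of
  total mass zero; monotone convergence as \<open>s\<close> tends to \<open>0\<close> then also yields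
  the integrability of the logarithm in the statement.

  Three facts about holonomic series are needed. They form a ring: a series satisfies an equation
  without singularities on \<open>U\<close> if and only if all its derivatives lie in a finitely generated module over the
  ring of rational functions that are regular on \<open>U\<close>, and this ring is noetherian. They converge near \<open>0\<close>, and
  their compositions with \<open>\<phi>\<close> converge on a disc of radius greater than \<open>1\<close>, because the
  derivatives composed with \<open>\<phi>\<close> solve a linear system with holomorphic coefficients on such a disc.

  Finally, since the rank is bounded, the powers of a non-zero element \<open>b\<close> are dependent over \<open>\<int>[f]\<close>, so \<open>b\<close> divides a
  non-zero element of \<open>\<int>[f]\<close>. Inverting the non-zero elements of \<open>\<int>[f]\<close>, which is what the tensor product
  does, therefore already produces the whole field of fractions.
\<close>

section \<open>Positive kernels and logarithmic energy\<close>

text \<open>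
  Expanding the exponential, each term of the series is the form of \<open>k\<close> at the vector
  \<open>d i * a i ^ n\<close> (a special case of Schur's product theorem).
\<close>

lemma exp_kernel_positive:
  fixes a :: "'i \<Rightarrow> real" and k :: "'i \<Rightarrow> 'i \<Rightarrow> real"
  assumes "finite I" and "s \<ge> 0"
    and pos: "\<And>d :: 'i \<Rightarrow> real. 0 \<le> (\<Sum>i\<in>I. \<Sum>j\<in>I. d i * d j * k i j)"
  shows "0 \<le> (\<Sum>i\<in>I. \<Sum>j\<in>I. d i * d j * (exp (s * a i * a j) * k i j))"
proof -
  have "(\<lambda>n. \<Sum>i\<in>I. \<Sum>j\<in>I. d i * d j * (((s * a i * a j) ^ n /\<^sub>R fact n) * k i j)) sums
        (\<Sum>i\<in>I. \<Sum>j\<in>I. d i * d j * (exp (s * a i * a j) * k i j))"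
    by (intro sums_sum sums_mult sums_mult2 exp_converges)
  moreover have "0 \<le> (\<Sum>i\<in>I. \<Sum>j\<in>I. d i * d j * (((s * a i * a j) ^ n /\<^sub>R fact n) * k i j))" for n
  proof -
    have "(\<Sum>i\<in>I. \<Sum>j\<in>I. d i * d j * (((s * a i * a j) ^ n /\<^sub>R fact n) * k i j))
        = s ^ n / fact n * (\<Sum>i\<in>I. \<Sum>j\<in>I. (d i * a i ^ n) * (d j * a j ^ n) * k i j)"
      unfolding sum_distrib_left by (intro sum.cong refl) (simp add: field_simps power_mult_distrib)
    then show ?thesis using pos[of "\<lambda>i. d i * a i ^ n"] \<open>s \<ge> 0\<close> by simp
  qed
  ultimately show ?thesis
    by (metis (lifting) sums_le sums_zero)
qed

text \<open>
  The cross term of \<open>\<bar>w - w'\<bar>\<^sup>2\<close> is a sum of two products of real coordinates, which gives two exponential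
  kernels; the remaining factors are absorbed into the weights.
\<close>

lemma gaussian_kernel_positive:
  fixes w :: "'i \<Rightarrow> complex" and c :: "'i \<Rightarrow> real"
  assumes "finite I" and "t \<ge> 0"
  shows "0 \<le> (\<Sum>i\<in>I. \<Sum>j\<in>I. c i * c j * exp (- t * (cmod (w i - w j))\<^sup>2))"
proof -
  have one: "0 \<le> (\<Sum>i\<in>I. \<Sum>j\<in>I. d i * d j * (1::real))" for d
    by (simp flip: sum_product)
  have "0 \<le> (\<Sum>i\<in>I. \<Sum>j\<in>I. d i * d j * (exp (2 * t * Re (w i) * Re (w j)) *
              (exp (2 * t * Im (w i) * Im (w j)) * 1)))" for d
    by (rule exp_kernel_positive[OF assms(1) _ exp_kernel_positive[OF assms(1) _ one]]) (use assms in auto)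
  from this[of "\<lambda>i. c i * exp (- t * (cmod (w i))\<^sup>2)"] show ?thesis
    unfolding cmod_power2
    by (simp add: algebra_simps power2_eq_square exp_add exp_diff exp_minus divide_inverse flip: mult_exp_exp)
qed

text \<open>
  The kernel is the Laplace transform of Gaussian kernels.
\<close>

lemma cauchy_kernel_positive:
  fixes w :: "'i \<Rightarrow> complex" and c :: "'i \<Rightarrow> real"
  assumes "finite I" and "s > 0"
  shows "0 \<le> (\<Sum>i\<in>I. \<Sum>j\<in>I. c i * c j * (1 / ((cmod (w i - w j))\<^sup>2 + s)))"
proof (rule has_integral_nonneg)
  show "((\<lambda>t. \<Sum>i\<in>I. \<Sum>j\<in>I. c i * c j * exp (- ((cmod (w i - w j))\<^sup>2 + s) * t)) has_integral
     (\<Sum>i\<in>I. \<Sum>j\<in>I. c i * c j * (1 / ((cmod (w i - w j))\<^sup>2 + s)))) {0..}"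
    by (intro has_integral_sum has_integral_mult_right assms)
      (use has_integral_exp_minus_to_infinity[of "_ + s" 0] \<open>s > 0\<close> in \<open>simp add: add_nonneg_pos\<close>)
next
  fix t :: real assume "t \<in> {0..}"
  have "(\<Sum>i\<in>I. \<Sum>j\<in>I. c i * c j * exp (- ((cmod (w i - w j))\<^sup>2 + s) * t))
      = exp (- s * t) * (\<Sum>i\<in>I. \<Sum>j\<in>I. c i * c j * exp (- t * (cmod (w i - w j))\<^sup>2))"
    unfolding sum_distrib_left by (intro sum.cong refl) (simp add: algebra_simps flip: exp_add)
  then show "0 \<le> (\<Sum>i\<in>I. \<Sum>j\<in>I. c i * c j * exp (- ((cmod (w i - w j))\<^sup>2 + s) * t))"
    using gaussian_kernel_positive[OF assms(1), of t c w] \<open>t \<in> {0..}\<close> by simp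
qed

text \<open>
  As a function of \<open>s\<close>, the form has the form of the Cauchy kernel as its derivative. So it is
  increasing, and it tends to zero at infinity.
\<close>

lemma log_kernel_conditionally_negative:
  fixes w :: "'i \<Rightarrow> complex" and c :: "'i \<Rightarrow> real"
  assumes "finite I" and "s > 0" and c0: "(\<Sum>i\<in>I. c i) = 0"
  shows "(\<Sum>i\<in>I. \<Sum>j\<in>I. c i * c j * ln ((cmod (w i - w j))\<^sup>2 + s)) \<le> 0"
proof -
  define \<Phi> where "\<Phi> r = (\<Sum>i\<in>I. \<Sum>j\<in>I. c i * c j * ln ((cmod (w i - w j))\<^sup>2 + r))" for r
  have deriv: "(\<Phi> has_real_derivative (\<Sum>i\<in>I. \<Sum>j\<in>I. c i * c j * (1 / ((cmod (w i - w j))\<^sup>2 + r)))) (at r)"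
    if "r > 0" for r
    unfolding \<Phi>_def using that
    by (auto intro!: derivative_eq_intros sum.cong simp: add_nonneg_pos)
  have mono: "\<Phi> s \<le> \<Phi> r" if "s \<le> r" for r
  proof (rule DERIV_nonneg_imp_nondecreasing[OF that])
    fix t assume "s \<le> t"
    then have "t > 0" using \<open>s > 0\<close> by simp
    from deriv[OF this] cauchy_kernel_positive[OF assms(1) this]
    show "\<exists>y. (\<Phi> has_real_derivative y) (at t) \<and> 0 \<le> y" by blast
  qed
  \<comment> \<open>Since the weights sum to zero, subtracting the constant \<open>ln r\<close> from the kernel changes nothing,
     and \<open>ln (x + r) - ln r\<close> vanishes at infinity.\<close>
  have eq: "\<Phi> r = (\<Sum>i\<in>I. \<Sum>j\<in>I. c i * c j * (ln ((cmod (w i - w j))\<^sup>2 + r) - ln r))" for r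
    unfolding \<Phi>_def right_diff_distrib sum_subtractf
    by (simp add: c0 flip: sum_distrib_right sum_distrib_left)
  have "((\<lambda>r. \<Sum>i\<in>I. \<Sum>j\<in>I. c i * c j * (ln ((cmod (w i - w j))\<^sup>2 + r) - ln r)) \<longlongrightarrow>
      (\<Sum>i\<in>I. \<Sum>j\<in>I. c i * c j * 0)) at_top"
  proof (intro tendsto_sum tendsto_mult tendsto_const)
    show "((\<lambda>r. ln ((cmod (w i - w j))\<^sup>2 + r) - ln r) \<longlongrightarrow> 0) at_top" for i j
      by real_asymp
  qed
  then have "(\<Phi> \<longlongrightarrow> 0) at_top" unfolding eq[symmetric] by simp
  then have "\<Phi> s \<le> 0"
    by (rule tendsto_lowerbound) (auto intro: eventually_at_top_linorderI[of s] mono)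
  then show ?thesis by (simp add: \<Phi>_def)
qed

text \<open>
  For \<open>s > 0\<close> this is a continuous majorant of \<open>ln \<bar>w\<bar>\<close>, decreasing to it as \<open>s\<close> tends to \<open>0\<close>.
\<close>

definition log_kernel :: "real \<Rightarrow> complex \<Rightarrow> real" where
  "log_kernel s w = ln ((cmod w)\<^sup>2 + s) / 2"

lemma log_kernel_minus: "log_kernel s (w - z) = log_kernel s (z - w)"
  by (simp add: log_kernel_def norm_minus_commute)

lemma ln_le_log_kernel: "s > 0 \<Longrightarrow> w \<noteq> 0 \<Longrightarrow> ln (cmod w) \<le> log_kernel s w"
proof -
  assume "s > 0" "w \<noteq> 0"
  then have "ln ((cmod w)\<^sup>2) \<le> ln ((cmod w)\<^sup>2 + s)" by (subst ln_le_cancel_iff) (auto simp: add_pos_pos)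
  moreover have "ln ((cmod w)\<^sup>2) = 2 * ln (cmod w)" using \<open>w \<noteq> 0\<close> by (simp add: ln_realpow)
  ultimately show ?thesis by (simp add: log_kernel_def)
qed

text \<open>
  The total charge of the points \<open>w\<close> with weight \<open>1\<close> and the points \<open>v\<close> with weight \<open>- D / M\<close> is zero. The
  right-hand side is linear in the charge of the \<open>w\<close>, apart from a constant, which is why it can be
  controlled by a weight function on the individual points.
\<close>

lemma energy_comparison:
  fixes w v :: "nat \<Rightarrow> complex"
  assumes "s > 0" and "M > 0"
  shows "(\<Sum>a<D. \<Sum>b<D. log_kernel s (w a - w b))
       \<le> 2 * (D / M) * (\<Sum>a<D. \<Sum>b<M. log_kernel s (w a - v b))
         - (D / M)\<^sup>2 * (\<Sum>a<M. \<Sum>b<M. log_kernel s (v a - v b))"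
proof -
  define c :: "nat + nat \<Rightarrow> real" where "c = case_sum (\<lambda>_. 1) (\<lambda>_. - (D / M))"
  define p where "p = case_sum w v"
  define L where "L z = ln ((cmod z)\<^sup>2 + s)" for z
  have [simp]: "L (v a - w b) = L (w b - v a)" for a b by (simp add: L_def norm_minus_commute)
  have "(\<Sum>i\<in>{..<D} <+> {..<M}. c i) = 0"
    using \<open>M > 0\<close> by (simp add: sum.Plus c_def)
  from log_kernel_conditionally_negative[OF _ assms(1) this, of p]
  have "(\<Sum>i\<in>{..<D} <+> {..<M}. \<Sum>j\<in>{..<D} <+> {..<M}. c i * c j * L (p i - p j)) \<le> 0"
    by (simp add: L_def)
  also have "(\<Sum>i\<in>{..<D} <+> {..<M}. \<Sum>j\<in>{..<D} <+> {..<M}. c i * c j * L (p i - p j))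
     = (\<Sum>a<D. \<Sum>b<D. L (w a - w b)) - (D / M) * (\<Sum>a<D. \<Sum>b<M. L (w a - v b))
       - (D / M) * (\<Sum>b<M. \<Sum>a<D. L (w a - v b)) + (D / M)\<^sup>2 * (\<Sum>a<M. \<Sum>b<M. L (v a - v b))"
    by (simp add: sum.Plus c_def p_def sum.distrib sum_subtractf sum_distrib_left sum_divide_distrib sum_negf power2_eq_square algebra_simps)
  also have "(\<Sum>b<M. \<Sum>a<D. L (w a - v b)) = (\<Sum>a<D. \<Sum>b<M. L (w a - v b))"
    by (rule sum.swap)
  finally show ?thesis
    by (simp add: log_kernel_def L_def flip: sum_divide_distrib)
qed

section \<open>Determinants of power series with integral coefficients\<close>

lemma complexify_nth [simp]: "fps_nth (complexify f) n = of_rat (fps_nth f n)"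
  by (simp add: complexify_def)

lemma complexify_0 [simp]: "complexify 0 = 0"
  and complexify_1 [simp]: "complexify 1 = 1"
  and complexify_const [simp]: "complexify (fps_const c) = fps_const (of_rat c)"
  and complexify_add [simp]: "complexify (f + g) = complexify f + complexify g"
  and complexify_mult [simp]: "complexify (f * g) = complexify f * complexify g"
  by (auto simp: fps_eq_iff of_rat_add fps_mult_nth of_rat_sum of_rat_mult)

lemma complexify_power [simp]: "complexify (f ^ n) = complexify f ^ n"
  by (induction n) auto

lemma complexify_sum: "complexify (sum f A) = (\<Sum>a\<in>A. complexify (f a))"
  by (induction A rule: infinite_finite_induct) auto

lemma complexify_compose: "complexify (f oo g) = complexify f oo complexify g"
  by (simp add: fps_eq_iff fps_compose_nth of_rat_sum of_rat_mult flip: complexify_power)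

lemma fps_const_sum: "fps_const (sum f A) = (\<Sum>a\<in>A. fps_const (f a))"
  by (simp add: fps_eq_iff fps_sum_nth)

text \<open>
  Gaussian elimination: a series of least order serves as pivot, and its leading coefficient is cleared from
  the others.
\<close>

lemma exists_echelon_combinations:
  fixes E :: "'i \<Rightarrow> 'a :: field fps"
  assumes "finite I"
    and "\<And>c. (\<Sum>i\<in>I. fps_const (c i) * E i) = 0 \<Longrightarrow> \<forall>i\<in>I. c i = 0"
  shows "\<exists>\<epsilon> C. (\<forall>r<card I. \<epsilon> r = (\<Sum>i\<in>I. fps_const (C r i) * E i) \<and> \<epsilon> r \<noteq> 0) \<and>
           (\<forall>r s. r < s \<longrightarrow> s < card I \<longrightarrow> subdegree (\<epsilon> r) < subdegree (\<epsilon> s))"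
  using assms
proof (induction "card I" arbitrary: I E)
  case 0
  then show ?case by simp
next
  case (Suc k)
  have "I \<noteq> {}" using Suc.hyps(2) by auto
  then obtain v where v: "v \<in> I" and vmin: "\<And>i. i \<in> I \<Longrightarrow> subdegree (E v) \<le> subdegree (E i)"
    using arg_min_if_finite[OF Suc.prems(1), of "\<lambda>i. subdegree (E i)"] not_less by metis
  define I' where "I' = I - {v}"
  have I: "I = insert v I'" "v \<notin> I'" "finite I'" "card I' = k"
    using v Suc.prems(1) Suc.hyps(2) by (auto simp: I'_def)
  define n where "n = subdegree (E v)"
  define c where "c i = fps_nth (E i) n / fps_nth (E v) n" for i
  define E' where "E' i = E i - fps_const (c i) * E v" for i
  have Ev: "E v \<noteq> 0"
  proof
    assume "E v = 0"
    then have "(\<Sum>i\<in>I. fps_const (if i = v then 1 else 0) * E i) = 0"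
      by (intro sum.neutral) auto
    from Suc.prems(2)[OF this] v show False by auto
  qed
  have E'_low: "fps_nth (E' i) m = 0" if "i \<in> I" "m \<le> n" for i m
  proof (cases "m = n")
    case False
    then have "m < subdegree (E v)" "m < subdegree (E i)"
      using that vmin[of i] by (auto simp: n_def)
    then have "fps_nth (E v) m = 0" "fps_nth (E i) m = 0" using nth_less_subdegree_zero by blast+
    then show ?thesis by (simp add: E'_def)
  next
    case True
    have "fps_nth (E v) n \<noteq> 0" using Ev by (simp add: n_def)
    then show ?thesis by (simp add: E'_def c_def True)
  qed
  have indep': "\<forall>i\<in>I'. d i = 0" if d: "(\<Sum>i\<in>I'. fps_const (d i) * E' i) = 0" for d
  proof -
    have "(\<Sum>i\<in>I. fps_const (if i = v then - (\<Sum>j\<in>I'. d j * c j) else d i) * E i) = 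
          (\<Sum>i\<in>I'. fps_const (d i) * E i) - fps_const (\<Sum>j\<in>I'. d j * c j) * E v"
    proof -
      have "(\<Sum>i\<in>I'. fps_const (if i = v then a else d i) * E i) = (\<Sum>i\<in>I'. fps_const (d i) * E i)" for a
        by (rule sum.cong) (use I(2) in auto)
      then show ?thesis
        unfolding I(1) sum.insert[OF I(3,2)] by (simp flip: fps_const_neg)
    qed
    also have "\<dots> = (\<Sum>i\<in>I'. fps_const (d i) * E' i)"
      by (simp add: E'_def right_diff_distrib sum_subtractf sum_distrib_right fps_const_sum
          mult.assoc fps_const_mult [symmetric] del: fps_const_mult)
    finally have "(\<Sum>i\<in>I. fps_const (if i = v then - (\<Sum>j\<in>I'. d j * c j) else d i) * E i) = 0"
      using d by simp
    from Suc.prems(2)[OF this]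
    have *: "\<forall>i\<in>I. (if i = v then - (\<Sum>j\<in>I'. d j * c j) else d i) = 0" .
    show ?thesis using * I(1,2) by (metis insertI2)
  qed
  obtain \<epsilon> C where \<epsilon>': "\<forall>r<k. \<epsilon> r = (\<Sum>i\<in>I'. fps_const (C r i) * E' i) \<and> \<epsilon> r \<noteq> 0"
    and mono': "\<forall>r s. r < s \<longrightarrow> s < k \<longrightarrow> subdegree (\<epsilon> r) < subdegree (\<epsilon> s)"
  proof -
    have "\<exists>\<epsilon> C. (\<forall>r<card I'. \<epsilon> r = (\<Sum>i\<in>I'. fps_const (C r i) * E' i) \<and> \<epsilon> r \<noteq> 0) \<and>
           (\<forall>r s. r < s \<longrightarrow> s < card I' \<longrightarrow> subdegree (\<epsilon> r) < subdegree (\<epsilon> s))"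
      by (rule Suc.hyps(1)) (use I(3,4) indep' in auto)
    then show thesis unfolding I(4) by (elim exE conjE) (rule that)
  qed
  note \<epsilon> = \<epsilon>'[rule_format] and mono = mono'[rule_format]
  have high: "n < subdegree (\<epsilon> r)" if "r < k" for r
  proof (rule subdegree_greaterI)
    show "\<epsilon> r \<noteq> 0" using \<epsilon> that by blast
    show "fps_nth (\<epsilon> r) i = 0" if "i \<le> n" for i
      using \<epsilon>[OF \<open>r < k\<close>] E'_low[OF _ that] I(1) by (simp add: fps_sum_nth)
  qed
  define \<epsilon>' where "\<epsilon>' r = (case r of 0 \<Rightarrow> E v | Suc r \<Rightarrow> \<epsilon> r)" for r
  define C' where "C' r = (case r of 0 \<Rightarrow> (\<lambda>i. if i = v then 1 else 0)
      | Suc r \<Rightarrow> (\<lambda>i. if i = v then - (\<Sum>j\<in>I'. C r j * c j) else C r i))" for r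
  have "\<epsilon>' r = (\<Sum>i\<in>I. fps_const (C' r i) * E i) \<and> \<epsilon>' r \<noteq> 0" if "r < card I" for r
  proof (cases r)
    case 0
    have "(\<Sum>i\<in>I. fps_const (C' r i) * E i) = (\<Sum>i\<in>I. if i = v then E i else 0)"
      by (intro sum.cong) (auto simp: 0 C'_def)
    then show ?thesis using Ev v Suc.prems(1) by (simp add: 0 \<epsilon>'_def)
  next
    case (Suc r')
    have "(\<Sum>i\<in>I. fps_const (C' r i) * E i) = 
          (\<Sum>i\<in>I'. fps_const (C r' i) * E i) - fps_const (\<Sum>j\<in>I'. C r' j * c j) * E v"
    proof -
      have "(\<Sum>i\<in>I'. fps_const (if i = v then a else C r' i) * E i) = (\<Sum>i\<in>I'. fps_const (C r' i) * E i)" for a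
        by (rule sum.cong) (use I(2) in auto)
      then show ?thesis
        unfolding I(1) sum.insert[OF I(3,2)] by (simp add: Suc C'_def flip: fps_const_neg)
    qed
    also have "\<dots> = (\<Sum>i\<in>I'. fps_const (C r' i) * E' i)"
      by (simp add: E'_def right_diff_distrib sum_subtractf sum_distrib_right fps_const_sum
          mult.assoc fps_const_mult [symmetric] del: fps_const_mult)
    finally have combination: "(\<Sum>i\<in>I. fps_const (C' r i) * E i) = (\<Sum>i\<in>I'. fps_const (C r' i) * E' i)" .
    have "\<epsilon>' r = \<epsilon> r'" by (simp add: Suc \<epsilon>'_def)
    moreover have "r' < k" using that Suc Suc.hyps(2) by simp
    ultimately show ?thesis unfolding combination using \<epsilon> by metis
  qed
  moreover have "subdegree (\<epsilon>' r) < subdegree (\<epsilon>' s)" if "r < s" "s < card I" for r s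
    using that mono high Suc.hyps(2) by (auto simp: \<epsilon>'_def n_def split: nat.splits)
  ultimately show ?case by blast
qed

text \<open>
  Substituting a series of order at least one preserves orders and changes a leading coefficient in a way that depends
  only on the linear term. This is why integrality in one variable can be compared with
  convergence in another.
\<close>

lemma fps_compose_nth_subdegree:
  fixes a b :: "'a :: field fps"
  assumes "fps_nth b 0 = 0"
  shows "k < subdegree a \<Longrightarrow> fps_nth (a oo b) k = 0"
    and "fps_nth (a oo b) (subdegree a) = fps_nth a (subdegree a) * fps_nth b 1 ^ subdegree a"
proof -
  show "k < subdegree a \<Longrightarrow> fps_nth (a oo b) k = 0"
    unfolding fps_compose_nth
  proof (intro sum.neutral ballI)
    fix i assume "k < subdegree a" "i \<in> {0..k}"
    then have "fps_nth a i = 0" by (intro nth_less_subdegree_zero) auto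
    then show "fps_nth a i * fps_nth (b ^ i) k = 0" by (simp only: mult_zero_left)
  qed
  have "fps_nth (a oo b) (subdegree a) = (\<Sum>i\<in>{subdegree a}. fps_nth a i * fps_nth (b ^ i) (subdegree a))"
    unfolding fps_compose_nth
  proof (rule sum.mono_neutral_right)
    show "\<forall>i\<in>{0..subdegree a} - {subdegree a}. fps_nth a i * fps_nth (b ^ i) (subdegree a) = 0"
    proof
      fix i assume "i \<in> {0..subdegree a} - {subdegree a}"
      then have "fps_nth a i = 0" by (intro nth_less_subdegree_zero) auto
      then show "fps_nth a i * fps_nth (b ^ i) (subdegree a) = 0" by (simp only: mult_zero_left)
    qed
  qed auto
  then show "fps_nth (a oo b) (subdegree a) = fps_nth a (subdegree a) * fps_nth b 1 ^ subdegree a"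
    using startsby_zero_power_nth_same[OF assms] by simp
qed

lemma fps_mult_nth_lowest:
  fixes a q :: "'a :: comm_ring_1 fps"
  assumes "\<And>k. k < n \<Longrightarrow> fps_nth a k = 0"
  shows "k < n \<Longrightarrow> fps_nth (a * q) k = 0" and "fps_nth (a * q) n = fps_nth a n * fps_nth q 0"
proof -
  show "k < n \<Longrightarrow> fps_nth (a * q) k = 0"
    using assms by (auto simp: fps_mult_nth intro!: sum.neutral)
  have "fps_nth (a * q) n = (\<Sum>i\<in>{n}. fps_nth a i * fps_nth q (n - i))"
    unfolding fps_mult_nth by (rule sum.mono_neutral_right) (use assms in auto)
  then show "fps_nth (a * q) n = fps_nth a n * fps_nth q 0" by simp
qed

lemma fps_compose_combination:
  fixes \<phi> :: "'a :: field fps"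
  assumes "fps_nth \<phi> 0 = 0"
  shows "(\<Sum>i\<in>I. fps_const (c i) * E i) oo \<phi> = (\<Sum>i\<in>I. fps_const (c i) * (E i oo \<phi>))"
  by (simp add: fps_compose_sum_distrib fps_compose_mult_distrib[OF assms])

lemma norm_det_le_column_bounds:
  fixes A :: "complex mat"
  assumes A: "A \<in> carrier_mat N N" and bound: "\<And>i j. i < N \<Longrightarrow> j < N \<Longrightarrow> cmod (A $$ (i, j)) \<le> C j"
  shows "cmod (Determinant.det A) \<le> fact N * (\<Prod>j<N. C j)"
proof -
  have "cmod (Determinant.det A) \<le> (\<Sum>p | p permutes {0..<N}. cmod (of_int (sign p) * (\<Prod>j<N. A $$ (p j, j))))"
    unfolding det_col[OF A] by (rule norm_sum)
  also have "\<dots> \<le> (\<Sum>p | p permutes {0..<N}. (\<Prod>j<N. C j))"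
  proof (rule sum_mono)
    fix p assume "p \<in> {p. p permutes {0..<N}}"
    then have "p j < N" if "j < N" for j using that permutes_in_image[of p "{0..<N}" j] by auto
    then have "(\<Prod>j<N. cmod (A $$ (p j, j))) \<le> (\<Prod>j<N. C j)"
      by (intro prod_mono) (auto intro: bound)
    then show "cmod (of_int (sign p) * (\<Prod>j<N. A $$ (p j, j))) \<le> (\<Prod>j<N. C j)"
      by (simp add: norm_mult prod_norm sign_def)
  qed
  also have "\<dots> = fact N * (\<Prod>j<N. C j)"
    by (simp add: card_permutations)
  finally show ?thesis .
qed

lemma norm_det_Ints_ge_1:
  fixes A :: "complex mat"
  assumes A: "A \<in> carrier_mat N N" and ints: "\<And>i j. i < N \<Longrightarrow> j < N \<Longrightarrow> A $$ (i, j) \<in> \<int>"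
    and "Determinant.det A \<noteq> 0"
  shows "1 \<le> cmod (Determinant.det A)"
proof -
  have "Determinant.det A \<in> \<int>"
    unfolding det_def'[OF A]
  proof (intro Ints_sum Ints_mult Ints_prod Ints_of_int)
    fix p i assume "p \<in> {p. p permutes {0..<N}}" "i \<in> {0..<N}"
    then show "A $$ (i, p i) \<in> \<int>" using permutes_in_image[of p "{0..<N}" i] by (auto intro: ints)
  qed
  then obtain k where "Determinant.det A = of_int k" by (auto elim: Ints_cases)
  then show ?thesis using assms(3) by auto
qed

text \<open>
  Let \<open>Z\<close> and \<open>Y\<close> be the matrices of the coefficients of \<open>E j oo x\<close> and of \<open>(E j oo \<phi>) * q\<close> at the orders
  \<open>n 0 < n 1 < \<dots>\<close> of the echelon combinations. On these combinations, both become triangular, with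
  diagonals that differ by the factors \<open>\<phi>'(0)^(n r) * q(0)\<close>. Hence \<open>det Y\<close> is \<open>det Z\<close>, a
  non-zero integer, times the product of these factors. The unipotent matrix \<open>B\<close> allows to estimate \<open>det Y\<close>
  in a better basis than \<open>E\<close>.
\<close>

theorem lattice_determinant_inequality:
  fixes E :: "nat \<Rightarrow> rat fps" and x :: "rat fps" and \<phi> q :: "complex fps" and B :: "nat \<Rightarrow> nat \<Rightarrow> complex"
  assumes indep: "\<And>c. (\<Sum>i<N. fps_const (c i) * E i) = 0 \<Longrightarrow> \<forall>i<N. c i = 0"
    and x: "fps_nth x 0 = 0" "fps_nth x 1 = 1"
    and integral: "\<And>i n. i < N \<Longrightarrow> fps_nth (E i oo x) n \<in> \<int>"
    and \<phi>: "fps_nth \<phi> 0 = 0" "cmod (fps_nth \<phi> 1) \<ge> 1"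
    and B: "\<And>i j. j < i \<Longrightarrow> B i j = 0" "\<And>j. B j j = 1"
    and bound: "\<And>j n. j < N \<Longrightarrow>
        cmod (fps_nth (((\<Sum>i<N. fps_const (B i j) * complexify (E i)) oo \<phi>) * q) n) \<le> C j"
  shows "cmod (fps_nth \<phi> 1) ^ (\<Sum>s<N. s) * cmod (fps_nth q 0) ^ N \<le> fact N * (\<Prod>j<N. C j)"
proof -
  have "\<exists>\<epsilon> c. (\<forall>r<N. \<epsilon> r = (\<Sum>i<N. fps_const (c r i) * E i) \<and> \<epsilon> r \<noteq> 0) \<and>
      (\<forall>r s. r < s \<longrightarrow> s < N \<longrightarrow> subdegree (\<epsilon> r) < subdegree (\<epsilon> s))"
    using exists_echelon_combinations[of "{..<N}" E] indep by simp
  then obtain \<epsilon> c where "\<forall>r<N. \<epsilon> r = (\<Sum>i<N. fps_const (c r i) * E i) \<and> \<epsilon> r \<noteq> 0"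
      and mono: "\<forall>r s. r < s \<longrightarrow> s < N \<longrightarrow> subdegree (\<epsilon> r) < subdegree (\<epsilon> s)"
    by (elim exE conjE) (rule that)
  then have \<epsilon>: "\<And>r. r < N \<Longrightarrow> \<epsilon> r = (\<Sum>i<N. fps_const (c r i) * E i)"
      and \<epsilon>_nz: "\<And>r. r < N \<Longrightarrow> \<epsilon> r \<noteq> 0" by blast+
  define n where "n r = subdegree (\<epsilon> r)" for r
  define lc where "lc r = (of_rat (fps_nth (\<epsilon> r) (n r)) :: complex)" for r
  define Z where "Z = Matrix.mat N N (\<lambda>(s, j). of_rat (fps_nth (E j oo x) (n s)) :: complex)"
  define Y where "Y = Matrix.mat N N (\<lambda>(s, j). fps_nth ((complexify (E j) oo \<phi>) * q) (n s))"
  define M where "M = Matrix.mat N N (\<lambda>(i, r). of_rat (c r i) :: complex)"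
  define U where "U = Matrix.mat N N (\<lambda>(i, j). B i j)"
  have carr [simp]: "Z \<in> carrier_mat N N" "Y \<in> carrier_mat N N" "M \<in> carrier_mat N N" "U \<in> carrier_mat N N"
    by (auto simp: Z_def Y_def M_def U_def)
  have carr_mult [simp]: "Z * M \<in> carrier_mat N N" "Y * M \<in> carrier_mat N N" "Y * U \<in> carrier_mat N N"
    by (rule mult_carrier_mat[OF carr(1) carr(3)] mult_carrier_mat[OF carr(2) carr(3)]
        mult_carrier_mat[OF carr(2) carr(4)])+
  have n_mono: "r < s \<Longrightarrow> s < N \<Longrightarrow> n r < n s" for r s using mono by (simp add: n_def)
  have le_n: "s < N \<Longrightarrow> s \<le> n s" for s
  proof (induction s)
    case (Suc s)
    then have "s \<le> n s" "n s < n (Suc s)" using n_mono[of s "Suc s"] by auto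
    then show ?case by simp
  qed simp
  have lc_nz: "lc r \<noteq> 0" if "r < N" for r using \<epsilon>_nz[OF that] by (simp add: lc_def n_def)
  \<comment> \<open>Passing to the echelon combinations makes both matrices lower triangular.\<close>
  have ZM: "(Z * M) $$ (s, r) = of_rat (fps_nth (\<epsilon> r oo x) (n s))" if "s < N" "r < N" for s r
  proof -
    have "fps_nth (\<epsilon> r oo x) (n s) = (\<Sum>i<N. c r i * fps_nth (E i oo x) (n s))"
      by (simp add: \<epsilon>[OF that(2)] fps_compose_combination[OF x(1)] fps_sum_nth)
    then show ?thesis
      using that by (simp add: Z_def M_def scalar_prod_def of_rat_sum of_rat_mult lessThan_atLeast0 mult.commute)
  qed
  have YM: "(Y * M) $$ (s, r) = fps_nth ((complexify (\<epsilon> r) oo \<phi>) * q) (n s)" if "s < N" "r < N" for s r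
  proof -
    have "fps_nth ((complexify (\<epsilon> r) oo \<phi>) * q) (n s)
        = (\<Sum>i<N. of_rat (c r i) * fps_nth ((complexify (E i) oo \<phi>) * q) (n s))"
      by (simp add: \<epsilon>[OF that(2)] complexify_sum fps_compose_combination[OF \<phi>(1)]
          fps_sum_nth sum_distrib_right mult.assoc)
    then show ?thesis
      using that by (simp add: Y_def M_def scalar_prod_def lessThan_atLeast0 mult.commute)
  qed
  have sub: "subdegree (complexify (\<epsilon> r)) = n r" if "r < N" for r
    using \<epsilon>_nz[OF that] unfolding n_def by (intro subdegreeI) auto
  have low: "fps_nth (complexify (\<epsilon> r) oo \<phi>) k = 0" if "r < N" "k < n r" for r k
    using fps_compose_nth_subdegree(1)[OF \<phi>(1), of k "complexify (\<epsilon> r)"] sub that by simp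
  have "Determinant.det (Z * M) = prod_list (diag_mat (Z * M))"
    by (rule det_lower_triangular[of N])
      (auto simp: ZM n_mono fps_compose_nth_subdegree(1)[OF x(1)] n_def[symmetric])
  also have "\<dots> = (\<Prod>r<N. (Z * M) $$ (r, r))"
    by (simp add: diag_mat_def prod.list_conv_set_nth lessThan_atLeast0 Z_def)
  also have "\<dots> = (\<Prod>r<N. lc r)"
    by (intro prod.cong refl)
      (simp add: ZM lc_def n_def fps_compose_nth_subdegree(2)[OF x(1)] x(2)[unfolded One_nat_def])
  finally have detZM: "Determinant.det Z * Determinant.det M = (\<Prod>r<N. lc r)"
    using det_mult[of Z N M] by simp
  have "Determinant.det (Y * M) = prod_list (diag_mat (Y * M))"
  proof (rule det_lower_triangular[of N])
    fix s r assume "s < r" "r < N"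
    then show "(Y * M) $$ (s, r) = 0"
      using fps_mult_nth_lowest(1)[of "n r" "complexify (\<epsilon> r) oo \<phi>" "n s" q, OF low] n_mono[of s r] by (simp add: YM)
  qed simp
  also have "\<dots> = (\<Prod>r<N. (Y * M) $$ (r, r))"
    by (simp add: diag_mat_def prod.list_conv_set_nth lessThan_atLeast0 Y_def)
  also have "\<dots> = (\<Prod>r<N. lc r * (fps_nth \<phi> 1 ^ n r * fps_nth q 0))"
  proof (intro prod.cong refl)
    fix r assume "r \<in> {..<N}"
    then have r: "r < N" by simp
    show "(Y * M) $$ (r, r) = lc r * (fps_nth \<phi> 1 ^ n r * fps_nth q 0)"
      using fps_mult_nth_lowest(2)[where q = q, OF low[OF r]]
        fps_compose_nth_subdegree(2)[OF \<phi>(1), of "complexify (\<epsilon> r)"]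
      by (simp add: YM r sub lc_def)
  qed
  finally have detYM: "Determinant.det Y * Determinant.det M =
      (\<Prod>r<N. lc r) * (\<Prod>r<N. fps_nth \<phi> 1 ^ n r * fps_nth q 0)"
    using det_mult[of Y N M] by (simp add: prod.distrib)
  have nz: "Determinant.det Z \<noteq> 0" "Determinant.det M \<noteq> 0"
    using detZM lc_nz by auto
  have "Determinant.det Y * Determinant.det M =
      Determinant.det Z * (\<Prod>r<N. fps_nth \<phi> 1 ^ n r * fps_nth q 0) * Determinant.det M"
    unfolding detYM detZM[symmetric] by simp
  with nz have detY: "Determinant.det Y = Determinant.det Z * (\<Prod>r<N. fps_nth \<phi> 1 ^ n r * fps_nth q 0)"
    by simp
  have "Determinant.det U = prod_list (diag_mat U)"
    by (rule det_upper_triangular[of _ N]) (auto simp: U_def B)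
  also have "\<dots> = 1"
    by (simp add: diag_mat_def prod.list_conv_set_nth U_def B)
  finally have detU: "Determinant.det U = 1" .
  have Z1: "1 \<le> cmod (Determinant.det Z)"
  proof (rule norm_det_Ints_ge_1[OF carr(1) _ nz(1)])
    fix i j assume ij: "i < N" "j < N"
    obtain k where "fps_nth (E j oo x) (n i) = of_int k" using integral[OF ij(2)] by (auto elim: Ints_cases)
    then show "Z $$ (i, j) \<in> \<int>" using ij by (simp add: Z_def)
  qed
  have "cmod (fps_nth \<phi> 1) ^ (\<Sum>s<N. s) * cmod (fps_nth q 0) ^ N
      \<le> cmod (fps_nth \<phi> 1) ^ (\<Sum>s<N. n s) * cmod (fps_nth q 0) ^ N"
    by (intro mult_right_mono power_increasing sum_mono \<phi>(2)) (auto intro: le_n)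
  also have "\<dots> = cmod (\<Prod>r<N. fps_nth \<phi> 1 ^ n r * fps_nth q 0)"
    by (simp add: norm_mult norm_power prod.distrib power_sum flip: prod_norm)
  also have "\<dots> \<le> cmod (Determinant.det Z) * \<dots>"
    using Z1 mult_right_mono[OF Z1, of "cmod (\<Prod>r<N. fps_nth \<phi> 1 ^ n r * fps_nth q 0)"] by simp
  also have "\<dots> = cmod (Determinant.det (Y * U))"
    using det_mult[of Y N U] by (simp add: detY norm_mult detU)
  also have "\<dots> \<le> fact N * (\<Prod>j<N. C j)"
  proof (rule norm_det_le_column_bounds)
    show "Y * U \<in> carrier_mat N N" by (rule carr_mult)
    fix s j assume sj: "s < N" "j < N"
    have "fps_nth (((\<Sum>i<N. fps_const (B i j) * complexify (E i)) oo \<phi>) * q) (n s)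
        = (\<Sum>i<N. B i j * fps_nth ((complexify (E i) oo \<phi>) * q) (n s))"
      by (simp add: fps_compose_combination[OF \<phi>(1)] fps_sum_nth sum_distrib_right mult.assoc)
    then have "(Y * U) $$ (s, j) = fps_nth (((\<Sum>i<N. fps_const (B i j) * complexify (E i)) oo \<phi>) * q) (n s)"
      using sj by (simp add: Y_def U_def scalar_prod_def lessThan_atLeast0 mult.commute)
    then show "cmod ((Y * U) $$ (s, j)) \<le> C j" using bound[OF sj(2)] by simp
  qed
  finally show ?thesis .
qed

section \<open>Trigonometric polynomials and Leja points\<close>

text \<open>
  The restrictions to the unit circle of real parts of polynomials are the real trigonometric polynomials. In this form
  they are logarithms of absolute values of zero-free entire functions.
\<close>

definition circle_harmonics :: "(complex \<Rightarrow> real) set" where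
  "circle_harmonics = {f. \<exists>P. \<forall>z\<in>sphere 0 1. f z = Re (poly P z)}"

lemma circle_harmonics_poly: "(\<lambda>z. Re (poly P z)) \<in> circle_harmonics"
  by (auto simp: circle_harmonics_def)

lemma circle_harmonics_cong:
  "f \<in> circle_harmonics \<Longrightarrow> (\<And>z. z \<in> sphere 0 1 \<Longrightarrow> g z = f z) \<Longrightarrow> g \<in> circle_harmonics"
  unfolding circle_harmonics_def by (auto intro: exI)

lemma circle_harmonics_add:
  assumes "f \<in> circle_harmonics" "g \<in> circle_harmonics"
  shows "(\<lambda>z. f z + g z) \<in> circle_harmonics"
proof -
  obtain P Q where "\<forall>z\<in>sphere 0 1. f z = Re (poly P z)" "\<forall>z\<in>sphere 0 1. g z = Re (poly Q z)"
    using assms by (auto simp: circle_harmonics_def)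
  then show ?thesis
    by (intro circle_harmonics_cong[OF circle_harmonics_poly[of "P + Q"]]) auto
qed

lemma circle_harmonics_sum:
  assumes "\<And>i. i \<in> I \<Longrightarrow> f i \<in> circle_harmonics"
  shows "(\<lambda>z. \<Sum>i\<in>I. f i z) \<in> circle_harmonics"
  using assms
proof (induction I rule: infinite_finite_induct)
  case (insert i I)
  then show ?case using circle_harmonics_add[of "f i" "\<lambda>z. \<Sum>i\<in>I. f i z"] by simp
qed (use circle_harmonics_poly[of 0] in auto)

text \<open>
  On the unit circle \<open>cnj z\<close> is the inverse of \<open>z\<close>, so \<open>2 Re u Re v = Re (u v) + Re (cnj u * v)\<close> is again a sum of real
  parts of monomials once the larger exponent is in \<open>v\<close>.
\<close>

lemma circle_harmonics_mult_monom:
  "(\<lambda>z. Re (a * z ^ i) * Re (b * z ^ j)) \<in> circle_harmonics"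
proof (induction i j arbitrary: a b rule: linorder_wlog)
  case (le j i)
  show ?case
  proof (rule circle_harmonics_cong[OF circle_harmonics_poly])
    fix z :: complex assume "z \<in> sphere 0 1"
    then have z: "z * cnj z = 1" by (simp add: complex_norm_square[symmetric])
    have split: "z ^ i = z ^ j * z ^ (i - j)" using le by (simp flip: power_add)
    have "cnj (a * z ^ j) * (b * z ^ i) = (z * cnj z) ^ j * (cnj a * b * z ^ (i - j))"
      by (simp add: split power_mult_distrib)
    moreover have "Re u * Re v = (Re (u * v) + Re (cnj u * v)) / 2" for u v :: complex
      by simp
    ultimately have "Re (a * z ^ j) * Re (b * z ^ i) = (Re (a * z ^ j * (b * z ^ i)) + Re (cnj a * b * z ^ (i - j))) / 2"
      by (metis z power_one mult_1)
    then show "Re (a * z ^ j) * Re (b * z ^ i) =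
        Re (poly (Polynomial.monom (a * b / 2) (j + i) + Polynomial.monom (cnj a * b / 2) (i - j)) z)"
      by (simp add: poly_monom power_add mult_ac add_divide_distrib del: times_divide_eq_left)
  qed
next
  case (sym i j)
  then show ?case using sym[of b a] by (simp only: mult.commute[of "Re (b * _)"])
qed

lemma circle_harmonics_mult:
  assumes "f \<in> circle_harmonics" "g \<in> circle_harmonics"
  shows "(\<lambda>z. f z * g z) \<in> circle_harmonics"
proof -
  obtain P Q where "\<forall>z\<in>sphere 0 1. f z = Re (poly P z)" "\<forall>z\<in>sphere 0 1. g z = Re (poly Q z)"
    using assms by (auto simp: circle_harmonics_def)
  then show ?thesis
    by (intro circle_harmonics_cong[OF circle_harmonics_sum[OF circle_harmonics_sum[OF circle_harmonics_mult_monom]]])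
      (auto simp: poly_altdef sum_product)
qed

lemma real_part_poly_approximation:
  assumes "continuous_on (sphere 0 1) u" and "\<delta> > 0"
  obtains P where "\<And>z. z \<in> sphere 0 1 \<Longrightarrow> \<bar>u z - Re (poly P z)\<bar> < \<delta>"
proof -
  interpret function_ring_on circle_harmonics "sphere 0 1 :: complex set"
  proof
    show "(\<lambda>_. c) \<in> circle_harmonics" for c
      using circle_harmonics_poly[of "[:of_real c:]"] by simp
    show "continuous_on (sphere 0 1) f" if f: "f \<in> circle_harmonics" for f
    proof -
      obtain P where P: "\<forall>z\<in>sphere 0 1. f z = Re (poly P z)" using f by (auto simp: circle_harmonics_def)
      have "continuous_on (sphere 0 1) (\<lambda>z. Re (poly P z))" by (intro continuous_intros)
      then show ?thesis by (rule continuous_on_eq) (use P in auto)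
    qed
    fix x y :: complex assume "x \<noteq> y"
    then have "Re (poly [:0, 1:] x) \<noteq> Re (poly [:0, 1:] y) \<or> Re (poly [:0, -\<i>:] x) \<noteq> Re (poly [:0, -\<i>:] y)"
      by (auto simp: complex_eq_iff)
    then show "\<exists>f\<in>circle_harmonics. f x \<noteq> f y"
      by (elim disjE; intro bexI[OF _ circle_harmonics_poly])
  qed (auto intro: circle_harmonics_add circle_harmonics_mult)
  obtain f where "f \<in> circle_harmonics" "\<forall>z\<in>sphere 0 1. \<bar>u z - f z\<bar> < \<delta>"
    using Stone_Weierstrass_basic[OF assms] by blast
  then show thesis using that by (force simp: circle_harmonics_def)
qed

text \<open>
  A mean value property over finitely many points: the sum of the \<open>k\<close>-th powers of the \<open>n\<close>-th roots of unity vanishes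
  for \<open>0 < k < n\<close>.
\<close>

lemma sum_poly_roots_of_unity:
  fixes P :: "complex poly"
  assumes "Polynomial.degree P < n"
  shows "(\<Sum>i<n. poly P (cis (2 * pi * (real i / real n)))) = n * poly P 0"
proof -
  have inner: "(\<Sum>i<n. cis (2 * pi * (real i / real n)) ^ k) = (if k = 0 then of_nat n else 0)" if "k < n" for k
  proof (cases "k = 0")
    case False
    define \<omega> where "\<omega> = cis (2 * pi * (real k / real n))"
    have \<omega>: "\<omega> = exp (2 * complex_of_real pi * \<i> * of_nat k / of_nat n)"
      by (simp add: \<omega>_def cis_conv_exp mult_ac)
    have "\<omega> \<noteq> 1"
      unfolding \<omega> using complex_root_unity_eq_1[of n k] False that by (auto dest: dvd_imp_le)
    moreover have "\<omega> ^ n = 1"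
      using that cis_multiple_2pi[of "of_nat k"] by (simp add: \<omega>_def Complex.DeMoivre)
    moreover have "cis (2 * pi * (real i / real n)) ^ k = \<omega> ^ i" for i :: nat
      by (simp add: \<omega>_def Complex.DeMoivre mult_ac)
    ultimately show ?thesis using False by (simp add: geometric_sum del: times_divide_eq_right)
  qed simp
  have "(\<Sum>i<n. poly P (cis (2 * pi * (real i / real n)))) =
      (\<Sum>k\<le>Polynomial.degree P. Polynomial.coeff P k * (\<Sum>i<n. cis (2 * pi * (real i / real n)) ^ k))"
    by (simp only: poly_altdef sum_distrib_left) (rule sum.swap)
  also have "\<dots> = (\<Sum>k\<in>{0}. Polynomial.coeff P k * (\<Sum>i<n. cis (2 * pi * (real i / real n)) ^ k))"
    using assms by (intro sum.mono_neutral_right) (auto simp: inner simp del: times_divide_eq_right)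
  also have "\<dots> = n * poly P 0" by (simp add: poly_0_coeff_0)
  finally show ?thesis .
qed

text \<open>
  Each point is chosen to maximise the weighted product of distances to its predecessors. So the maximal values are
  attained at the points themselves, and their product is a weighted Vandermonde
  product.
\<close>

lemma weighted_leja_sequence:
  fixes g :: "complex \<Rightarrow> complex" and W :: "complex \<Rightarrow> real"
  assumes "compact S" "S \<noteq> {}" "continuous_on S g" "continuous_on S W"
  shows "\<exists>z :: nat \<Rightarrow> complex. \<forall>k. z k \<in> S \<and> (\<forall>\<zeta>\<in>S. (\<Prod>t<k. cmod (g \<zeta> - g (z t))) * exp (- W \<zeta>)
                      \<le> (\<Prod>t<k. cmod (g (z k) - g (z t))) * exp (- W (z k)))"
    (is "\<exists>z. \<forall>k. ?P z k (z k)")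
proof (rule dependent_wellorder_choice[where P = ?P])
  fix k and z :: "nat \<Rightarrow> complex"
  have "continuous_on S (\<lambda>\<zeta>. (\<Prod>t<k. cmod (g \<zeta> - g (z t))) * exp (- W \<zeta>))"
    by (intro continuous_intros assms)
  from continuous_attains_sup[OF assms(1,2) this]
  show "\<exists>r. r \<in> S \<and> (\<forall>\<zeta>\<in>S. (\<Prod>t<k. cmod (g \<zeta> - g (z t))) * exp (- W \<zeta>)
                    \<le> (\<Prod>t<k. cmod (g r - g (z t))) * exp (- W r))"
    by blast
next
  fix r k and z z' :: "nat \<Rightarrow> complex"
  assume "\<And>t. t < k \<Longrightarrow> z t = z' t"
  then have "(\<Prod>t<k. cmod (g \<zeta> - g (z t))) = (\<Prod>t<k. cmod (g \<zeta> - g (z' t)))" for \<zeta>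
    by (intro prod.cong) auto
  then show "(r \<in> S \<and> (\<forall>\<zeta>\<in>S. (\<Prod>t<k. cmod (g \<zeta> - g (z t))) * exp (- W \<zeta>)
                    \<le> (\<Prod>t<k. cmod (g r - g (z t))) * exp (- W r))) =
    (r \<in> S \<and> (\<forall>\<zeta>\<in>S. (\<Prod>t<k. cmod (g \<zeta> - g (z' t))) * exp (- W \<zeta>)
                    \<le> (\<Prod>t<k. cmod (g r - g (z' t))) * exp (- W r)))"
    by simp
qed

lemma sum_symmetric_offdiagonal:
  fixes K :: "nat \<Rightarrow> nat \<Rightarrow> real"
  assumes "\<And>a b. K a b = K b a"
  shows "(\<Sum>a<D. \<Sum>b<D. K a b) = 2 * (\<Sum>k<D. \<Sum>t<k. K k t) + (\<Sum>a<D. K a a)"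
proof (induction D)
  case (Suc D)
  have "(\<Sum>a<D. K a D) = (\<Sum>a<D. K D a)" by (simp add: assms[of _ D])
  with Suc show ?case by (simp add: sum.distrib)
qed simp

text \<open>
  This is Cauchy's estimate on the unit circle.
\<close>

lemma fps_nth_le_sup_circle:
  fixes G :: "complex fps"
  assumes "fps_conv_radius G > 1" and "\<And>z. cmod z = 1 \<Longrightarrow> cmod (eval_fps G z) \<le> C"
  shows "cmod (fps_nth G n) \<le> C"
proof -
  have sub: "(cball 0 1 :: complex set) \<subseteq> eball 0 (fps_conv_radius G)"
  proof
    fix z :: complex assume "z \<in> cball 0 1"
    then have "ereal (cmod z) \<le> 1" by (simp add: one_ereal_def)
    then show "z \<in> eball 0 (fps_conv_radius G)" using le_less_trans[of "ereal (cmod z)" 1, OF _ assms(1)] by simp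
  qed
  have "cmod ((deriv ^^ n) (eval_fps G) 0) \<le> fact n * C / 1 ^ n"
    by (rule Cauchy_inequality)
      (use sub assms(2) in \<open>auto intro!: holomorphic_on_eval_fps continuous_on_subset[OF continuous_on_eval_fps] dest: subsetD[OF ball_subset_cball]\<close>)
  moreover have "fps_conv_radius G > 0" using assms(1) by (rule less_trans[rotated]) simp
  ultimately show ?thesis
    by (simp add: fps_nth_conv_deriv norm_divide divide_le_eq mult.commute)
qed

section \<open>The determinant inequality at Leja points\<close>

lemma fps_conv_radius_gt_mult:
  "r < fps_conv_radius f \<Longrightarrow> r < fps_conv_radius g \<Longrightarrow> r < fps_conv_radius (f * g :: complex fps)"
  by (rule less_le_trans[OF _ fps_conv_radius_mult]) simp

lemma fps_conv_radius_gt_add: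
  "r < fps_conv_radius f \<Longrightarrow> r < fps_conv_radius g \<Longrightarrow> r < fps_conv_radius (f + g :: complex fps)"
  by (rule less_le_trans[OF _ fps_conv_radius_add]) simp

text \<open>
  The polynomial expression \<open>Q(F)\<close>, with the coefficients of \<open>Q\<close> regarded as constant series.
\<close>

definition fps_poly :: "'a :: comm_ring_1 poly \<Rightarrow> 'a fps \<Rightarrow> 'a fps" where
  "fps_poly Q F = poly (map_poly fps_const Q) F"

lemma fps_poly_0 [simp]: "fps_poly 0 F = 0"
  by (simp add: fps_poly_def)

lemma fps_poly_pCons [simp]: "fps_poly (pCons a Q) F = fps_const a + F * fps_poly Q F"
  by (cases "a = 0 \<and> Q = 0") (auto simp: fps_poly_def map_poly_pCons)

lemma fps_poly_altdef:
  assumes "Polynomial.degree Q < D"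
  shows "fps_poly Q F = (\<Sum>k<D. fps_const (Polynomial.coeff Q k) * F ^ k)"
proof -
  have "fps_poly Q F = (\<Sum>k\<le>Polynomial.degree Q. fps_const (Polynomial.coeff Q k) * F ^ k)"
    by (simp add: fps_poly_def poly_altdef coeff_map_poly degree_map_poly)
  also have "\<dots> = (\<Sum>k<D. fps_const (Polynomial.coeff Q k) * F ^ k)"
    using assms by (intro sum.mono_neutral_left) (auto simp: coeff_eq_0)
  finally show ?thesis .
qed

lemma fps_poly_compose:
  fixes \<phi> :: "'a :: field fps"
  assumes "fps_nth \<phi> 0 = 0"
  shows "fps_poly Q F oo \<phi> = fps_poly Q (F oo \<phi>)"
  by (induction Q) (simp_all add: fps_compose_add_distrib fps_compose_mult_distrib[OF assms])

lemma fps_conv_radius_fps_poly: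
  assumes "r < fps_conv_radius F"
  shows "r < fps_conv_radius (fps_poly Q F :: complex fps)"
proof (induction Q)
  case 0
  then show ?case using assms by (cases r) auto
next
  case (pCons a Q)
  have "r < fps_conv_radius (fps_const a)" using assms by (cases r) auto
  then show ?case by (simp add: fps_conv_radius_gt_add fps_conv_radius_gt_mult pCons assms)
qed

lemma eval_fps_fps_poly:
  assumes "ereal (cmod z) < fps_conv_radius F"
  shows "eval_fps (fps_poly Q F) z = poly Q (eval_fps F z)"
proof (induction Q)
  case (pCons a Q)
  have "ereal (cmod z) < fps_conv_radius (F * fps_poly Q F)"
    by (intro fps_conv_radius_gt_mult fps_conv_radius_fps_poly assms)
  then show ?case
    using pCons assms by (simp add: eval_fps_add eval_fps_mult fps_conv_radius_fps_poly)
qed simp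

lemma block_index_less: "k < D \<Longrightarrow> i < m \<Longrightarrow> k * m + i < D * (m :: nat)"
  using mult_le_mono1[of "Suc k" D m] by simp

lemma sum_div_mod:
  fixes t :: "nat \<Rightarrow> nat \<Rightarrow> 'a :: comm_monoid_add"
  assumes "m > 0"
  shows "(\<Sum>j<D * m. t (j div m) (j mod m)) = (\<Sum>k<D. \<Sum>i<m. t k i)"
  unfolding sum.cartesian_product
  by (rule sum.reindex_bij_witness[where i = "\<lambda>(k, i). k * m + i" and j = "\<lambda>j. (j div m, j mod m)"])
    (use assms in \<open>auto simp: less_mult_imp_div_less intro: block_index_less\<close>)

lemma prod_div:
  fixes u :: "nat \<Rightarrow> 'a :: comm_semiring_1"
  assumes "m > 0"
  shows "(\<Prod>j<D * m. u (j div m)) = (\<Prod>k<D. u k) ^ m"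
proof -
  have "(\<Prod>j<D * m. u (j div m)) = (\<Prod>(k, i)\<in>{..<D} \<times> {..<m}. u k)"
    by (rule prod.reindex_bij_witness[where i = "\<lambda>(k, i). k * m + i" and j = "\<lambda>j. (j div m, j mod m)"])
      (use assms in \<open>auto simp: less_mult_imp_div_less intro: block_index_less\<close>)
  also have "\<dots> = (\<Prod>k<D. u k ^ m)"
    by (simp add: prod.cartesian_product[symmetric])
  finally show ?thesis by (simp add: prod_power_distrib)
qed

lemma newton_poly:
  fixes w :: "nat \<Rightarrow> complex"
  shows "Polynomial.degree (\<Prod>t<k. [:- w t, 1:]) = k" "Polynomial.coeff (\<Prod>t<k. [:- w t, 1:]) k = 1"
proof -
  have "Polynomial.degree (\<Prod>t<k. [:- w t, 1:]) = k \<and> Polynomial.lead_coeff (\<Prod>t<k. [:- w t, 1:]) = 1"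
  proof (induction k)
    case (Suc k)
    have nz: "(\<Prod>t<k. [:- w t, 1:]) \<noteq> 0" by simp
    have "Polynomial.degree ((\<Prod>t<k. [:- w t, 1:]) * [:- w k, 1:]) = Suc k"
      using Suc by (subst degree_mult_eq[OF nz]) auto
    moreover have "Polynomial.lead_coeff ((\<Prod>t<k. [:- w t, 1:]) * [:- w k, 1:]) = 1"
      using Suc by (subst Polynomial.lead_coeff_mult) auto
    ultimately show ?case by (simp only: prod.lessThan_Suc simp_thms)
  qed simp
  then show "Polynomial.degree (\<Prod>t<k. [:- w t, 1:]) = k" "Polynomial.coeff (\<Prod>t<k. [:- w t, 1:]) k = 1" by auto
qed

text \<open>
  The series \<open>\<phi>\<close> is a second substitution, under which the \<open>h i\<close> need not be integral but converge
  on a disc of radius greater than \<open>1\<close>.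
\<close>

locale integral_family =
  fixes f x :: "rat fps" and h :: "nat \<Rightarrow> rat fps" and m :: nat and \<phi> :: "complex fps"
  assumes m_pos: "m > 0"
    and indep: "\<And>D c. (\<Sum>k<D. \<Sum>i<m. fps_const (c k i) * (f ^ k * h i)) = 0 \<Longrightarrow> \<forall>k<D. \<forall>i<m. c k i = 0"
    and x: "fps_nth x 0 = 0" "fps_nth x 1 = 1"
    and integral: "\<And>n. fps_nth (f oo x) n \<in> \<int>" "\<And>i n. i < m \<Longrightarrow> fps_nth (h i oo x) n \<in> \<int>"
    and \<phi>: "fps_nth \<phi> 0 = 0" "cmod (fps_nth \<phi> 1) \<ge> 1"
    and conv: "1 < fps_conv_radius (complexify f oo \<phi>)" "\<And>i. i < m \<Longrightarrow> 1 < fps_conv_radius (complexify (h i) oo \<phi>)"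
begin

definition g :: "complex \<Rightarrow> complex" where
  "g = eval_fps (complexify f oo \<phi>)"

lemma continuous_on_circle:
  "1 < fps_conv_radius F \<Longrightarrow> continuous_on (sphere 0 1) (eval_fps (F :: complex fps))"
  by (intro continuous_on_subset[OF continuous_on_eval_fps]) (auto simp: one_ereal_def)

lemma g_continuous: "continuous_on (sphere 0 1) g"
  unfolding g_def by (rule continuous_on_circle[OF conv(1)])

text \<open>
  The column of index \<open>j = k * m + i\<close> is \<open>Q\<^sub>k(f) h\<^sub>i\<close>, where \<open>Q\<^sub>k\<close> is the monic polynomial with roots \<open>g (z t)\<close>
  for \<open>t < k\<close>. The passage from the \<open>f^k h\<^sub>i\<close> to these series is unipotent, so that
  \<open>lattice_determinant_inequality\<close> applies with \<open>q = exp (- D * P)\<close>.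
\<close>

lemma determinant_bound_at_leja_points:
  fixes P :: "complex poly" and C :: real and \<mu> :: "nat \<Rightarrow> real" and D :: nat
  assumes C: "\<And>i z. i < m \<Longrightarrow> cmod z = 1 \<Longrightarrow> cmod (eval_fps (complexify (h i) oo \<phi>) z) \<le> C"
    and leja: "\<And>k \<zeta>. \<zeta> \<in> sphere 0 1 \<Longrightarrow> (\<Prod>t<k. cmod (g \<zeta> - g (z t))) * exp (- (D * Re (poly P \<zeta>))) \<le> \<mu> k"
  shows "cmod (fps_nth \<phi> 1) ^ (\<Sum>s<D * m. s) * exp (- (D * Re (poly P 0))) ^ (D * m)
      \<le> fact (D * m) * (C ^ (D * m) * (\<Prod>k<D. \<mu> k) ^ m)"
proof -
  define E where "E j = f ^ (j div m) * h (j mod m)" for j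
  define Q where "Q k = (\<Prod>t<k. [:- g (z t), 1:])" for k
  \<comment> \<open>The entry for \<open>i = k' * m + i'\<close> and \<open>j = k * m + i'\<close> is the coefficient of \<open>f^k'\<close> in \<open>Q k\<close>.\<close>
  define B where "B i j = (if i mod m = j mod m then Polynomial.coeff (Q (j div m)) (i div m) else 0)" for i j
  define e where "e \<zeta> = exp (- (of_nat D * poly P \<zeta>))" for \<zeta>
  define q where "q = fps_expansion e 0"
  have e_hol: "e holomorphic_on eball 0 \<infinity>"
    unfolding e_def by (intro holomorphic_intros)
  have q_conv: "fps_conv_radius q = \<infinity>"
    using conv_radius_fps_expansion[OF e_hol] by (simp add: q_def)
  have q_eval: "eval_fps q \<zeta> = e \<zeta>" for \<zeta>
    using eval_fps_expansion'[OF e_hol, of \<zeta>] by (simp add: q_def)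
  have norm_e: "cmod (e \<zeta>) = exp (- (D * Re (poly P \<zeta>)))" for \<zeta>
    by (simp add: e_def)
  have degQ: "Polynomial.degree (Q k) = k" "Polynomial.coeff (Q k) k = 1" for k
    by (simp_all add: Q_def newton_poly)
  have "cmod (fps_nth \<phi> 1) ^ (\<Sum>s<D * m. s) * cmod (fps_nth q 0) ^ (D * m)
      \<le> fact (D * m) * (\<Prod>j<D * m. C * \<mu> (j div m))"
  proof (rule lattice_determinant_inequality[where E = E and x = x and B = B])
    fix c assume 0: "(\<Sum>j<D * m. fps_const (c j) * E j) = 0"
    have "(\<Sum>k<D. \<Sum>i<m. fps_const (c (k * m + i)) * (f ^ k * h i)) = (\<Sum>j<D * m. fps_const (c j) * E j)"
      using sum_div_mod[OF m_pos, of "\<lambda>k i. fps_const (c (k * m + i)) * (f ^ k * h i)" D]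
      by (simp add: E_def)
    with 0 indep[where D = D and c = "\<lambda>k i. c (k * m + i)"] have *: "c (k * m + i) = 0" if "k < D" "i < m" for k i
      using that by simp
    show "\<forall>j<D * m. c j = 0"
      using *[of "j div m" "j mod m" for j] m_pos by (auto simp: less_mult_imp_div_less)
  next
    fix j n assume "j < D * m"
    have pow: "fps_nth ((f ^ k * h i) oo x) n \<in> \<int>" if "i < m" for k i n
    proof (induction k arbitrary: n)
      case 0
      then show ?case using integral(2)[OF that] by simp
    next
      case (Suc k)
      have "(f ^ Suc k * h i) oo x = (f oo x) * ((f ^ k * h i) oo x)"
        by (simp add: fps_compose_mult_distrib[OF x(1)] mult.assoc)
      then show ?case using Suc integral(1) by (auto simp: fps_mult_nth intro!: Ints_sum Ints_mult)
    qed
    show "fps_nth (E j oo x) n \<in> \<int>"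
      unfolding E_def using pow m_pos by simp
  next
    fix i j :: nat assume "j < i"
    show "B i j = 0"
    proof (cases "i mod m = j mod m")
      case True
      with \<open>j < i\<close> have "j div m \<noteq> i div m" by (metis div_mult_mod_eq less_irrefl)
      moreover have "j div m \<le> i div m" using \<open>j < i\<close> by (simp add: div_le_mono)
      ultimately show ?thesis by (simp add: B_def degQ coeff_eq_0)
    qed (simp add: B_def)
  next
    show "B j j = 1" for j by (simp add: B_def degQ)
  next
    fix j n assume j: "j < D * m"
    define k where "k = j div m"
    define i where "i = j mod m"
    have k: "k < D" and i: "i < m" using j m_pos by (auto simp: k_def i_def less_mult_imp_div_less)
    have "(\<Sum>l<D * m. fps_const (B l j) * complexify (E l)) = 
        (\<Sum>k'<D. \<Sum>i'<m. (if i' = i then fps_const (Polynomial.coeff (Q k) k') * complexify (f ^ k' * h i') else 0))"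
      using sum_div_mod[OF m_pos, of "\<lambda>k' i'. if i' = i then fps_const (Polynomial.coeff (Q k) k') * complexify (f ^ k' * h i') else 0" D]
      by (simp add: E_def B_def k_def i_def if_distrib if_distribR cong: if_cong)
    also have "\<dots> = (\<Sum>k'<D. fps_const (Polynomial.coeff (Q k) k') * complexify f ^ k') * complexify (h i)"
      using i by (simp add: sum_distrib_right mult.assoc)
    also have "\<dots> = fps_poly (Q k) (complexify f) * complexify (h i)"
      using k by (subst fps_poly_altdef[of _ D]) (auto simp: degQ)
    finally have eq: "((\<Sum>l<D * m. fps_const (B l j) * complexify (E l)) oo \<phi>) * q
        = fps_poly (Q k) (complexify f oo \<phi>) * (complexify (h i) oo \<phi>) * q"
      by (simp add: fps_compose_mult_distrib[OF \<phi>(1)] fps_poly_compose[OF \<phi>(1)])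
    show "cmod (fps_nth (((\<Sum>l<D * m. fps_const (B l j) * complexify (E l)) oo \<phi>) * q) n) \<le> C * \<mu> (j div m)"
      unfolding eq
    proof (rule fps_nth_le_sup_circle)
      have conv': "1 < fps_conv_radius (fps_poly (Q k) (complexify f oo \<phi>))"
        "1 < fps_conv_radius (fps_poly (Q k) (complexify f oo \<phi>) * (complexify (h i) oo \<phi>))"
        by (intro fps_conv_radius_fps_poly fps_conv_radius_gt_mult conv i)+
      show "1 < fps_conv_radius (fps_poly (Q k) (complexify f oo \<phi>) * (complexify (h i) oo \<phi>) * q)"
        by (intro fps_conv_radius_gt_mult conv') (simp add: q_conv one_ereal_def)
      fix \<zeta> :: complex assume \<zeta>: "cmod \<zeta> = 1"
      have "eval_fps (fps_poly (Q k) (complexify f oo \<phi>) * (complexify (h i) oo \<phi>) * q) \<zeta>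
          = poly (Q k) (g \<zeta>) * eval_fps (complexify (h i) oo \<phi>) \<zeta> * e \<zeta>"
        using conv conv' i \<zeta> by (simp add: eval_fps_mult eval_fps_fps_poly q_eval q_conv g_def one_ereal_def[symmetric])
      also have "cmod \<dots> = ((\<Prod>t<k. cmod (g \<zeta> - g (z t))) * exp (- (D * Re (poly P \<zeta>)))) *
           cmod (eval_fps (complexify (h i) oo \<phi>) \<zeta>)"
        by (simp add: norm_mult norm_e Q_def poly_prod flip: prod_norm)
      also have "\<dots> \<le> \<mu> k * C"
        using leja[of \<zeta> k] C[OF i \<zeta>] \<zeta> by (intro mult_mono) (auto intro!: order_trans[OF _ leja[of \<zeta> k]] mult_nonneg_nonneg prod_nonneg)
      finally show "cmod (eval_fps (fps_poly (Q k) (complexify f oo \<phi>) * (complexify (h i) oo \<phi>) * q) \<zeta>) \<le> C * \<mu> (j div m)"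
        by (simp add: mult.commute k_def)
    qed
  qed (use x \<phi> in auto)
  also have "(\<Prod>j<D * m. C * \<mu> (j div m)) = C ^ (D * m) * (\<Prod>k<D. \<mu> k) ^ m"
    by (simp add: prod.distrib prod_div[OF m_pos])
  also have "cmod (fps_nth q 0) = exp (- (D * Re (poly P 0)))"
    using q_eval[of 0] by (simp add: eval_fps_at_0 norm_e)
  finally show ?thesis .
qed

text \<open>
  The logarithm of \<open>determinant_bound_at_leja_points\<close> for a Leja sequence. The polynomial \<open>Re P\<close> is close to the potential of
  the charges at the points \<open>v b\<close>. So the mixed term of \<open>energy_comparison\<close> cancels against the weights, and
  only the self-energy of the points \<open>v b\<close> remains.
\<close>

lemma determinant_energy_bound:
  fixes P :: "complex poly" and v :: "nat \<Rightarrow> complex" and M D :: nat and s C \<delta> :: real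
  assumes "M > 0" "s > 0"
    and C: "C \<ge> 1" "\<And>i z. i < m \<Longrightarrow> cmod z = 1 \<Longrightarrow> cmod (eval_fps (complexify (h i) oo \<phi>) z) \<le> C"
    and P: "\<And>\<zeta>. \<zeta> \<in> sphere 0 1 \<Longrightarrow> \<bar>(\<Sum>b<M. log_kernel s (g \<zeta> - v b)) / M - Re (poly P \<zeta>)\<bar> \<le> \<delta>"
  shows "(\<Sum>s<D * m. real s) * ln (cmod (fps_nth \<phi> 1)) - D ^ 2 * m * Re (poly P 0)
      \<le> ln (fact (D * m)) + D * m * ln C + m * (D ^ 2 * \<delta> - D * log_kernel s 0 / 2
           - D ^ 2 / 2 * ((\<Sum>a<M. \<Sum>b<M. log_kernel s (v a - v b)) / M ^ 2))"
proof -
  define W where "W \<zeta> = D * Re (poly P \<zeta>)" for \<zeta>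
  let ?K = "log_kernel s"
  let ?I = "\<Sum>a<M. \<Sum>b<M. ?K (v a - v b)"
  have W_cont: "continuous_on (sphere 0 1) W"
    unfolding W_def by (intro continuous_intros)
  have sphere: "(sphere 0 1 :: complex set) \<noteq> {}" by simp
  obtain z :: "nat \<Rightarrow> complex" where *: "\<forall>k. z k \<in> sphere 0 1 \<and> (\<forall>\<zeta>\<in>sphere 0 1. (\<Prod>t<k. cmod (g \<zeta> - g (z t))) * exp (- W \<zeta>)
                      \<le> (\<Prod>t<k. cmod (g (z k) - g (z t))) * exp (- W (z k)))"
    using weighted_leja_sequence[OF compact_sphere sphere g_continuous W_cont] by (elim exE) (rule that)
  then have z: "\<And>k. z k \<in> sphere 0 1"
    and leja: "\<And>k \<zeta>. \<zeta> \<in> sphere 0 1 \<Longrightarrow> (\<Prod>t<k. cmod (g \<zeta> - g (z t))) * exp (- W \<zeta>)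
                      \<le> (\<Prod>t<k. cmod (g (z k) - g (z t))) * exp (- W (z k))"
    by (blast dest: spec)+
  define \<mu> where "\<mu> k = (\<Prod>t<k. cmod (g (z k) - g (z t))) * exp (- W (z k))" for k
  have bound: "cmod (fps_nth \<phi> 1) ^ (\<Sum>s<D * m. s) * exp (- W 0) ^ (D * m)
      \<le> fact (D * m) * (C ^ (D * m) * (\<Prod>k<D. \<mu> k) ^ m)"
    unfolding W_def
    by (rule determinant_bound_at_leja_points[where z = z, OF C(2)])
      (use leja in \<open>simp_all add: \<mu>_def W_def\<close>)
  have norm_pos: "cmod (fps_nth \<phi> 1) > 0" using \<phi>(2) by linarith
  have lhs_pos: "cmod (fps_nth \<phi> 1) ^ (\<Sum>s<D * m. s) * exp (- W 0) ^ (D * m) > 0"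
    using \<phi>(2) by (intro mult_pos_pos zero_less_power) auto
  note rhs_pos = less_le_trans[OF lhs_pos bound]
  have le: "ln (cmod (fps_nth \<phi> 1) ^ (\<Sum>s<D * m. s) * exp (- W 0) ^ (D * m))
        \<le> ln (fact (D * m) * (C ^ (D * m) * (\<Prod>k<D. \<mu> k) ^ m))"
    by (subst ln_le_cancel_iff[OF lhs_pos rhs_pos]) (rule bound)
  have "(\<Prod>k<D. \<mu> k) ^ m \<noteq> 0" using rhs_pos by (metis mult_zero_right less_irrefl)
  then have "(\<Prod>k<D. \<mu> k) \<noteq> 0" using m_pos by auto
  then have \<mu>_pos: "\<mu> k > 0" if "k < D" for k
    using that by (force simp: \<mu>_def less_le intro!: prod_nonneg mult_nonneg_nonneg)
  have distinct: "g (z k) - g (z t) \<noteq> 0" if "k < D" "t < k" for k t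
  proof
    assume "g (z k) - g (z t) = 0"
    then have "(\<Prod>t<k. cmod (g (z k) - g (z t))) = 0" using that(2) by (intro prod_zero) auto
    with \<mu>_pos[OF that(1)] show False unfolding \<mu>_def by simp
  qed
  have "ln (cmod (fps_nth \<phi> 1) ^ (\<Sum>s<D * m. s) * exp (- W 0) ^ (D * m))
      = real (\<Sum>s<D * m. s) * ln (cmod (fps_nth \<phi> 1)) - D * m * W 0"
    using norm_pos by (subst ln_mult_pos[OF zero_less_power[OF norm_pos]]) (simp_all add: ln_realpow)
  moreover have "ln (fact (D * m) * (C ^ (D * m) * (\<Prod>k<D. \<mu> k) ^ m))
      = ln (fact (D * m)) + (D * m * ln C + m * (\<Sum>k<D. ln (\<mu> k)))"
  proof -
    have pos: "C > 0" "(\<Prod>k<D. \<mu> k) > 0" using C(1) \<mu>_pos by (auto intro: prod_pos)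
    have "ln (\<Prod>k<D. \<mu> k) = (\<Sum>k<D. ln (\<mu> k))" using \<mu>_pos by (intro ln_prod) (simp, metis lessThan_iff less_irrefl)
    with pos show ?thesis by (simp add: ln_mult_pos ln_realpow)
  qed
  ultimately have main: "real (\<Sum>s<D * m. s) * ln (cmod (fps_nth \<phi> 1)) - D * m * W 0
      \<le> ln (fact (D * m)) + (D * m * ln C + m * (\<Sum>k<D. ln (\<mu> k)))"
    using le by simp
  have "(\<Sum>k<D. ln (\<mu> k)) \<le> (\<Sum>k<D. (\<Sum>t<k. ?K (g (z k) - g (z t))) - W (z k))"
  proof (rule sum_mono)
    fix k assume "k \<in> {..<D}"
    then have k: "k < D" by simp
    have "ln (\<mu> k) = (\<Sum>t<k. ln (cmod (g (z k) - g (z t)))) - W (z k)"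
      using distinct[OF k] unfolding \<mu>_def
      by (subst ln_mult_pos) (auto intro!: prod_pos ln_prod)
    also have "\<dots> \<le> (\<Sum>t<k. ?K (g (z k) - g (z t))) - W (z k)"
      using distinct[OF k] \<open>s > 0\<close> by (intro diff_right_mono sum_mono ln_le_log_kernel) auto
    finally show "ln (\<mu> k) \<le> (\<Sum>t<k. ?K (g (z k) - g (z t))) - W (z k)" .
  qed
  also have "\<dots> = ((\<Sum>a<D. \<Sum>b<D. ?K (g (z a) - g (z b))) - D * ?K 0) / 2 - (\<Sum>k<D. W (z k))"
    using sum_symmetric_offdiagonal[of "\<lambda>a b. ?K (g (z a) - g (z b))" D]
    by (simp add: log_kernel_minus sum_subtractf)
  finally have upper: "(\<Sum>k<D. ln (\<mu> k))
      \<le> ((\<Sum>a<D. \<Sum>b<D. ?K (g (z a) - g (z b))) - D * ?K 0) / 2 - (\<Sum>k<D. W (z k))" .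
  have "(D / M) * (\<Sum>a<D. \<Sum>b<M. ?K (g (z a) - v b)) = (\<Sum>a<D. D * ((\<Sum>b<M. ?K (g (z a) - v b)) / M))"
    by (simp add: sum_distrib_left sum_divide_distrib)
  also have "\<dots> \<le> (\<Sum>a<D. D * (Re (poly P (z a)) + \<delta>))"
    by (intro sum_mono mult_left_mono) (use P[OF z] in \<open>auto simp: abs_le_iff algebra_simps\<close>)
  also have "\<dots> = (\<Sum>k<D. W (z k)) + D ^ 2 * \<delta>"
    by (simp add: W_def algebra_simps sum.distrib power2_eq_square)
  finally have pot: "(D / M) * (\<Sum>a<D. \<Sum>b<M. ?K (g (z a) - v b)) \<le> (\<Sum>k<D. W (z k)) + D ^ 2 * \<delta>" .
  have "(\<Sum>k<D. ln (\<mu> k)) \<le> D ^ 2 * \<delta> - D * ?K 0 / 2 - D ^ 2 / 2 * (?I / M ^ 2)"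
  proof -
    have "(\<Sum>a<D. \<Sum>b<D. ?K (g (z a) - g (z b)))
        \<le> 2 * ((D / M) * (\<Sum>a<D. \<Sum>b<M. ?K (g (z a) - v b))) - D ^ 2 * (?I / M ^ 2)"
      using energy_comparison[OF \<open>s > 0\<close> \<open>M > 0\<close>, where D = D and w = "\<lambda>a. g (z a)" and v = v]
      by (simp add: power_divide mult.assoc)
    then show ?thesis using upper pot by argo
  qed
  then have "m * (\<Sum>k<D. ln (\<mu> k)) \<le> m * (D ^ 2 * \<delta> - D * ?K 0 / 2 - D ^ 2 / 2 * (?I / M ^ 2))"
    by (intro mult_left_mono) auto
  with main show ?thesis
    by (simp add: W_def power2_eq_square mult_ac)
qed

text \<open>
  Dividing \<open>determinant_energy_bound\<close> by \<open>D\<^sup>2 m / 2\<close> and letting \<open>D\<close> tend to infinity. The number \<open>Re P(0)\<close>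
  is the average of \<open>Re P\<close> over roots of unity, hence close to an average of the potential.
\<close>

lemma rank_bound_discrete:
  fixes v :: "nat \<Rightarrow> complex" and M :: nat and s \<delta> :: real
  assumes "M > 0" "s > 0" "\<delta> > 0"
  shows "\<exists>n0. \<forall>n\<ge>n0. m * ln (cmod (fps_nth \<phi> 1)) \<le>
      2 * ((\<Sum>i<n. \<Sum>b<M. log_kernel s (g (cis (2 * pi * (real i / real n))) - v b)) / (n * M))
      - (\<Sum>a<M. \<Sum>b<M. log_kernel s (v a - v b)) / M ^ 2 + 4 * \<delta>"
proof -
  let ?K = "log_kernel s"
  define u where "u \<zeta> = (\<Sum>b<M. ?K (g \<zeta> - v b)) / M" for \<zeta>
  let ?I = "(\<Sum>a<M. \<Sum>b<M. ?K (v a - v b)) / M ^ 2"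
  let ?l = "ln (cmod (fps_nth \<phi> 1))"
  have "continuous_on (sphere 0 1) u"
    unfolding u_def log_kernel_def
    by (intro continuous_intros g_continuous) (use \<open>s > 0\<close> \<open>M > 0\<close> in \<open>auto simp: add_nonneg_eq_0_iff\<close>)
  then obtain P where P: "\<And>\<zeta>. \<zeta> \<in> sphere 0 1 \<Longrightarrow> \<bar>u \<zeta> - Re (poly P \<zeta>)\<bar> < \<delta>"
    using real_part_poly_approximation[OF _ \<open>\<delta> > 0\<close>] by blast
  obtain C where C: "C \<ge> 1" "\<And>i z. i < m \<Longrightarrow> cmod z = 1 \<Longrightarrow> cmod (eval_fps (complexify (h i) oo \<phi>) z) \<le> C"
  proof -
    have "\<exists>B. \<forall>z\<in>sphere 0 1. cmod (eval_fps (complexify (h i) oo \<phi>) z) \<le> B" if "i < m" for i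
    proof -
      have "continuous_on (sphere 0 1) (eval_fps (complexify (h i) oo \<phi>))"
        by (intro continuous_on_circle conv that)
      from compact_imp_bounded[OF compact_continuous_image[OF this compact_sphere]]
      show ?thesis by (auto simp: bounded_iff)
    qed
    then obtain B where B: "\<And>i z. i < m \<Longrightarrow> z \<in> sphere 0 1 \<Longrightarrow> cmod (eval_fps (complexify (h i) oo \<phi>) z) \<le> B i"
      by metis
    show thesis
    proof (rule that[of "Max (insert 1 (B ` {..<m}))"])
      fix i and z :: complex assume "i < m" "cmod z = 1"
      then show "cmod (eval_fps (complexify (h i) oo \<phi>) z) \<le> Max (insert 1 (B ` {..<m}))"
        by (intro order_trans[OF B Max_ge]) auto
    qed simp
  qed
  have "(m - 1 / D) * ?l - 2 * Re (poly P 0) 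
      \<le> 2 * ln (D * m) / D + 2 * ln C / D - ?K 0 / D + 2 * \<delta> - ?I" if "D \<ge> 1" for D :: nat
  proof -
    have gauss: "(\<Sum>s<N. real s) = real N * (real N - 1) / 2" for N
      by (induction N) (auto simp: field_simps)
    have N: "0 < D * m" using that m_pos by simp
    have "fact (D * m) \<le> real (D * m) ^ (D * m)"
      using fact_le_power[of "D * m", where 'a = real] by simp
    then have "ln (fact (D * m)) \<le> ln (real (D * m) ^ (D * m))" by (intro ln_mono) auto
    then have fact: "ln (fact (D * m)) \<le> D * m * ln (D * m)" using N by (simp add: ln_realpow)
    have "(\<Sum>s<D * m. real s) * ?l - D ^ 2 * m * Re (poly P 0)
        \<le> ln (fact (D * m)) + D * m * ln C + m * (D ^ 2 * \<delta> - D * ?K 0 / 2 - D ^ 2 / 2 * ?I)"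
      using determinant_energy_bound[OF \<open>M > 0\<close> \<open>s > 0\<close> C, where P = P and v = v and \<delta> = \<delta> and D = D] P
      by (fastforce simp: u_def)
    also have "\<dots> \<le> D * m * ln (D * m) + D * m * ln C + m * (D ^ 2 * \<delta> - D * ?K 0 / 2 - D ^ 2 / 2 * ?I)"
      using fact by simp
    finally have "(2 / (D ^ 2 * m)) * (real (D * m) * (real (D * m) - 1) / 2 * ?l - D ^ 2 * m * Re (poly P 0))
        \<le> (2 / (D ^ 2 * m)) * (D * m * ln (D * m) + D * m * ln C + m * (D ^ 2 * \<delta> - D * ?K 0 / 2 - D ^ 2 / 2 * ?I))"
      unfolding gauss by (intro mult_left_mono) auto
    moreover have "(2 / (D ^ 2 * m)) * (real (D * m) * (real (D * m) - 1) / 2 * ?l - D ^ 2 * m * Re (poly P 0))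
        = (m - 1 / D) * ?l - 2 * Re (poly P 0)"
      using that m_pos by (simp add: field_simps power2_eq_square)
    moreover have "(2 / (d\<^sup>2 * e)) * (d * e * L + d * e * c + e * (d\<^sup>2 * \<delta> - d * k / 2 - d\<^sup>2 / 2 * i))
        = 2 * L / d + 2 * c / d - k / d + 2 * \<delta> - i" if "d > 0" "e > 0" for d e L c k i :: real
      using that by (simp add: field_simps power2_eq_square)
    from this[of "real D" "real m" "ln (D * m)" "ln C" "?K 0" ?I]
    have "(2 / (D ^ 2 * m)) * (D * m * ln (D * m) + D * m * ln C + m * (D ^ 2 * \<delta> - D * ?K 0 / 2 - D ^ 2 / 2 * ?I))
        = 2 * ln (D * m) / D + 2 * ln C / D - ?K 0 / D + 2 * \<delta> - ?I"
      using that m_pos by simp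
    ultimately show ?thesis by linarith
  qed
  moreover have "(\<lambda>D::nat. (m - 1 / D) * ?l - 2 * Re (poly P 0)) \<longlonglongrightarrow> (real m - 0) * ?l - 2 * Re (poly P 0)"
    by (intro tendsto_intros lim_1_over_n)
  moreover have "(\<lambda>D::nat. 2 * ln (D * m) / D + 2 * ln C / D - ?K 0 / D + 2 * \<delta> - ?I) \<longlonglongrightarrow> 0 + 0 - 0 + 2 * \<delta> - ?I"
  proof (intro tendsto_intros)
    have "real m > 0" using m_pos by simp
    then show "(\<lambda>D::nat. 2 * ln (real (D * m)) / D) \<longlonglongrightarrow> 0" unfolding of_nat_mult by real_asymp
  qed
  ultimately have limit: "m * ?l - 2 * Re (poly P 0) \<le> 2 * \<delta> - ?I"
    by (intro LIMSEQ_le[of _ "m * ?l - 2 * Re (poly P 0)" _ "2 * \<delta> - ?I"]) auto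
  show ?thesis
  proof (intro exI[of _ "Suc (Polynomial.degree P)"] allI impI)
    fix n assume "n \<ge> Suc (Polynomial.degree P)"
    then have n: "Polynomial.degree P < n" "n > 0" by auto
    have "n * Re (poly P 0) = (\<Sum>i<n. Re (poly P (cis (2 * pi * (real i / real n)))))"
      using arg_cong[OF sum_poly_roots_of_unity[OF n(1)], of Re] by simp
    also have "\<dots> \<le> (\<Sum>i<n. u (cis (2 * pi * (real i / real n))) + \<delta>)"
    proof (rule sum_mono)
      fix i
      show "Re (poly P (cis (2 * pi * (real i / real n)))) \<le> u (cis (2 * pi * (real i / real n))) + \<delta>"
        using P[of "cis (2 * pi * (real i / real n))"] by (simp add: abs_less_iff)
    qed
    also have "\<dots> = n * ((\<Sum>i<n. \<Sum>b<M. ?K (g (cis (2 * pi * (real i / real n))) - v b)) / (n * M) + \<delta>)"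
      using n by (simp add: u_def sum.distrib field_simps flip: sum_divide_distrib)
    finally have "Re (poly P 0) \<le> (\<Sum>i<n. \<Sum>b<M. ?K (g (cis (2 * pi * (real i / real n))) - v b)) / (n * M) + \<delta>"
      using n by simp
    with limit show "m * ?l \<le>
      2 * ((\<Sum>i<n. \<Sum>b<M. ?K (g (cis (2 * pi * (real i / real n))) - v b)) / (n * M)) - ?I + 4 * \<delta>"
      by linarith
  qed
qed

end

section \<open>Passage to the double integral\<close>

lemma riemann_sum_error:
  fixes h :: "real \<Rightarrow> real"
  assumes cont: "continuous_on {0..1} h" and "n > 0"
    and osc: "\<And>x y. x \<in> {0..1} \<Longrightarrow> y \<in> {0..1} \<Longrightarrow> \<bar>x - y\<bar> \<le> 1 / n \<Longrightarrow> \<bar>h x - h y\<bar> \<le> \<delta>"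
  shows "\<bar>(\<Sum>i<n. h (real i / real n)) / n - integral {0..1} h\<bar> \<le> \<delta>"
proof -
  have int: "h integrable_on {a..b}" if "0 \<le> a" "b \<le> 1" for a b
    using that by (intro integrable_continuous_real continuous_on_subset[OF cont]) auto
  have partial: "\<bar>(\<Sum>i<k. h (real i / real n)) / n - integral {0..real k / real n} h\<bar> \<le> k / n * \<delta>"
    if "k \<le> n" for k
    using that
  proof (induction k)
    case (Suc k)
    let ?a = "real k / real n" and ?b = "real (Suc k) / real n"
    have ab: "0 \<le> ?a" "?a \<le> ?b" "?b \<le> 1" "?b - ?a = 1 / n"
      using Suc.prems \<open>n > 0\<close> by (auto simp: divide_simps)
    have "integral {0..?a} h + integral {?a..?b} h = integral {0..?b} h"
      using ab by (intro Henstock_Kurzweil_Integration.integral_combine int) auto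
    moreover have "\<bar>h ?a / n - integral {?a..?b} h\<bar> \<le> \<delta> / n"
    proof -
      have "((\<lambda>x. h x - h ?a) has_integral (integral {?a..?b} h - h ?a / n)) {?a..?b}"
      proof -
        have "((\<lambda>x. h ?a) has_integral (h ?a / n)) {?a..?b}"
          using has_integral_const_real[of "h ?a" ?a ?b] ab by simp
        with int[OF ab(1,3)] show ?thesis by (intro has_integral_diff) (auto simp: has_integral_integral)
      qed
      moreover have "norm (h x - h ?a) \<le> \<delta>" if "x \<in> {?a..?b}" for x
      proof -
        have "?a \<le> x" "x \<le> ?b" using that by auto
        then have "0 \<le> x" "x \<le> 1" "?a \<le> 1" "\<bar>x - ?a\<bar> \<le> 1 / n" using ab by linarith+
        then show ?thesis using osc[of x ?a] ab(1) by simp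
      qed
      moreover have "0 \<le> \<delta>" using osc[of 0 0] by simp
      ultimately have "norm (integral {?a..?b} h - h ?a / n) \<le> \<delta> * measure lborel {?a..?b}"
        by (intro has_integral_bound_real[where S = "{}"]) auto
      then show ?thesis using ab by (simp add: abs_minus_commute)
    qed
    moreover have "\<bar>(\<Sum>i<k. h (real i / real n)) / n - integral {0..?a} h\<bar> \<le> k / n * \<delta>"
      using Suc by simp
    ultimately show ?case
      by (simp add: add_divide_distrib ring_distribs)
  qed simp
  from partial[of n] \<open>n > 0\<close> show ?thesis by simp
qed

lemma double_riemann_sum:
  fixes H :: "real \<times> real \<Rightarrow> real"
  assumes cont: "continuous_on ({0..1} \<times> {0..1}) H" and "\<delta> > 0"
  obtains N where "\<And>n M. n \<ge> N \<Longrightarrow> M \<ge> N \<Longrightarrow> n > 0 \<and> M > 0 \<and>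
     \<bar>(\<Sum>i<n. \<Sum>b<M. H (real i / real n, real b / real M)) / (n * M) - (LINT t : {0..1} \<times> {0..1} | lborel. H t)\<bar> \<le> \<delta>"
proof -
  let ?Q = "{0..1} \<times> {0..1} :: (real \<times> real) set"
  have Q: "?Q = cbox (0, 0) (1, 1)" by (simp add: cbox_Pair_eq)
  have compact: "compact ?Q" unfolding Q by (rule compact_cbox)
  obtain \<eta> where \<eta>: "\<eta> > 0" "\<And>p q. p \<in> ?Q \<Longrightarrow> q \<in> ?Q \<Longrightarrow> dist p q < \<eta> \<Longrightarrow> dist (H p) (H q) < \<delta> / 2"
    using compact_uniformly_continuous[OF cont compact, unfolded uniformly_continuous_on_def] \<open>\<delta> > 0\<close>
    by (metis half_gt_zero)
  obtain N :: nat where N: "N > 0" "1 / N < \<eta>"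
    using \<eta>(1) by (metis inverse_eq_divide reals_Archimedean of_nat_0_less_iff zero_less_Suc)
  define u where "u x = integral {0..1} (\<lambda>y. H (x, y))" for x
  have H_eq: "(LINT t : ?Q | lborel. H t) = integral {0..1} u"
  proof -
    have "set_integrable lborel ?Q H"
      unfolding set_integrable_def
      using borel_integrable_compact[OF compact cont] by (simp add: indicator_scaleR_eq_if)
    then have "(LINT t : ?Q | lborel. H t) = integral ?Q H"
      by (simp add: set_borel_integral_eq_integral)
    also have "\<dots> = integral {0..1} u"
      using integral_prod_continuous[of 0 0 1 1 H] cont by (simp add: Q u_def[abs_def])
    finally show ?thesis .
  qed
  show thesis
  proof (rule that[of N])
    fix n M assume "n \<ge> N" "M \<ge> N"
    then have pos: "n > 0" "M > 0" using N by auto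
    have halves: "\<bar>b - c\<bar> \<le> \<delta> / 2 \<Longrightarrow> \<bar>a - b\<bar> \<le> \<delta> / 2 \<Longrightarrow> \<bar>a - c\<bar> \<le> \<delta>" for a b c :: real
      by linarith
    have "1 / n \<le> 1 / N" "1 / M \<le> 1 / N"
      using \<open>n \<ge> N\<close> \<open>M \<ge> N\<close> N(1) by (auto simp: divide_simps)
    then have small: "1 / n < \<eta>" "1 / M < \<eta>" using N(2) by auto
    have osc1: "\<bar>H (x, y) - H (x', y)\<bar> \<le> \<delta> / 2"
      if "x \<in> {0..1}" "x' \<in> {0..1}" "y \<in> {0..1}" "\<bar>x - x'\<bar> \<le> 1 / n" for x x' y
      using \<eta>(2)[of "(x, y)" "(x', y)"] that small by (simp add: dist_Pair_Pair dist_real_def)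
    have osc2: "\<bar>H (x, y) - H (x, y')\<bar> \<le> \<delta> / 2"
      if "x \<in> {0..1}" "y' \<in> {0..1}" "y \<in> {0..1}" "\<bar>y - y'\<bar> \<le> 1 / M" for x y' y
      using \<eta>(2)[of "(x, y)" "(x, y')"] that small by (simp add: dist_Pair_Pair dist_real_def)
    have cont_y: "continuous_on {0..1} (\<lambda>y. H (x, y))" if "x \<in> {0..1}" for x
      using that by (intro continuous_on_compose2[OF cont] continuous_intros) auto
    have cont_x: "continuous_on {0..1} u"
      unfolding u_def using integral_continuous_on_param[of "{0..1}" 0 1 "\<lambda>x y. H (x, y)"] cont by simp
    have u_osc: "\<bar>u x - u x'\<bar> \<le> \<delta> / 2" if "x \<in> {0..1}" "x' \<in> {0..1}" "\<bar>x - x'\<bar> \<le> 1 / n" for x x'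
    proof -
      have "u x - u x' = integral {0..1} (\<lambda>y. H (x, y) - H (x', y))"
        unfolding u_def using that by (intro integral_diff[symmetric] integrable_continuous_real cont_y)
      also have "norm \<dots> \<le> \<delta> / 2 * (1 - 0)"
        using that by (intro integral_bound continuous_intros cont_y) (use osc1[OF that(1,2) _ that(3)] in auto)
      finally show ?thesis by simp
    qed
    have "\<bar>(\<Sum>i<n. u (real i / real n)) / n - integral {0..1} u\<bar> \<le> \<delta> / 2"
      using u_osc by (intro riemann_sum_error[OF cont_x pos(1)])
    moreover have "\<bar>(\<Sum>i<n. \<Sum>b<M. H (real i / real n, real b / real M)) / (n * M) - (\<Sum>i<n. u (real i / real n)) / n\<bar> \<le> \<delta> / 2"
    proof -
      have "\<bar>(\<Sum>b<M. H (real i / real n, real b / real M)) / M - u (real i / real n)\<bar> \<le> \<delta> / 2" if "i < n" for i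
        unfolding u_def
      proof (rule riemann_sum_error[OF cont_y pos(2)])
        show i: "real i / real n \<in> {0..1}" using that by simp
        show "\<bar>H (real i / real n, y) - H (real i / real n, y')\<bar> \<le> \<delta> / 2"
          if "y \<in> {0..1}" "y' \<in> {0..1}" "\<bar>y - y'\<bar> \<le> 1 / M" for y y'
          by (rule osc2[OF i that(2,1,3)])
      qed
      then have "(\<Sum>i<n. \<bar>(\<Sum>b<M. H (real i / real n, real b / real M)) / M - u (real i / real n)\<bar>) \<le> (\<Sum>i<n. \<delta> / 2)"
        by (intro sum_mono) auto
      then have "\<bar>\<Sum>i<n. ((\<Sum>b<M. H (real i / real n, real b / real M)) / M - u (real i / real n))\<bar> \<le> n * (\<delta> / 2)"
        by (intro order_trans[OF sum_abs]) simp
      moreover have "(\<Sum>i<n. ((\<Sum>b<M. H (real i / real n, real b / real M)) / M - u (real i / real n)))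
         = n * ((\<Sum>i<n. \<Sum>b<M. H (real i / real n, real b / real M)) / (n * M) - (\<Sum>i<n. u (real i / real n)) / n)"
        using pos by (simp add: sum_subtractf right_diff_distrib flip: sum_divide_distrib)
      ultimately show ?thesis using pos by (simp add: abs_mult)
    qed
    ultimately have "\<bar>(\<Sum>i<n. \<Sum>b<M. H (real i / real n, real b / real M)) / (n * M) - integral {0..1} u\<bar> \<le> \<delta>"
      by (rule halves)
    then show "n > 0 \<and> M > 0 \<and>
     \<bar>(\<Sum>i<n. \<Sum>b<M. H (real i / real n, real b / real M)) / (n * M) - (LINT t : ?Q | lborel. H t)\<bar> \<le> \<delta>"
      using pos unfolding H_eq by blast
  qed
qed

text \<open>
  Monotone convergence, with the uniform lower bound \<open>L\<close> in place of an integrability hypothesis. The bound also shows that the zero set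
  of \<open>G\<close> is a null set, so that the convention \<open>ln 0 = 0\<close> does not matter.
\<close>

lemma log_integral_lower_bound:
  fixes G :: "'a :: euclidean_space \<Rightarrow> complex"
  assumes "compact A" and cont: "continuous_on A G"
    and L: "\<And>s. s > 0 \<Longrightarrow> L \<le> (LINT t : A | lborel. log_kernel s (G t))"
  shows "L \<le> (LINT t : A | lborel. ln (cmod (G t)))"
proof -
  define K where "K j t = log_kernel (1 / Suc j) (G t)" for j t
  have A: "A \<in> sets lborel" using \<open>compact A\<close> by (simp add: borel_compact)
  have K_cont: "continuous_on A (K j)" for j
    unfolding K_def log_kernel_def by (intro continuous_intros cont) (auto simp: add_nonneg_eq_0_iff)
  have K_int: "set_integrable lborel A (K j)" for j
    unfolding set_integrable_def
    using borel_integrable_compact[OF \<open>compact A\<close> K_cont] by (simp add: indicator_scaleR_eq_if)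
  have LK: "L \<le> (LINT t : A | lborel. K j t)" for j
    unfolding K_def by (rule L) simp
  have K_anti: "K (Suc j) t \<le> K j t" for j t
  proof -
    have "(cmod (G t))\<^sup>2 + 1 / Suc (Suc j) \<le> (cmod (G t))\<^sup>2 + 1 / Suc j" by (simp add: frac_le)
    then show ?thesis unfolding K_def log_kernel_def
      by (intro divide_right_mono ln_mono) (auto intro: add_nonneg_pos)
  qed
  have K_lim: "(\<lambda>j. K j t) \<longlonglongrightarrow> ln (cmod (G t))" if "G t \<noteq> 0" for t
  proof -
    have "(\<lambda>j. ln ((cmod (G t))\<^sup>2 + 1 / Suc j) / 2) \<longlonglongrightarrow> ln ((cmod (G t))\<^sup>2 + 0) / 2"
      by (intro tendsto_intros LIMSEQ_Suc[OF lim_1_over_n]) (use that in auto)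
    then show ?thesis using that by (simp add: K_def log_kernel_def ln_realpow)
  qed
  define Z where "Z = {t \<in> A. G t = 0}"
  have "closed Z"
    unfolding Z_def using continuous_closed_preimage_constant[OF cont compact_imp_closed[OF \<open>compact A\<close>], of 0] .
  then have Z: "Z \<in> sets lborel" "Z \<subseteq> A" by (auto simp: Z_def)
  obtain b where b: "\<And>t. t \<in> A \<Longrightarrow> K 0 t \<le> b"
    using compact_imp_bounded[OF compact_continuous_image[OF K_cont \<open>compact A\<close>, of 0]]
    by (auto simp: bounded_iff abs_le_iff)
  have fin: "emeasure lborel A < \<infinity>" using \<open>compact A\<close> by (rule emeasure_compact_finite)
  have finZ: "emeasure lborel Z < \<infinity>" using emeasure_mono[OF Z(2), of lborel] A fin by (auto intro: le_less_trans)
  have A_int: "set_integrable lborel A (\<lambda>_. c :: real)" for c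
    using A fin by (simp add: set_integrable_def)
  have Z_int: "set_integrable lborel Z (\<lambda>_. c :: real)" for c
    using Z finZ by (simp add: set_integrable_def)
  \<comment> \<open>On the zero set the regularised logarithms tend to minus infinity, so it must be a null set.\<close>
  have K_le: "K j t \<le> b" if "t \<in> A" for j t
    using K_anti b[OF that] lift_Suc_antimono_le[of "\<lambda>j. K j t" 0 j] by (meson order_trans le0)
  have bound: "L \<le> \<bar>b\<bar> * measure lborel A - (ln (Suc j) / 2) * measure lborel Z" for j
  proof -
    have "(LINT t : A | lborel. K j t) \<le> (LINT t | lborel. indicator A t *\<^sub>R \<bar>b\<bar> - indicator Z t *\<^sub>R (ln (Suc j) / 2))"
      unfolding set_lebesgue_integral_def
    proof (rule integral_mono)
      show "integrable lborel (\<lambda>t. indicator A t *\<^sub>R K j t)" using K_int by (simp add: set_integrable_def)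
      show "integrable lborel (\<lambda>t. indicator A t *\<^sub>R \<bar>b\<bar> - indicator Z t *\<^sub>R (ln (Suc j) / 2))"
        using A_int[of "\<bar>b\<bar>"] Z_int[of "ln (Suc j) / 2"] unfolding set_integrable_def by (rule Bochner_Integration.integrable_diff)
      fix t
      show "indicator A t *\<^sub>R K j t \<le> indicator A t *\<^sub>R \<bar>b\<bar> - indicator Z t *\<^sub>R (ln (Suc j) / 2)"
      proof (cases "t \<in> Z")
        case True
        then have "K j t = - (ln (Suc j) / 2)" by (simp add: Z_def K_def log_kernel_def ln_div)
        then show ?thesis using True Z(2) by (auto simp: indicator_def)
      next
        case False
        then show ?thesis using K_le[of t j] by (auto simp: indicator_def)
      qed
    qed
    also have "\<dots> = \<bar>b\<bar> * measure lborel A - (ln (Suc j) / 2) * measure lborel Z"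
      using A_int[of "\<bar>b\<bar>"] Z_int[of "ln (Suc j) / 2"] A Z
      unfolding set_integrable_def by (subst Bochner_Integration.integral_diff) auto
    finally show ?thesis using LK[of j] by simp
  qed
  have "measure lborel Z = 0"
  proof (rule ccontr)
    assume "measure lborel Z \<noteq> 0"
    then have "measure lborel Z > 0" using measure_nonneg[of lborel Z] by linarith
    then have "filterlim (\<lambda>j. \<bar>b\<bar> * measure lborel A - (ln (Suc j) / 2) * measure lborel Z) at_bot sequentially"
      by real_asymp
    then have "eventually (\<lambda>j. \<bar>b\<bar> * measure lborel A - (ln (Suc j) / 2) * measure lborel Z < L) sequentially"
      by (simp add: filterlim_at_bot_dense)
    then show False using bound by (auto simp: eventually_sequentially not_less[symmetric])
  qed
  then have "emeasure lborel Z = 0" using finZ by (auto simp: measure_def enn2real_eq_0_iff)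
  then have Znull: "Z \<in> null_sets lborel" using Z by blast
  then have ae: "AE t in lborel. t \<notin> Z" by (rule AE_not_in)
  define f where "f j t = - (indicator A t *\<^sub>R K j t)" for j t
  have f_int: "integrable lborel (f j)" for j
    unfolding f_def using K_int by (simp add: set_integrable_def)
  have f_le: "integral\<^sup>L lborel (f j) \<le> - L" for j
    using LK[of j] by (simp add: f_def[abs_def] set_lebesgue_integral_def)
  have f_mono: "mono (\<lambda>j. f j t)" for t
    by (rule incseq_SucI) (use K_anti[of _ t] in \<open>auto simp: f_def indicator_def\<close>)
  have "incseq (\<lambda>j. integral\<^sup>L lborel (f j))"
    by (intro incseq_SucI integral_mono f_int) (use f_mono in \<open>auto simp: mono_def\<close>)
  then obtain l where l: "(\<lambda>j. integral\<^sup>L lborel (f j)) \<longlonglongrightarrow> l"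
    using f_le by (elim incseq_convergent) auto
  then have "l \<le> - L" using f_le by (intro LIMSEQ_le_const2[OF l]) auto
  have lim: "AE t in lborel. (\<lambda>j. f j t) \<longlonglongrightarrow> - (indicator A t *\<^sub>R ln (cmod (G t)))"
    using ae
  proof eventually_elim
    case (elim t)
    then show ?case
      unfolding f_def using K_lim[of t]
      by (cases "t \<in> A") (auto simp: Z_def intro!: tendsto_minus)
  qed
  have meas: "(\<lambda>t. indicator A t *\<^sub>R ln (cmod (G t))) \<in> borel_measurable lborel"
  proof -
    have [measurable]: "(\<lambda>t. indicator A t *\<^sub>R G t) \<in> borel_measurable lborel"
      using borel_measurable_continuous_on_indicator[OF _ cont] A by simp
    have "(\<lambda>t. ln (cmod (indicator A t *\<^sub>R G t))) \<in> borel_measurable lborel"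
      by measurable
    moreover have "ln (cmod (indicator A t *\<^sub>R G t)) = indicator A t *\<^sub>R ln (cmod (G t))" for t
      by (simp add: indicator_def)
    ultimately show ?thesis by simp
  qed
  have "integral\<^sup>L lborel (\<lambda>t. - (indicator A t *\<^sub>R ln (cmod (G t)))) = l"
    by (rule Bochner_Integration.integral_monotone_convergence[OF f_int _ lim l]) (use f_mono meas in auto)
  then have "(LINT t : A | lborel. ln (cmod (G t))) = - l"
    by (simp add: set_lebesgue_integral_def)
  with \<open>l \<le> - L\<close> show ?thesis by simp
qed

context integral_family
begin

text \<open>
  Both charges are now uniform distributions on the images of roots of unity, and the double sums
  become double integrals. The mixed term counts twice and the self-energy counts minus one, which leaves one
  double integral.
\<close>

theorem rank_bound_integral:
  shows "m * ln (cmod (fps_nth \<phi> 1)) \<le>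
     (LINT t : {0..1} \<times> {0..1} | lborel. ln (cmod (g (cis (2 * pi * fst t)) - g (cis (2 * pi * snd t)))))"
proof (rule log_integral_lower_bound)
  let ?Q = "{0..1} \<times> {0..1} :: (real \<times> real) set"
  have "?Q = cbox (0, 0) (1, 1)" by (simp add: cbox_Pair_eq)
  then show "compact ?Q" by (metis compact_cbox)
  show G_cont: "continuous_on ?Q (\<lambda>t. g (cis (2 * pi * fst t)) - g (cis (2 * pi * snd t)))"
  proof (intro continuous_on_diff)
    show "continuous_on ?Q (\<lambda>t. g (cis (2 * pi * fst t)))" "continuous_on ?Q (\<lambda>t. g (cis (2 * pi * snd t)))"
      by (rule continuous_on_compose2[OF g_continuous]; force intro!: continuous_intros)+
  qed
  fix s :: real assume "s > 0"
  define H where "H t = log_kernel s (g (cis (2 * pi * fst t)) - g (cis (2 * pi * snd t)))" for t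
  let ?I = "LINT t : ?Q | lborel. H t"
  have H_cont: "continuous_on ?Q H"
    unfolding H_def log_kernel_def
    by (intro continuous_on_divide continuous_on_ln continuous_on_add continuous_on_power continuous_on_norm
        continuous_on_const G_cont) (use \<open>s > 0\<close> in \<open>auto simp: add_nonneg_eq_0_iff\<close>)
  have "m * ln (cmod (fps_nth \<phi> 1)) \<le> ?I + \<epsilon>" if "\<epsilon> > 0" for \<epsilon>
  proof -
    \<comment> \<open>Seven errors of size \<open>\<delta>\<close> occur: three from Riemann sums and four from \<open>rank_bound_discrete\<close>.\<close>
    define \<delta> where "\<delta> = \<epsilon> / 7"
    have "\<delta> > 0" using that by (simp add: \<delta>_def)
    let ?R = "\<lambda>n M. (\<Sum>i<n. \<Sum>b<M. H (real i / real n, real b / real M)) / (n * M)"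
    from double_riemann_sum[OF H_cont \<open>\<delta> > 0\<close>] obtain N where
      N: "n > 0 \<and> M > 0 \<and> \<bar>?R n M - ?I\<bar> \<le> \<delta>" if "n \<ge> N" "M \<ge> N" for n M
      by blast
    have pos: "N > 0" using N[of N N] by simp
    define v where "v b = g (cis (2 * pi * (real b / real N)))" for b
    have "\<exists>n0. \<forall>n\<ge>n0. m * ln (cmod (fps_nth \<phi> 1)) \<le>
      2 * ((\<Sum>i<n. \<Sum>b<N. log_kernel s (g (cis (2 * pi * (real i / real n))) - v b)) / (n * N))
      - (\<Sum>a<N. \<Sum>b<N. log_kernel s (v a - v b)) / N ^ 2 + 4 * \<delta>"
      by (rule rank_bound_discrete[OF pos \<open>s > 0\<close> \<open>\<delta> > 0\<close>])
    then obtain n0 where n0: "m * ln (cmod (fps_nth \<phi> 1)) \<le>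
      2 * ((\<Sum>i<n. \<Sum>b<N. log_kernel s (g (cis (2 * pi * (real i / real n))) - v b)) / (n * N))
      - (\<Sum>a<N. \<Sum>b<N. log_kernel s (v a - v b)) / N ^ 2 + 4 * \<delta>" if "n \<ge> n0" for n
      by (elim exE) (rule that, blast)
    have "m * ln (cmod (fps_nth \<phi> 1)) \<le> 2 * ?R (max n0 N) N - ?R N N + 4 * \<delta>"
      using n0[of "max n0 N"] by (simp add: H_def v_def power2_eq_square)
    also have "\<dots> \<le> 2 * (?I + \<delta>) - (?I - \<delta>) + 4 * \<delta>"
      using N[of "max n0 N" N] N[of N N] by (intro add_mono diff_mono mult_left_mono) (auto simp: abs_le_iff)
    finally show ?thesis by (simp add: \<delta>_def)
  qed
  then show "m * ln (cmod (fps_nth \<phi> 1)) \<le> (LINT t : ?Q | lborel. log_kernel s (g (cis (2 * pi * fst t)) - g (cis (2 * pi * snd t))))"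
    unfolding H_def by (rule field_le_epsilon)
qed

end

section \<open>Differential equations without singularities\<close>

text \<open>
  The rational functions without poles on \<open>U\<close>, expanded at \<open>0\<close>. This presupposes \<open>0 \<in> U\<close>, where the inverse of the
  denominator is a power series.
\<close>

definition regular_ring :: "complex set \<Rightarrow> complex fps set" where
  "regular_ring U = {fps_of_poly p * inverse (fps_of_poly q) | p q. \<forall>z\<in>U. poly q z \<noteq> 0}"

lemma regular_ringI:
  "(\<And>z. z \<in> U \<Longrightarrow> poly q z \<noteq> 0) \<Longrightarrow> fps_of_poly p * inverse (fps_of_poly q) \<in> regular_ring U"
  unfolding regular_ring_def by blast

lemma regular_ringE:
  assumes "r \<in> regular_ring U" "0 \<in> U"
  obtains p q where "r = fps_of_poly p * inverse (fps_of_poly q)" "\<And>z. z \<in> U \<Longrightarrow> poly q z \<noteq> 0"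
    "fps_nth (fps_of_poly q) 0 \<noteq> 0"
proof -
  obtain p q where "r = fps_of_poly p * inverse (fps_of_poly q)" and q: "\<forall>z\<in>U. poly q z \<noteq> 0"
    using assms(1) unfolding regular_ring_def by blast
  moreover have "fps_nth (fps_of_poly q) 0 \<noteq> 0" using q assms(2) by (auto simp: poly_0_coeff_0)
  ultimately show thesis using that by blast
qed

lemma regular_ring_poly: "fps_of_poly p \<in> regular_ring U"
  using regular_ringI[of U 1 p] by simp

lemma regular_ring_0: "0 \<in> regular_ring U"
  and regular_ring_1: "1 \<in> regular_ring U"
  and regular_ring_const: "fps_const c \<in> regular_ring U"
  using regular_ring_poly[of 0 U] regular_ring_poly[of 1 U] regular_ring_poly[of "[:c:]" U] 
  by (simp_all add: fps_of_poly_const)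

lemma regular_ring_mult:
  assumes "r \<in> regular_ring U" "s \<in> regular_ring U" "0 \<in> U"
  shows "r * s \<in> regular_ring U"
proof -
  obtain p q where r: "r = fps_of_poly p * inverse (fps_of_poly q)" "\<And>z. z \<in> U \<Longrightarrow> poly q z \<noteq> 0"
    using regular_ringE[OF assms(1,3)] by metis
  obtain p' q' where s: "s = fps_of_poly p' * inverse (fps_of_poly q')" "\<And>z. z \<in> U \<Longrightarrow> poly q' z \<noteq> 0"
    using regular_ringE[OF assms(2,3)] by metis
  have "r * s = fps_of_poly (p * p') * inverse (fps_of_poly (q * q'))"
    by (simp add: r s fps_of_poly_mult fps_inverse_mult mult_ac)
  then show ?thesis using regular_ringI[of U "q * q'" "p * p'"] r(2) s(2) by simp
qed

lemma regular_ring_add: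
  assumes "r \<in> regular_ring U" "s \<in> regular_ring U" "0 \<in> U"
  shows "r + s \<in> regular_ring U"
proof -
  obtain p q where r: "r = fps_of_poly p * inverse (fps_of_poly q)" "\<And>z. z \<in> U \<Longrightarrow> poly q z \<noteq> 0"
    and q: "fps_nth (fps_of_poly q) 0 \<noteq> 0"
    using regular_ringE[OF assms(1,3)] by metis
  obtain p' q' where s: "s = fps_of_poly p' * inverse (fps_of_poly q')" "\<And>z. z \<in> U \<Longrightarrow> poly q' z \<noteq> 0"
    and q': "fps_nth (fps_of_poly q') 0 \<noteq> 0"
    using regular_ringE[OF assms(2,3)] by metis
  have "fps_of_poly (p * q' + p' * q) * inverse (fps_of_poly (q * q')) =
     fps_of_poly p * inverse (fps_of_poly q) * (inverse (fps_of_poly q') * fps_of_poly q') +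
     fps_of_poly p' * inverse (fps_of_poly q') * (inverse (fps_of_poly q) * fps_of_poly q)"
    by (simp only: fps_of_poly_mult fps_of_poly_add fps_inverse_mult ring_distribs mult_ac)
  also have "\<dots> = r + s"
    by (simp only: r s inverse_mult_eq_1[OF q] inverse_mult_eq_1[OF q'] mult_1_right)
  finally show ?thesis using regular_ringI[of U "q * q'" "p * q' + p' * q"] r(2) s(2) by simp
qed

lemma regular_ring_uminus: "r \<in> regular_ring U \<Longrightarrow> 0 \<in> U \<Longrightarrow> - r \<in> regular_ring U"
  using regular_ring_mult[OF regular_ring_const[of "-1"], of r U] by (simp flip: fps_const_neg)

lemma regular_ring_deriv:
  assumes "r \<in> regular_ring U" "0 \<in> U"
  shows "fps_deriv r \<in> regular_ring U"
proof -
  obtain p q where r: "r = fps_of_poly p * inverse (fps_of_poly q)" and q: "\<And>z. z \<in> U \<Longrightarrow> poly q z \<noteq> 0"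
    and q0: "fps_nth (fps_of_poly q) 0 \<noteq> 0"
    using regular_ringE[OF assms] by metis
  have inv: "inverse (fps_of_poly q) \<in> regular_ring U" using regular_ringI[of U q 1] q by simp
  have "fps_deriv r = fps_of_poly (pderiv p) * inverse (fps_of_poly q) +
      fps_of_poly p * (fps_of_poly (- pderiv q) * (inverse (fps_of_poly q) * inverse (fps_of_poly q)))"
    by (simp add: r fps_inverse_deriv[OF q0] fps_of_poly_pderiv fps_of_poly_uminus power2_eq_square mult_ac)
  also have "\<dots> \<in> regular_ring U"
    by (intro regular_ring_add regular_ring_mult regular_ring_poly inv assms(2))
  finally show ?thesis .
qed

inductive_set regular_span :: "complex set \<Rightarrow> complex fps set \<Rightarrow> complex fps set" for U S where
  zero: "0 \<in> regular_span U S"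
| step: "r \<in> regular_ring U \<Longrightarrow> e \<in> S \<Longrightarrow> v \<in> regular_span U S \<Longrightarrow> r * e + v \<in> regular_span U S"

lemma regular_span_add:
  "v \<in> regular_span U S \<Longrightarrow> w \<in> regular_span U S \<Longrightarrow> v + w \<in> regular_span U S"
  by (induction rule: regular_span.induct) (auto simp: add.assoc intro: regular_span.step)

lemma regular_span_base: "e \<in> S \<Longrightarrow> e \<in> regular_span U S"
  using regular_span.step[OF regular_ring_1 _ regular_span.zero, of e S U] by simp

lemma regular_span_scale:
  "v \<in> regular_span U S \<Longrightarrow> r \<in> regular_ring U \<Longrightarrow> 0 \<in> U \<Longrightarrow> r * v \<in> regular_span U S"
proof (induction rule: regular_span.induct)
  case (step s e v)
  have "r * (s * e + v) = r * s * e + r * v" by (simp add: algebra_simps)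
  then show ?case using step by (simp add: regular_span.step regular_ring_mult)
qed (auto intro: regular_span.zero)

lemma regular_span_diff:
  "v \<in> regular_span U S \<Longrightarrow> w \<in> regular_span U S \<Longrightarrow> 0 \<in> U \<Longrightarrow> v - w \<in> regular_span U S"
  using regular_span_add[of v U S "fps_const (-1) * w"] regular_span_scale[OF _ regular_ring_const[of "-1"], of w U S]
  by (simp flip: fps_const_neg)

lemma regular_span_trans:
  "v \<in> regular_span U S \<Longrightarrow> S \<subseteq> regular_span U T \<Longrightarrow> 0 \<in> U \<Longrightarrow> v \<in> regular_span U T"
  by (induction rule: regular_span.induct)
    (auto intro!: regular_span.zero regular_span_add intro: regular_span_scale)

lemma regular_span_mono:
  "v \<in> regular_span U S \<Longrightarrow> S \<subseteq> T \<Longrightarrow> v \<in> regular_span U T"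
  by (induction rule: regular_span.induct) (auto intro: regular_span.intros)

lemma regular_span_insertD:
  assumes "v \<in> regular_span U (insert e S)" "0 \<in> U"
  shows "\<exists>c\<in>regular_ring U. \<exists>w\<in>regular_span U S. v = c * e + w"
  using assms(1)
proof (induction rule: regular_span.induct)
  case zero
  then show ?case using regular_ring_0 regular_span.zero by (intro bexI[of _ 0]) auto
next
  case (step r e' v)
  then obtain c w where cw: "c \<in> regular_ring U" "w \<in> regular_span U S" "v = c * e + w" by blast
  show ?case
  proof (cases "e' = e")
    case True
    then have "r * e' + v = (r + c) * e + w" by (simp add: cw algebra_simps)
    then show ?thesis using cw step.hyps(1) regular_ring_add[OF _ _ assms(2)] by blast
  next
    case False
    then have "r * e' + w \<in> regular_span U S" using step.hyps cw by (auto intro: regular_span.step)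
    moreover have "r * e' + v = c * e + (r * e' + w)" by (simp add: cw)
    ultimately show ?thesis using cw by blast
  qed
qed

lemma regular_span_range:
  assumes "v \<in> regular_span U (range c)"
  shows "\<exists>N. v \<in> regular_span U (c ` {..<N::nat})"
  using assms
proof (induction rule: regular_span.induct)
  case (step r e v)
  then obtain N j where "v \<in> regular_span U (c ` {..<N})" "e = c j" by blast
  then have "r * e + v \<in> regular_span U (c ` {..<max N (Suc j)})"
    using step.hyps(1) by (intro regular_span.step) (auto intro: regular_span_mono)
  then show ?case by blast
qed (auto intro: regular_span.zero)

lemma regular_span_explicit:
  assumes "v \<in> regular_span U (f ` {..<n::nat})" "0 \<in> U"
  shows "\<exists>b. (\<forall>i<n. b i \<in> regular_ring U) \<and> v = (\<Sum>i<n. b i * f i)"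
  using assms(1)
proof (induction rule: regular_span.induct)
  case zero
  then show ?case using regular_ring_0 by (intro exI[of _ "\<lambda>_. 0"]) auto
next
  case (step r e v)
  then obtain b j where b: "\<forall>i<n. b i \<in> regular_ring U" "v = (\<Sum>i<n. b i * f i)" and j: "j < n" "e = f j" by auto
  have "(\<Sum>i<n. (b(j := b j + r)) i * f i) = (\<Sum>i<n. b i * f i + (if i = j then r * f i else 0))"
    by (intro sum.cong) (auto simp: algebra_simps)
  also have "\<dots> = r * e + v" using j by (simp add: sum.distrib b)
  finally show ?case
    using b(1) step.hyps(1) j by (intro exI[of _ "b(j := b j + r)"]) (auto intro: regular_ring_add assms(2))
qed

text \<open>
  Denominators are units, so an ideal is generated by its polynomials, hence by one of least degree. That one is
  already a combination of finitely many of the \<open>c j\<close>.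
\<close>

lemma regular_ideal_stabilises:
  assumes c: "\<And>j. c j \<in> regular_ring U" and U: "0 \<in> U"
  shows "\<exists>N::nat. \<forall>j. c j \<in> regular_span U (c ` {..<N})"
proof (cases "\<forall>j. c j = 0")
  case True
  then show ?thesis by (auto intro: regular_span.zero)
next
  case False
  define J where "J = {p. p \<noteq> 0 \<and> fps_of_poly p \<in> regular_span U (range c)}"
  have numerator: "\<exists>p q. c j = fps_of_poly p * inverse (fps_of_poly q) \<and> (\<forall>z\<in>U. poly q z \<noteq> 0) \<and>
      fps_of_poly p \<in> regular_span U (range c)" for j
  proof -
    obtain p q where pq: "c j = fps_of_poly p * inverse (fps_of_poly q)" "\<And>z. z \<in> U \<Longrightarrow> poly q z \<noteq> 0"
      "fps_nth (fps_of_poly q) 0 \<noteq> 0"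
      using regular_ringE[OF c U] by metis
    have "fps_of_poly q * c j = fps_of_poly p * (inverse (fps_of_poly q) * fps_of_poly q)"
      by (simp only: pq(1) mult_ac)
    then have "fps_of_poly q * c j = fps_of_poly p"
      by (simp only: inverse_mult_eq_1[OF pq(3)] mult_1_right)
    moreover have "fps_of_poly q * c j \<in> regular_span U (range c)"
      by (intro regular_span_scale regular_ring_poly U regular_span_base) auto
    ultimately have "fps_of_poly p \<in> regular_span U (range c)" by (simp only:)
    then show ?thesis using pq(1,2) by blast
  qed
  obtain j where "c j \<noteq> 0" using False by blast
  with numerator[of j] have "J \<noteq> {}" by (auto simp: J_def)
  then obtain g where g: "g \<in> J" and gmin: "\<And>p. p \<in> J \<Longrightarrow> Polynomial.degree g \<le> Polynomial.degree p"
    using ex_has_least_nat[of "\<lambda>p. p \<in> J" _ Polynomial.degree] by (metis ex_in_conv)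
  have "fps_of_poly g \<in> regular_span U (range c)" using g by (simp add: J_def)
  from regular_span_range[OF this] obtain N where N: "fps_of_poly g \<in> regular_span U (c ` {..<N})" ..
  have "c j \<in> regular_span U (c ` {..<N})" for j
  proof -
    obtain p q where pq: "c j = fps_of_poly p * inverse (fps_of_poly q)" "\<forall>z\<in>U. poly q z \<noteq> 0"
      "fps_of_poly p \<in> regular_span U (range c)"
      using numerator[of j] by blast
    have "fps_of_poly (p mod g) = fps_of_poly p - fps_of_poly (p div g) * fps_of_poly g"
      by (simp add: minus_div_mult_eq_mod flip: fps_of_poly_diff fps_of_poly_mult)
    also have "\<dots> \<in> regular_span U (range c)"
      using pq(3) g by (intro regular_span_diff regular_span_scale regular_ring_poly U) (auto simp: J_def)
    finally have "p mod g \<notin> J \<Longrightarrow> p mod g = 0" by (auto simp: J_def)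
    moreover have "p mod g \<notin> J"
    proof
      assume "p mod g \<in> J"
      then have "p mod g \<noteq> 0" "Polynomial.degree g \<le> Polynomial.degree (p mod g)" using gmin by (auto simp: J_def)
      then show False using degree_mod_less[of g p] g by (auto simp: J_def)
    qed
    ultimately have "p = p div g * g" by (metis div_mult_mod_eq add.right_neutral)
    then have "c j = fps_of_poly (p div g) * inverse (fps_of_poly q) * fps_of_poly g"
      unfolding pq(1) by (metis fps_of_poly_mult mult.assoc mult.commute)
    also have "\<dots> \<in> regular_span U (c ` {..<N})"
      using pq(2) by (intro regular_span_scale N regular_ringI U) auto
    finally show ?thesis .
  qed
  then show ?thesis by blast
qed

text \<open>
  Induction on the number of generators. The coefficients at the generator \<open>e\<close> lie in an ideal that is generated by finitely many of
  them; subtracting combinations of the corresponding elements moves the rest of the sequence into the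
  span of the other generators.
\<close>

lemma regular_span_noetherian:
  assumes "finite S" "\<And>j::nat. v j \<in> regular_span U S" and U: "0 \<in> U"
  shows "\<exists>n. v n \<in> regular_span U (v ` {..<n})"
  using assms(1,2)
proof (induction S arbitrary: v rule: finite_induct)
  case empty
  have "x = 0" if "x \<in> regular_span U {}" for x using that by cases auto
  with empty have "v 0 = 0" by blast
  then show ?case by (auto intro!: exI[of _ 0] regular_span.zero)
next
  case (insert e S)
  have "\<forall>j. \<exists>c w. c \<in> regular_ring U \<and> w \<in> regular_span U S \<and> v j = c * e + w"
    using regular_span_insertD[OF insert.prems U] by blast
  then obtain c w where c: "\<And>j. c j \<in> regular_ring U" and w: "\<And>j. w j \<in> regular_span U S"
    and v: "\<And>j. v j = c j * e + w j" by metis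
  obtain N where N: "\<And>j. c j \<in> regular_span U (c ` {..<N})"
    using regular_ideal_stabilises[of c U, OF c U] by blast
  have lift: "\<exists>y\<in>regular_span U (v ` {..<N}). d * e - y \<in> regular_span U S"
    if "d \<in> regular_span U (c ` {..<N})" for d
    using that
  proof (induction rule: regular_span.induct)
    case zero
    then show ?case by (intro bexI[of _ 0]) (auto intro: regular_span.zero)
  next
    case (step r a d)
    then obtain y i where y: "y \<in> regular_span U (v ` {..<N})" "d * e - y \<in> regular_span U S"
      and i: "a = c i" "i < N" by auto
    have "(r * a + d) * e - (r * v i + y) = (d * e - y) - r * w i"
      by (simp add: i v algebra_simps)
    also have "\<dots> \<in> regular_span U S"
      by (intro regular_span_diff regular_span_scale y w step.hyps(1) U)
    finally show ?case using y i step.hyps(1) by (intro bexI[of _ "r * v i + y"]) (auto intro: regular_span.step)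
  qed
  have "\<forall>j. \<exists>y. y \<in> regular_span U (v ` {..<N}) \<and> c (N + j) * e - y \<in> regular_span U S"
    using lift[OF N] by blast
  then obtain y where y: "\<And>j. y j \<in> regular_span U (v ` {..<N})"
    and y': "\<And>j. c (N + j) * e - y j \<in> regular_span U S" by metis
  define u where "u j = v (N + j) - y j" for j
  have u_in: "u j \<in> regular_span U S" for j
    using regular_span_add[OF y'[of j] w[of "N + j"]] by (simp add: u_def v algebra_simps)
  obtain n where n: "u n \<in> regular_span U (u ` {..<n})" using insert.IH[of u, OF u_in] by blast
  have y_mono: "y j \<in> regular_span U (v ` {..<N + n})" for j
    by (rule regular_span_mono[OF y]) auto
  have "u ` {..<n} \<subseteq> regular_span U (v ` {..<N + n})"
  proof
    fix a assume "a \<in> u ` {..<n}"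
    then obtain j where j: "j < n" "a = v (N + j) - y j" by (auto simp: u_def)
    have "v (N + j) \<in> v ` {..<N + n}" using j(1) by auto
    from regular_span_diff[OF regular_span_base[OF this] y_mono U]
    show "a \<in> regular_span U (v ` {..<N + n})" by (simp add: j(2))
  qed
  then have "u n + y n \<in> regular_span U (v ` {..<N + n})"
    by (intro regular_span_add regular_span_trans[OF n] y_mono U)
  then show ?case by (auto simp: u_def)
qed

text \<open>
  A monic equation with coefficients in \<open>regular_ring U\<close>, solved for the highest derivative.
\<close>

definition satisfies_regular_ode :: "complex set \<Rightarrow> complex fps \<Rightarrow> bool" where
  "satisfies_regular_ode U F \<longleftrightarrow>
     (\<exists>n b. (\<forall>i<n. b i \<in> regular_ring U) \<and> (fps_deriv ^^ n) F = (\<Sum>i<n. b i * (fps_deriv ^^ i) F))"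

text \<open>
  The point of this characterisation is that it is visibly stable under sums and products, whereas an equation
  of minimal order for a sum may have apparent singularities.
\<close>

lemma regular_ode_iff_finite_span:
  assumes U: "0 \<in> U"
  shows "satisfies_regular_ode U F \<longleftrightarrow> (\<exists>S. finite S \<and> (\<forall>j. (fps_deriv ^^ j) F \<in> regular_span U S))"
proof
  assume "satisfies_regular_ode U F"
  then obtain n b where b: "\<forall>i<n. b i \<in> regular_ring U"
    and ode: "(fps_deriv ^^ n) F = (\<Sum>i<n. b i * (fps_deriv ^^ i) F)"
    by (auto simp: satisfies_regular_ode_def)
  define S where "S = (\<lambda>i. (fps_deriv ^^ i) F) ` {..<n}"
  have sum_in: "(\<Sum>i<k. b i * (fps_deriv ^^ i) F) \<in> regular_span U S" if "k \<le> n" for k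
    using that
  proof (induction k)
    case (Suc k)
    then show ?case using b
      by (auto simp: S_def add.commute intro!: regular_span.step)
  qed (simp add: regular_span.zero)
  have deriv_base: "fps_deriv e \<in> regular_span U S" if e: "e \<in> S" for e
  proof -
    obtain i where i: "i < n" "e = (fps_deriv ^^ i) F" using e by (auto simp: S_def)
    show ?thesis
    proof (cases "Suc i < n")
      case True
      then have "(fps_deriv ^^ Suc i) F \<in> S" unfolding S_def by blast
      then show ?thesis using regular_span_base by (simp add: i)
    next
      case False
      then have "n = Suc i" using i by simp
      then have "fps_deriv e = (fps_deriv ^^ n) F" by (simp add: i)
      then show ?thesis using ode sum_in[of n] by simp
    qed
  qed
  have deriv_closed: "fps_deriv v \<in> regular_span U S" if "v \<in> regular_span U S" for v
    using that
  proof (induction rule: regular_span.induct)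
    case (step r e v)
    have "r * fps_deriv e + fps_deriv r * e + fps_deriv v \<in> regular_span U S"
      using step by (intro regular_span_add regular_span_scale deriv_base[OF step.hyps(2)] regular_span_base[OF step.hyps(2)] regular_ring_deriv U)
    then show ?case by simp
  qed (simp add: regular_span.zero)
  have F_in: "F \<in> regular_span U S"
  proof (cases "n = 0")
    case True
    then show ?thesis using ode by (simp add: regular_span.zero)
  next
    case False
    then have "(fps_deriv ^^ 0) F \<in> S" unfolding S_def by blast
    then show ?thesis using regular_span_base by simp
  qed
  have "(fps_deriv ^^ j) F \<in> regular_span U S" for j
    by (induction j) (use F_in deriv_closed in auto)
  then show "\<exists>S. finite S \<and> (\<forall>j. (fps_deriv ^^ j) F \<in> regular_span U S)"
    by (intro exI[of _ S]) (auto simp: S_def)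
next
  assume "\<exists>S. finite S \<and> (\<forall>j. (fps_deriv ^^ j) F \<in> regular_span U S)"
  then obtain S where S: "finite S" "\<And>j. (fps_deriv ^^ j) F \<in> regular_span U S" by blast
  obtain n where "(fps_deriv ^^ n) F \<in> regular_span U ((\<lambda>j. (fps_deriv ^^ j) F) ` {..<n})"
    using regular_span_noetherian[of S "\<lambda>j. (fps_deriv ^^ j) F", OF S U] by blast
  from regular_span_explicit[OF this U] show "satisfies_regular_ode U F"
    unfolding satisfies_regular_ode_def by blast
qed

lemma regular_ode_const:
  assumes U: "0 \<in> U"
  shows "satisfies_regular_ode U (fps_const c)"
  unfolding satisfies_regular_ode_def
  using regular_ring_0 by (intro exI[of _ 1] exI[of _ "\<lambda>_. 0"]) auto

lemma regular_ode_add: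
  assumes "satisfies_regular_ode U F" "satisfies_regular_ode U G" and U: "0 \<in> U"
  shows "satisfies_regular_ode U (F + G)"
proof -
  obtain S T where ST: "finite S" "finite T" "\<And>j. (fps_deriv ^^ j) F \<in> regular_span U S"
    "\<And>j. (fps_deriv ^^ j) G \<in> regular_span U T"
    using assms by (auto simp: regular_ode_iff_finite_span)
  have "(fps_deriv ^^ j) (F + G) = (fps_deriv ^^ j) F + (fps_deriv ^^ j) G" for j
    by (induction j) auto
  then have "(fps_deriv ^^ j) (F + G) \<in> regular_span U (S \<union> T)" for j
    using regular_span_add[OF regular_span_mono[OF ST(3)] regular_span_mono[OF ST(4)], of "S \<union> T"] by simp
  then show ?thesis using ST by (auto simp: regular_ode_iff_finite_span[OF U])
qed

lemma regular_ode_mult: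
  assumes "satisfies_regular_ode U F" "satisfies_regular_ode U G" and U: "0 \<in> U"
  shows "satisfies_regular_ode U (F * G)"
proof -
  obtain S T where ST: "finite S" "finite T" "\<And>j. (fps_deriv ^^ j) F \<in> regular_span U S"
    "\<And>j. (fps_deriv ^^ j) G \<in> regular_span U T"
    using assms by (auto simp: regular_ode_iff_finite_span)
  define P where "P = (\<lambda>(e, e'). e * e') ` (S \<times> T)"
  have scale: "e * w \<in> regular_span U P" if "e \<in> S" "w \<in> regular_span U T" for e w
    using that(2)
  proof (induction rule: regular_span.induct)
    case (step r e' w)
    have "e * e' \<in> P" using that(1) step.hyps(2) by (auto simp: P_def)
    from regular_span.step[OF step.hyps(1) this step.IH] show ?case by (simp add: algebra_simps)
  qed (simp add: regular_span.zero)
  have prod: "v * w \<in> regular_span U P" if "v \<in> regular_span U S" "w \<in> regular_span U T" for v w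
    using that(1)
  proof (induction rule: regular_span.induct)
    case (step r e v)
    have "(r * e + v) * w = r * (e * w) + v * w" by (simp add: algebra_simps)
    then show ?case using step scale[OF step.hyps(2) that(2)] U by (simp add: regular_span_add regular_span_scale)
  qed (simp add: regular_span.zero)
  have "(fps_deriv ^^ j) ((fps_deriv ^^ a) F * (fps_deriv ^^ b) G) \<in> regular_span U P" for j a b
  proof (induction j arbitrary: a b)
    case 0
    then show ?case by (simp add: prod ST)
  next
    case (Suc j)
    have add: "(fps_deriv ^^ j) (v + w) = (fps_deriv ^^ j) v + (fps_deriv ^^ j) w" for v w :: "complex fps"
      by (induction j) auto
    have "(fps_deriv ^^ Suc j) ((fps_deriv ^^ a) F * (fps_deriv ^^ b) G)
       = (fps_deriv ^^ j) ((fps_deriv ^^ a) F * (fps_deriv ^^ Suc b) G + (fps_deriv ^^ Suc a) F * (fps_deriv ^^ b) G)"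
      by (simp add: funpow_Suc_right del: funpow.simps(2)) (simp add: funpow_swap1)
    then show ?case using regular_span_add[OF Suc[of a "Suc b"] Suc[of "Suc a" b]] by (simp only: add)
  qed
  from this[of _ 0 0] show ?thesis
    using ST(1,2) by (auto simp: regular_ode_iff_finite_span[OF U] P_def intro!: exI[of _ P])
qed

lemma fps_to_fls_sum: "fps_to_fls (sum f A) = (\<Sum>a\<in>A. fps_to_fls (f a))"
  by (induction A rule: infinite_finite_induct) auto

lemma ratfun_to_fls_Fract:
  assumes "q \<noteq> 0"
  shows "ratfun_to_fls (Fract p q) = fps_to_fls (fps_of_poly p) / fps_to_fls (fps_of_poly q)"
proof -
  define p' q' where "p' = fst (quot_of_fract (Fract p q))" and "q' = snd (quot_of_fract (Fract p q))"
  have q': "q' \<noteq> 0" by (simp add: q'_def)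
  have "Fract p' q' = Fract p q" unfolding p'_def q'_def by (rule Fract_quot_of_fract)
  then have "p' * q = p * q'" using q' assms by (simp add: eq_fract)
  then have "fps_to_fls (fps_of_poly p') * fps_to_fls (fps_of_poly q) = fps_to_fls (fps_of_poly p) * fps_to_fls (fps_of_poly q')"
    by (simp flip: fls_times_fps_to_fls fps_of_poly_mult)
  then show ?thesis using q' assms
    by (simp add: ratfun_to_fls_def p'_def[symmetric] q'_def[symmetric] frac_eq_eq)
qed

lemma ratfun_to_fls_divide:
  assumes "b \<noteq> 0"
  shows "ratfun_to_fls (a / b) = ratfun_to_fls a / ratfun_to_fls b" "ratfun_to_fls b \<noteq> 0"
proof -
  obtain p q where a: "a = Fract p q" "q \<noteq> 0" by (cases a)
  obtain r s where b: "b = Fract r s" "s \<noteq> 0" by (cases b)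
  have r: "r \<noteq> 0" using assms b by (auto simp: Zero_fract_def eq_fract)
  show "ratfun_to_fls (a / b) = ratfun_to_fls a / ratfun_to_fls b" "ratfun_to_fls b \<noteq> 0"
    using a b r by (simp_all add: ratfun_to_fls_Fract fps_of_poly_mult fls_times_fps_to_fls)
qed

lemma regular_at_Fract:
  assumes "poly q z \<noteq> 0"
  shows "regular_at (Fract p q) z"
proof -
  define p' q' where "p' = fst (quot_of_fract (Fract p q))" and "q' = snd (quot_of_fract (Fract p q))"
  have q': "q' \<noteq> 0" by (simp add: q'_def)
  have "q \<noteq> 0" using assms by auto
  have "Fract p' q' = Fract p q" unfolding p'_def q'_def by (rule Fract_quot_of_fract)
  then have "p' * q = p * q'" using q' \<open>q \<noteq> 0\<close> by (simp add: eq_fract)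
  then have "q' dvd p' * q" by simp
  moreover have "coprime q' p'" using coprime_quot_of_fract[of "Fract p q"] by (simp add: p'_def q'_def coprime_commute)
  ultimately have "q' dvd q" by (simp add: coprime_dvd_mult_right_iff)
  then show ?thesis using assms unfolding regular_at_def q'_def[symmetric] by (auto elim!: dvdE)
qed

lemma ratfun_to_fls_regular:
  assumes "\<And>z. z \<in> U \<Longrightarrow> regular_at a z" "0 \<in> U"
  shows "\<exists>r\<in>regular_ring U. ratfun_to_fls a = fps_to_fls r"
proof -
  define p q where "p = fst (quot_of_fract a)" and "q = snd (quot_of_fract a)"
  have q: "\<And>z. z \<in> U \<Longrightarrow> poly q z \<noteq> 0" using assms(1) by (simp add: regular_at_def q_def)
  have q0: "fps_nth (fps_of_poly q) 0 \<noteq> 0" using q[OF assms(2)] by (simp add: poly_0_coeff_0)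
  then have nz: "fps_of_poly q \<noteq> 0" by auto
  have "fps_of_poly p * inverse (fps_of_poly q) * fps_of_poly q = fps_of_poly p"
    using inverse_mult_eq_1[OF q0] by (simp add: mult.assoc)
  then have "fps_to_fls (fps_of_poly p * inverse (fps_of_poly q)) * fps_to_fls (fps_of_poly q) = fps_to_fls (fps_of_poly p)"
    by (simp only: fls_times_fps_to_fls[symmetric])
  then have "ratfun_to_fls a = fps_to_fls (fps_of_poly p * inverse (fps_of_poly q))"
    using nz by (simp add: ratfun_to_fls_def p_def q_def divide_eq_eq del: fls_times_fps_to_fls)
  with regular_ringI[of U q p] q show ?thesis by blast
qed

text \<open>
  Dividing an operator by its leading coefficient translates between operators over the field of rational functions and
  monic equations over \<open>regular_ring U\<close>.
\<close>

lemma holonomic_on_iff_regular_ode: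
  assumes U: "0 \<in> U"
  shows "holonomic_on f U \<longleftrightarrow> satisfies_regular_ode U (complexify f)"
proof
  assume "holonomic_on f U"
  then obtain L where L: "L \<noteq> 0" "nonsingular_on L U" "apply_diffop L (complexify f) = 0"
    by (auto simp: holonomic_on_def)
  define n where "n = Polynomial.degree L"
  define D where "D i = fps_to_fls ((fps_deriv ^^ i) (complexify f))" for i
  let ?a = "\<lambda>i. Polynomial.coeff L i / Polynomial.lead_coeff L"
  have lead: "Polynomial.lead_coeff L \<noteq> 0" using L(1) by simp
  have "\<forall>i. \<exists>r. i \<le> n \<longrightarrow> r \<in> regular_ring U \<and> ratfun_to_fls (?a i) = fps_to_fls r"
    using ratfun_to_fls_regular[OF _ U] L(2) unfolding nonsingular_on_def n_def by blast
  then obtain r where r: "\<And>i. i \<le> n \<Longrightarrow> r i \<in> regular_ring U"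
    "\<And>i. i \<le> n \<Longrightarrow> ratfun_to_fls (?a i) = fps_to_fls (r i)" by metis
  have "0 = (\<Sum>i\<le>n. ratfun_to_fls (Polynomial.coeff L i) * D i) / ratfun_to_fls (Polynomial.lead_coeff L)"
    using L(3) by (simp add: apply_diffop_def n_def D_def)
  also have "\<dots> = (\<Sum>i\<le>n. ratfun_to_fls (?a i) * D i)"
    by (simp add: sum_divide_distrib ratfun_to_fls_divide[OF lead])
  also have "\<dots> = (\<Sum>i<n. ratfun_to_fls (?a i) * D i) + D n"
    using lead ratfun_to_fls_Fract[of 1 1]
    by (simp add: n_def lessThan_Suc_atMost[symmetric] One_fract_def[symmetric])
  finally have "D n = - (\<Sum>i<n. ratfun_to_fls (?a i) * D i)"
    by (simp add: eq_neg_iff_add_eq_0 add.commute)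
  also have "\<dots> = fps_to_fls (\<Sum>i<n. - r i * (fps_deriv ^^ i) (complexify f))"
    by (simp add: r D_def fps_to_fls_sum fls_times_fps_to_fls sum_negf)
  finally have "(fps_deriv ^^ n) (complexify f) = (\<Sum>i<n. - r i * (fps_deriv ^^ i) (complexify f))"
    by (simp add: D_def)
  then show "satisfies_regular_ode U (complexify f)"
    unfolding satisfies_regular_ode_def using r(1) regular_ring_uminus[OF _ U]
    by (intro exI[of _ n] exI[of _ "\<lambda>i. - r i"]) auto
next
  assume "satisfies_regular_ode U (complexify f)"
  then obtain n b where b: "\<And>i. i < n \<Longrightarrow> b i \<in> regular_ring U"
    and ode: "(fps_deriv ^^ n) (complexify f) = (\<Sum>i<n. b i * (fps_deriv ^^ i) (complexify f))"
    by (auto simp: satisfies_regular_ode_def)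
  have "\<forall>i. \<exists>p q. i < n \<longrightarrow> b i = fps_of_poly p * inverse (fps_of_poly q) \<and>
      (\<forall>z\<in>U. poly q z \<noteq> 0) \<and> fps_nth (fps_of_poly q) 0 \<noteq> 0"
    using regular_ringE[OF b U] by metis
  then obtain p q where pq: "\<And>i. i < n \<Longrightarrow> b i = fps_of_poly (p i) * inverse (fps_of_poly (q i))"
    "\<And>i z. i < n \<Longrightarrow> z \<in> U \<Longrightarrow> poly (q i) z \<noteq> 0" "\<And>i. i < n \<Longrightarrow> fps_nth (fps_of_poly (q i)) 0 \<noteq> 0" by metis
  have q_nz: "q i \<noteq> 0" if "i < n" for i using pq(3)[OF that] by auto
  define L where "L = Polynomial.monom 1 n + (\<Sum>i<n. Polynomial.monom (Fract (- p i) (q i)) i)"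
  have coeff_L: "Polynomial.coeff L i = (if i = n then 1 else if i < n then Fract (- p i) (q i) else 0)" for i
    by (auto simp: L_def Polynomial.coeff_sum)
  have deg_L: "Polynomial.degree L = n"
  proof (rule antisym)
    show "Polynomial.degree L \<le> n" by (rule degree_le) (simp add: coeff_L)
    show "n \<le> Polynomial.degree L" by (rule le_degree) (simp add: coeff_L)
  qed
  have "L \<noteq> 0" using coeff_L[of n] by auto
  moreover have "nonsingular_on L U"
    unfolding nonsingular_on_def deg_L coeff_L
    using pq(2) regular_at_Fract[of 1 _ 1] by (auto simp: One_fract_def[symmetric] intro!: regular_at_Fract)
  moreover have "apply_diffop L (complexify f) = 0"
  proof -
    have "ratfun_to_fls (Fract (- p i) (q i)) = - fps_to_fls (b i)" if "i < n" for i
    proof -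
      have "b i * fps_of_poly (q i) = fps_of_poly (p i)"
        using inverse_mult_eq_1[OF pq(3)[OF that]] by (simp add: pq(1)[OF that] mult.assoc)
      then have "fps_to_fls (b i) * fps_to_fls (fps_of_poly (q i)) = fps_to_fls (fps_of_poly (p i))"
        by (simp only: fls_times_fps_to_fls[symmetric])
      then show ?thesis
        using q_nz[OF that] by (simp add: ratfun_to_fls_Fract fps_of_poly_uminus divide_eq_eq)
    qed
    then have "apply_diffop L (complexify f) =
        fps_to_fls ((fps_deriv ^^ n) (complexify f)) - (\<Sum>i<n. fps_to_fls (b i) * fps_to_fls ((fps_deriv ^^ i) (complexify f)))"
      using ratfun_to_fls_Fract[of 1 1]
      by (simp add: apply_diffop_def deg_L coeff_L lessThan_Suc_atMost[symmetric] sum_negf One_fract_def[symmetric])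
    also have "\<dots> = 0"
      by (simp add: ode fps_to_fls_sum fls_times_fps_to_fls)
    finally show ?thesis .
  qed
  ultimately show "holonomic_on f U" by (auto simp: holonomic_on_def)
qed

lemma holonomic_algebra_closed:
  assumes "0 \<in> U" and x: "fps_nth x 0 = 0"
  shows "a \<in> holonomic_algebra U x \<Longrightarrow> b \<in> holonomic_algebra U x \<Longrightarrow> a + b \<in> holonomic_algebra U x"
    and "a \<in> holonomic_algebra U x \<Longrightarrow> b \<in> holonomic_algebra U x \<Longrightarrow> a * b \<in> holonomic_algebra U x"
    and "fps_const (of_int k) \<in> holonomic_algebra U x"
  using assms unfolding holonomic_algebra_def
  by (auto simp: holonomic_on_iff_regular_ode regular_ode_add regular_ode_mult regular_ode_const
      fps_compose_add_distrib fps_compose_mult_distrib fps_mult_nth intro!: Ints_sum Ints_mult)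

section \<open>Analytic continuation of the solutions\<close>

text \<open>
  If the coefficients of the \<open>B i j\<close> are at most \<open>c i j / r ^ k\<close>, the system bounds \<open>(k + 1) * a (k + 1)\<close> by a
  constant times the sum \<open>s k\<close> of the previous \<open>a l\<close>. Hence \<open>s (k + 1) / s k\<close> is bounded by \<open>1 + O(1 / k)\<close>, and the ratio test
  applies at every radius less than \<open>r\<close>.
\<close>

lemma fps_linear_system_conv_radius:
  fixes G :: "nat \<Rightarrow> complex fps" and B :: "nat \<Rightarrow> nat \<Rightarrow> complex fps"
  assumes system: "\<And>i. i < n \<Longrightarrow> fps_deriv (G i) = (\<Sum>j<n. B i j * G j)"
    and B: "\<And>i j. i < n \<Longrightarrow> j < n \<Longrightarrow> ereal R \<le> fps_conv_radius (B i j)" and "i < n"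
  shows "ereal R \<le> fps_conv_radius (G i)"
  unfolding fps_conv_radius_def
proof (rule conv_radius_geI_ex)
  fix \<rho> assume "0 < \<rho>" "ereal \<rho> < ereal R"
  then have "0 < \<rho>" "\<rho> < R" by simp_all
  \<comment> \<open>A radius between \<open>\<rho>\<close> and \<open>R\<close> leaves room both for the bound on \<open>B\<close> and for the ratio test.\<close>
  define r where "r = (\<rho> + R) / 2"
  have r: "\<rho> < r" "r < R" "0 < r" using \<open>0 < \<rho>\<close> \<open>\<rho> < R\<close> by (auto simp: r_def)
  have "\<exists>c. \<forall>k. cmod (fps_nth (B i j)  k) * r ^ k \<le> c" if "i < n" "j < n" for i j
  proof -
    have "ereal (norm (complex_of_real r)) < fps_conv_radius (B i j)"
      by (rule less_le_trans[OF _ B[OF that]]) (use r in simp)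
    from norm_summable_fps[OF this] have "summable (\<lambda>k. cmod (fps_nth (B i j) k) * r ^ k)"
      using r by (simp add: norm_mult norm_power)
    then have "Bseq (\<lambda>k. cmod (fps_nth (B i j) k) * r ^ k)"
      using summable_LIMSEQ_zero convergentI convergent_imp_Bseq by blast
    then obtain K where "\<forall>k. norm (cmod (fps_nth (B i j) k) * r ^ k) \<le> K" by (auto simp: Bseq_def)
    then show ?thesis by (intro exI[of _ K]) (auto simp: abs_le_iff)
  qed
  then obtain c where c: "\<And>i j k. i < n \<Longrightarrow> j < n \<Longrightarrow> cmod (fps_nth (B i j) k) * r ^ k \<le> c i j" by metis
  have c_nonneg: "0 \<le> c i j" if "i < n" "j < n" for i j
    using order_trans[OF norm_ge_zero, of "fps_nth (B i j) 0" "c i j"] c[OF that, of 0] by simp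
  define C where "C = (\<Sum>i<n. \<Sum>j<n. c i j)"
  define a where "a k = (\<Sum>i<n. cmod (fps_nth (G i) k) * r ^ k)" for k
  define s where "s k = (\<Sum>l\<le>k. a l)" for k
  have a_nonneg: "0 \<le> a k" for k using r by (auto simp: a_def intro!: sum_nonneg)
  have s_nonneg: "0 \<le> s k" for k unfolding s_def by (intro sum_nonneg a_nonneg)
  \<comment> \<open>Comparing coefficients in the system bounds each coefficient by all the previous ones.\<close>
  have step: "Suc k * a (Suc k) \<le> r * C * s k" for k
  proof -
    have "Suc k * (cmod (fps_nth (G i) (Suc k)) * r ^ Suc k) \<le> (\<Sum>j<n. r * (c i j * s k))" if i: "i < n" for i
    proof -
      have "of_nat (Suc k) * fps_nth (G i) (Suc k) = (\<Sum>j<n. \<Sum>l\<le>k. fps_nth (B i j) l * fps_nth (G j) (k - l))"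
        using arg_cong[OF system[OF i], of "\<lambda>f. fps_nth f k"]
        by (simp add: fps_sum_nth fps_mult_nth atMost_atLeast0)
      then have "real (Suc k) * cmod (fps_nth (G i) (Suc k)) =
          cmod (\<Sum>j<n. \<Sum>l\<le>k. fps_nth (B i j) l * fps_nth (G j) (k - l))"
        by (metis norm_mult norm_of_nat)
      also have "\<dots> \<le> (\<Sum>j<n. \<Sum>l\<le>k. cmod (fps_nth (B i j) l) * cmod (fps_nth (G j) (k - l)))"
        by (intro order_trans[OF norm_sum] sum_mono) (simp add: norm_mult)
      finally have "real (Suc k) * cmod (fps_nth (G i) (Suc k)) * r ^ Suc k
          \<le> (\<Sum>j<n. \<Sum>l\<le>k. cmod (fps_nth (B i j) l) * cmod (fps_nth (G j) (k - l))) * r ^ Suc k"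
        using r by (intro mult_right_mono) auto
      also have "\<dots> = (\<Sum>j<n. r * (\<Sum>l\<le>k. (cmod (fps_nth (B i j) l) * r ^ l) * (cmod (fps_nth (G j) (k - l)) * r ^ (k - l))))"
        unfolding sum_distrib_right sum_distrib_left
        by (intro sum.cong refl) (simp add: field_simps flip: power_add)
      also have "\<dots> \<le> (\<Sum>j<n. r * (c i j * s k))"
      proof (intro sum_mono mult_left_mono)
        fix j assume "j \<in> {..<n}"
        then have j: "j < n" by simp
        have G_le: "cmod (fps_nth (G j) l) * r ^ l \<le> a l" for l
          unfolding a_def using j r by (intro member_le_sum[of j "{..<n}" "\<lambda>j. cmod (fps_nth (G j) l) * r ^ l"]) auto
        have "(\<Sum>l\<le>k. (cmod (fps_nth (B i j) l) * r ^ l) * (cmod (fps_nth (G j) (k - l)) * r ^ (k - l)))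
            \<le> (\<Sum>l\<le>k. c i j * a (k - l))"
          using r by (intro sum_mono mult_mono c i j G_le c_nonneg) auto
        also have "\<dots> = c i j * (\<Sum>l\<le>k. a (k - l))" by (simp add: sum_distrib_left)
        also have "(\<Sum>l\<le>k. a (k - l)) = s k"
          unfolding s_def by (rule sum.reindex_bij_witness[where i = "\<lambda>l. k - l" and j = "\<lambda>l. k - l"]) auto
        finally show "(\<Sum>l\<le>k. (cmod (fps_nth (B i j) l) * r ^ l) * (cmod (fps_nth (G j) (k - l)) * r ^ (k - l)))
            \<le> c i j * s k" .
      qed (use r in auto)
      finally show ?thesis by (simp add: mult.assoc)
    qed
    then have "(\<Sum>i<n. Suc k * (cmod (fps_nth (G i) (Suc k)) * r ^ Suc k)) \<le> (\<Sum>i<n. \<Sum>j<n. r * (c i j * s k))"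
      by (intro sum_mono) auto
    then show ?thesis
      by (simp add: a_def C_def sum_distrib_left sum_distrib_right mult_ac)
  qed
  define t where "t = \<rho> / r"
  have t: "0 < t" "t < 1" using \<open>0 < \<rho>\<close> r by (auto simp: t_def)
  have "(\<lambda>k. t * (1 + r * C / real (Suc k))) \<longlonglongrightarrow> t" by real_asymp
  then have "eventually (\<lambda>k. t * (1 + r * C / real (Suc k)) < (1 + t) / 2) sequentially"
    by (rule order_tendstoD(2)) (use t in simp)
  then obtain k0 where k0: "\<And>k. k \<ge> k0 \<Longrightarrow> t * (1 + r * C / real (Suc k)) \<le> (1 + t) / 2"
    by (auto simp: eventually_sequentially intro: less_imp_le)
  have "summable (\<lambda>k. s k * t ^ k)"
  proof (rule summable_ratio_test[of "(1 + t) / 2" k0])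
    fix k assume "k \<ge> k0"
    have "s (Suc k) \<le> s k * (1 + r * C / real (Suc k))"
    proof -
      have "a (Suc k) \<le> r * C * s k / real (Suc k)"
        using step[of k] by (simp add: pos_le_divide_eq mult.commute)
      then show ?thesis by (simp add: s_def algebra_simps)
    qed
    then have "s (Suc k) * t ^ Suc k \<le> s k * (1 + r * C / real (Suc k)) * t ^ Suc k"
      using t by (intro mult_right_mono) auto
    also have "\<dots> = (t * (1 + r * C / real (Suc k))) * (s k * t ^ k)" by simp
    also have "\<dots> \<le> (1 + t) / 2 * (s k * t ^ k)"
      using k0[OF \<open>k \<ge> k0\<close>] s_nonneg t by (intro mult_right_mono) auto
    finally show "norm (s (Suc k) * t ^ Suc k) \<le> (1 + t) / 2 * norm (s k * t ^ k)"
      using s_nonneg t by simp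
  qed (use t in auto)
  then have "summable (\<lambda>k. fps_nth (G i) k * complex_of_real \<rho> ^ k)"
  proof (rule summable_comparison_test'[where N = 0])
    fix k :: nat
    have "cmod (fps_nth (G i) k) * r ^ k \<le> a k"
      unfolding a_def using \<open>i < n\<close> r by (intro member_le_sum[of i "{..<n}" "\<lambda>i. cmod (fps_nth (G i) k) * r ^ k"]) auto
    also have "\<dots> \<le> s k"
      unfolding s_def using a_nonneg by (intro member_le_sum) auto
    finally have "cmod (fps_nth (G i) k) * r ^ k * t ^ k \<le> s k * t ^ k"
      using t by (intro mult_right_mono) auto
    then show "norm (fps_nth (G i) k * complex_of_real \<rho> ^ k) \<le> s k * t ^ k"
      using r \<open>0 < \<rho>\<close> by (simp add: t_def norm_mult norm_power power_divide)
  qed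
  then show "\<exists>z. norm z = \<rho> \<and> summable (\<lambda>k. fps_nth (G i) k * z ^ k)"
    using \<open>0 < \<rho>\<close> by (intro exI[of _ "complex_of_real \<rho>"]) auto
qed

lemma regular_ring_compose_conv_radius:
  assumes r: "r \<in> regular_ring U" and "0 \<in> U" "R > 0"
    and hol: "\<phi> holomorphic_on ball 0 R" and maps: "\<phi> ` ball 0 R \<subseteq> U" and "\<phi> 0 = 0"
  shows "ereal R \<le> fps_conv_radius (r oo fps_expansion \<phi> 0)"
proof -
  obtain p q where pq: "r = fps_of_poly p * inverse (fps_of_poly q)" "\<And>z. z \<in> U \<Longrightarrow> poly q z \<noteq> 0"
    "fps_nth (fps_of_poly q) 0 \<noteq> 0"
    using regular_ringE[OF r \<open>0 \<in> U\<close>] by metis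
  have exp: "\<phi> has_fps_expansion fps_expansion \<phi> 0"
    using hol \<open>R > 0\<close> by (intro has_fps_expansion_fps_expansion[of "ball 0 R"]) auto
  have 0: "fps_nth (fps_expansion \<phi> 0) 0 = 0" using \<open>\<phi> 0 = 0\<close> by (simp add: fps_expansion_def)
  define \<psi> where "\<psi> z = poly p (\<phi> z) * inverse (poly q (\<phi> z))" for z
  have poly_exp: "poly P has_fps_expansion fps_of_poly P" for P
    by (auto simp: has_fps_expansion_def)
  have "((\<lambda>z. poly p z * inverse (poly q z)) \<circ> \<phi>) has_fps_expansion (r oo fps_expansion \<phi> 0)"
    unfolding pq(1)
    by (intro has_fps_expansion_compose has_fps_expansion_mult has_fps_expansion_inverse poly_exp exp 0 pq(3))
  then have "\<psi> has_fps_expansion (r oo fps_expansion \<phi> 0)"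
    by (simp add: o_def \<psi>_def[abs_def])
  moreover have \<psi>_hol: "\<psi> holomorphic_on ball 0 R"
    unfolding \<psi>_def using maps
    by (intro holomorphic_intros holomorphic_on_compose_gen[OF hol, of "poly _" UNIV, unfolded o_def])
      (auto intro!: pq(2) holomorphic_intros)
  moreover from \<psi>_hol have "\<psi> has_fps_expansion fps_expansion \<psi> 0"
    using \<open>R > 0\<close> by (intro has_fps_expansion_fps_expansion[of "ball 0 R"]) auto
  ultimately have "r oo fps_expansion \<phi> 0 = fps_expansion \<psi> 0"
    by (metis fps_expansion_unique_complex)
  then show ?thesis
    using conv_radius_fps_expansion[of \<psi> 0 "ereal R"] \<psi>_hol by simp
qed

text \<open>
  The compositions \<open>G i\<close> of the derivatives of \<open>F\<close> with \<open>\<phi>\<close> satisfy \<open>G i' = \<phi>' * G (i + 1)\<close>. The equation for \<open>F\<close> closes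
  this system. It remains regular at the zeros of \<open>\<phi>'\<close>, which would be singularities of an equation for
  \<open>F \<circ> \<phi>\<close> alone.
\<close>

lemma regular_ode_compose_conv_radius:
  assumes ode: "satisfies_regular_ode U F" and "0 \<in> U" "R > 0"
    and hol: "\<phi> holomorphic_on ball 0 R" and maps: "\<phi> ` ball 0 R \<subseteq> U" and "\<phi> 0 = 0"
  shows "ereal R \<le> fps_conv_radius (F oo fps_expansion \<phi> 0)"
proof -
  obtain n b where b: "\<And>i. i < n \<Longrightarrow> b i \<in> regular_ring U"
    and eq: "(fps_deriv ^^ n) F = (\<Sum>i<n. b i * (fps_deriv ^^ i) F)"
    using ode by (auto simp: satisfies_regular_ode_def)
  define \<Phi> where "\<Phi> = fps_expansion \<phi> 0"
  have 0: "fps_nth \<Phi> 0 = 0" using \<open>\<phi> 0 = 0\<close> by (simp add: \<Phi>_def fps_expansion_def)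
  have "ereal R \<le> fps_conv_radius \<Phi>"
    unfolding \<Phi>_def by (rule conv_radius_fps_expansion) (use hol in simp)
  then have \<Phi>': "ereal R \<le> fps_conv_radius (fps_deriv \<Phi>)"
    using fps_conv_radius_deriv[of \<Phi>] by (rule order_trans)
  define G where "G i = (fps_deriv ^^ i) F oo \<Phi>" for i
  define B where "B i j = (if Suc i = n then fps_deriv \<Phi> * (b j oo \<Phi>) else if j = Suc i then fps_deriv \<Phi> else 0)" for i j
  have G': "fps_deriv (G i) = fps_deriv \<Phi> * G (Suc i)" for i
    by (simp add: G_def fps_compose_deriv[OF 0] mult.commute)
  show ?thesis
  proof (cases "n = 0")
    case True
    then show ?thesis using eq by simp
  next
    case False
    have "ereal R \<le> fps_conv_radius (G 0)"
    proof (rule fps_linear_system_conv_radius[where B = B])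
      fix i assume i: "i < n"
      show "fps_deriv (G i) = (\<Sum>j<n. B i j * G j)"
      proof (cases "Suc i = n")
        case True
        have "G n = (\<Sum>j<n. (b j oo \<Phi>) * G j)"
          unfolding G_def eq by (simp add: fps_compose_sum_distrib fps_compose_mult_distrib[OF 0])
        then show ?thesis using True by (simp add: G' B_def sum_distrib_left mult.assoc)
      next
        case False
        then have "(\<Sum>j<n. B i j * G j) = (\<Sum>j<n. if j = Suc i then fps_deriv \<Phi> * G j else 0)"
          by (intro sum.cong) (auto simp: B_def)
        then show ?thesis using False i by (simp add: G')
      qed
      fix j assume "j < n"
      from regular_ring_compose_conv_radius[OF b[OF this] assms(2-6)] \<Phi>'
      have "ereal R \<le> fps_conv_radius (fps_deriv \<Phi> * (b j oo \<Phi>))"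
        unfolding \<Phi>_def by (intro order_trans[OF _ fps_conv_radius_mult]) simp
      then show "ereal R \<le> fps_conv_radius (B i j)"
        using \<Phi>' by (simp add: B_def)
    qed (use False in simp)
    then show ?thesis by (simp add: G_def \<Phi>_def)
  qed
qed

text \<open>
  The special case of the identity map on a small disc.
\<close>

lemma regular_ode_conv_radius_pos:
  assumes "satisfies_regular_ode U F" and "open U" "0 \<in> U"
  shows "0 < fps_conv_radius F"
proof -
  obtain e where e: "e > 0" "ball 0 e \<subseteq> U" using assms(2,3) by (auto simp: open_contains_ball)
  have "(\<lambda>z. z) has_fps_expansion fps_expansion (\<lambda>z. z) (0 :: complex)"
    by (rule has_fps_expansion_fps_expansion[of UNIV]) auto
  then have X: "fps_expansion (\<lambda>z. z) (0 :: complex) = fps_X"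
    using has_fps_expansion_fps_X by (metis fps_expansion_unique_complex)
  have "ereal e \<le> fps_conv_radius (F oo fps_expansion (\<lambda>z. z) 0)"
    by (rule regular_ode_compose_conv_radius[OF assms(1,3)]) (use e in auto)
  then have "ereal e \<le> fps_conv_radius F" unfolding X by simp
  then show ?thesis by (rule less_le_trans[rotated]) (use e in simp)
qed

theorem regular_ode_continuation:
  assumes "satisfies_regular_ode U F" and "open U" "0 \<in> U"
    and V: "open V" "cball 0 1 \<subseteq> V" and \<phi>: "\<phi> holomorphic_on V" "\<phi> ` V \<subseteq> U" "\<phi> 0 = 0"
  shows "1 < fps_conv_radius (F oo fps_expansion \<phi> 0)"
    and "\<forall>\<^sub>F z in nhds 0. eval_fps (F oo fps_expansion \<phi> 0) z = eval_fps F (\<phi> z)"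
proof -
  obtain e where e: "e > 0" "(\<Union>x\<in>cball 0 1. ball x e) \<subseteq> V"
    using compact_subset_open_imp_ball_epsilon_subset[OF compact_cball V] by blast
  have ball: "ball 0 (1 + e) \<subseteq> V"
  proof
    fix z :: complex assume z: "z \<in> ball 0 (1 + e)"
    show "z \<in> V"
    proof (cases "cmod z \<le> 1")
      case False
      define w where "w = z /\<^sub>R cmod z"
      have "z - w = (1 - 1 / cmod z) *\<^sub>R z" by (simp add: w_def scaleR_left_diff_distrib divide_inverse)
      then have "cmod (z - w) = \<bar>1 - 1 / cmod z\<bar> * cmod z" by (simp only: norm_scaleR)
      also have "\<dots> = cmod z - 1"
      proof -
        have gt: "1 < cmod z" using False by simp
        then have "z \<noteq> 0" by auto
        moreover have "0 < cmod z" using gt by linarith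
        then have "1 / cmod z < 1" using gt by (simp only: divide_less_eq_1_pos)
        ultimately have "z \<noteq> 0" "1 - 1 / cmod z > 0" by auto
        then show ?thesis by (simp add: abs_of_pos left_diff_distrib)
      qed
      finally have "dist w z < e" using z by (simp add: dist_norm norm_minus_commute)
      moreover have "w \<in> cball 0 1" using False by (cases "z = 0") (auto simp: w_def)
      ultimately have "z \<in> (\<Union>x\<in>cball 0 1. ball x e)" by (intro UN_I[of w]) auto
      then show ?thesis using e(2) by blast
    qed (use V(2) in auto)
  qed
  have "ereal (1 + e) \<le> fps_conv_radius (F oo fps_expansion \<phi> 0)"
    using e(1) ball \<phi> by (intro regular_ode_compose_conv_radius[OF assms(1,3)]) (auto intro: holomorphic_on_subset)
  then show "1 < fps_conv_radius (F oo fps_expansion \<phi> 0)"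
    by (rule less_le_trans[rotated]) (use e(1) in \<open>simp add: one_ereal_def\<close>)
  have "eval_fps F has_fps_expansion F"
    using regular_ode_conv_radius_pos[OF assms(1-3)] by (simp add: has_fps_expansion_def)
  moreover have "\<phi> has_fps_expansion fps_expansion \<phi> 0"
    using V \<phi> by (intro has_fps_expansion_fps_expansion[of V]) auto
  moreover have "fps_nth (fps_expansion \<phi> 0) 0 = 0" using \<phi>(3) by (simp add: fps_expansion_def)
  ultimately have "(eval_fps F \<circ> \<phi>) has_fps_expansion (F oo fps_expansion \<phi> 0)"
    by (rule has_fps_expansion_compose)
  then show "\<forall>\<^sub>F z in nhds 0. eval_fps (F oo fps_expansion \<phi> 0) z = eval_fps F (\<phi> z)"
    by (simp add: has_fps_expansion_def)
qed

section \<open>Tensor products with a field of fractions\<close>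

definition subring_set :: "'a :: comm_ring_1 set \<Rightarrow> bool" where
  "subring_set S \<longleftrightarrow> 1 \<in> S \<and> (\<forall>a\<in>S. \<forall>b\<in>S. a - b \<in> S \<and> a * b \<in> S)"

lemma subring_setD:
  assumes "subring_set S"
  shows "1 \<in> S" "a \<in> S \<Longrightarrow> b \<in> S \<Longrightarrow> a - b \<in> S" "a \<in> S \<Longrightarrow> b \<in> S \<Longrightarrow> a * b \<in> S"
    "0 \<in> S" "a \<in> S \<Longrightarrow> - a \<in> S" "a \<in> S \<Longrightarrow> b \<in> S \<Longrightarrow> a + b \<in> S" "a \<in> S \<Longrightarrow> a ^ n \<in> S"
proof -
  show 1: "1 \<in> S" and diff: "\<And>a b. a \<in> S \<Longrightarrow> b \<in> S \<Longrightarrow> a - b \<in> S"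
    and mult: "\<And>a b. a \<in> S \<Longrightarrow> b \<in> S \<Longrightarrow> a * b \<in> S"
    using assms by (auto simp: subring_set_def)
  show 0: "0 \<in> S" using diff[OF 1 1] by simp
  show neg: "\<And>a. a \<in> S \<Longrightarrow> - a \<in> S" using diff[OF 0] by simp
  show "a \<in> S \<Longrightarrow> b \<in> S \<Longrightarrow> a + b \<in> S" using diff[OF _ neg, of a b] by simp
  show "a \<in> S \<Longrightarrow> a ^ n \<in> S" by (induction n) (auto simp: 1 mult)
qed

lemma type_algebra_simps [simp]:
  "carrier (ring_of_type_algebra\<lparr>carrier := S\<rparr>) = S"
  "x \<otimes>\<^bsub>ring_of_type_algebra\<lparr>carrier := S\<rparr>\<^esub> y = x * y"
  "x \<oplus>\<^bsub>ring_of_type_algebra\<lparr>carrier := S\<rparr>\<^esub> y = x + y"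
  "\<one>\<^bsub>ring_of_type_algebra\<lparr>carrier := S\<rparr>\<^esub> = 1"
  "\<zero>\<^bsub>ring_of_type_algebra\<lparr>carrier := S\<rparr>\<^esub> = 0"
  "x \<otimes>\<^bsub>ring_of_type_algebra\<^esub> y = x * y" "x \<oplus>\<^bsub>ring_of_type_algebra\<^esub> y = x + y"
  "\<one>\<^bsub>ring_of_type_algebra\<^esub> = 1" "\<zero>\<^bsub>ring_of_type_algebra\<^esub> = 0"
  by (simp_all add: ring_of_type_algebra_def)

lemma subring_set_is_cring:
  assumes S: "subring_set S"
  shows "cring (ring_of_type_algebra\<lparr>carrier := S\<rparr>)"
proof (rule cringI)
  note D = subring_setD[OF S]
  show "abelian_group (ring_of_type_algebra\<lparr>carrier := S\<rparr>)"
  proof (rule abelian_groupI)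
    fix x assume "x \<in> carrier (ring_of_type_algebra\<lparr>carrier := S\<rparr>)"
    then show "\<exists>y\<in>carrier (ring_of_type_algebra\<lparr>carrier := S\<rparr>).
        y \<oplus>\<^bsub>ring_of_type_algebra\<lparr>carrier := S\<rparr>\<^esub> x = \<zero>\<^bsub>ring_of_type_algebra\<lparr>carrier := S\<rparr>\<^esub>"
      using D(5)[of x] by (intro bexI[of _ "- x"]) auto
  qed (auto simp: D algebra_simps)
  show "comm_monoid (ring_of_type_algebra\<lparr>carrier := S\<rparr>)"
    by (rule comm_monoidI) (auto simp: D algebra_simps)
qed (auto simp: algebra_simps)

lemma subring_set_a_inv:
  assumes S: "subring_set S" and "x \<in> S"
  shows "\<ominus>\<^bsub>ring_of_type_algebra\<lparr>carrier := S\<rparr>\<^esub> x = - x"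
proof -
  interpret cring "ring_of_type_algebra\<lparr>carrier := S\<rparr>" by (rule subring_set_is_cring[OF S])
  show ?thesis using minus_equality[of "- x" x] subring_setD(5)[OF S] assms(2) by simp
qed

lemma subfield_of_type_algebra:
  fixes S K :: "'a :: field set"
  assumes S: "subring_set S" and K: "subring_set K" "K \<subseteq> S" and inv: "\<And>k. k \<in> K \<Longrightarrow> inverse k \<in> K"
  shows "subfield K (ring_of_type_algebra\<lparr>carrier := S\<rparr>)"
proof -
  let ?R = "ring_of_type_algebra\<lparr>carrier := S\<rparr> :: 'a ring"
  interpret cring ?R by (rule subring_set_is_cring[OF S])
  have "subring K ?R"
    by (rule subringI) (use K subring_setD[OF K(1)] in \<open>auto simp: subring_set_a_inv[OF S]\<close>)
  then show ?thesis
  proof (intro subfieldI subcringI')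
    have "\<exists>y\<in>K. x * y = 1" if "x \<in> K" "x \<noteq> 0" for x
      using that inv[of x] by (intro bexI[of _ "inverse x"]) auto
    then show "Units (?R\<lparr>carrier := K\<rparr>) = K - {\<zero>\<^bsub>?R\<^esub>}"
      by (auto simp: Units_def ring_of_type_algebra_def mult.commute)
  qed
qed

lemma subring_set_frac_carrier:
  assumes S: "subring_set S"
  shows "subring_set (frac_carrier S)" and "q \<in> frac_carrier S \<Longrightarrow> inverse q \<in> frac_carrier S"
    and "a \<in> S \<Longrightarrow> fps_to_fls a \<in> frac_carrier S"
proof -
  note D = subring_setD[OF S]
  have intro: "fps_to_fls a / fps_to_fls b \<in> frac_carrier S" if "a \<in> S" "b \<in> S" "b \<noteq> 0" for a b
    using that by (auto simp: frac_carrier_def)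
  show base: "a \<in> S \<Longrightarrow> fps_to_fls a \<in> frac_carrier S" for a using intro[of a 1] D(1) by simp
  show "q \<in> frac_carrier S \<Longrightarrow> inverse q \<in> frac_carrier S"
  proof -
    assume "q \<in> frac_carrier S"
    then obtain a b where q: "q = fps_to_fls a / fps_to_fls b" "a \<in> S" "b \<in> S" "b \<noteq> 0" by (auto simp: frac_carrier_def)
    show ?thesis using intro[of b a] base[OF D(4)] q by (cases "a = 0") auto
  qed
  show "subring_set (frac_carrier S)"
    unfolding subring_set_def
  proof (intro conjI ballI)
    show "1 \<in> frac_carrier S" using base[OF D(1)] by simp
    fix p q assume "p \<in> frac_carrier S" "q \<in> frac_carrier S"
    then obtain a b c d where p: "p = fps_to_fls a / fps_to_fls b" "a \<in> S" "b \<in> S" "b \<noteq> 0"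
      and q: "q = fps_to_fls c / fps_to_fls d" "c \<in> S" "d \<in> S" "d \<noteq> 0"
      by (auto simp: frac_carrier_def)
    have "p - q = fps_to_fls (a * d - c * b) / fps_to_fls (b * d)" "p * q = fps_to_fls (a * c) / fps_to_fls (b * d)"
      using p q by (simp_all add: fls_times_fps_to_fls diff_frac_eq)
    then show "p - q \<in> frac_carrier S" "p * q \<in> frac_carrier S"
      using intro[of "a * d - c * b" "b * d"] intro[of "a * c" "b * d"] p q D by simp_all
  qed
qed

text \<open>
  The additive extension of \<open>f\<close> from a set to the free abelian group on it.
\<close>

definition frag_eval :: "('a \<Rightarrow> 'b :: comm_ring_1) \<Rightarrow> ('a \<Rightarrow>\<^sub>0 int) \<Rightarrow> 'b" where
  "frag_eval f c = (\<Sum>x\<in>Poly_Mapping.keys c. of_int (Poly_Mapping.lookup c x) * f x)"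

lemma frag_eval_superset:
  assumes "finite A" "Poly_Mapping.keys c \<subseteq> A"
  shows "frag_eval f c = (\<Sum>x\<in>A. of_int (Poly_Mapping.lookup c x) * f x)"
  unfolding frag_eval_def using assms by (intro sum.mono_neutral_left) (auto simp: in_keys_iff)

lemma frag_eval_0 [simp]: "frag_eval f 0 = 0"
  by (simp add: frag_eval_def)

lemma frag_eval_of [simp]: "frag_eval f (frag_of x) = f x"
  by (simp add: frag_eval_def)

lemma frag_eval_diff: "frag_eval f (c - d) = frag_eval f c - frag_eval f d"
proof -
  let ?A = "Poly_Mapping.keys c \<union> Poly_Mapping.keys d"
  have "Poly_Mapping.keys (c - d) \<subseteq> ?A" by (auto simp: in_keys_iff lookup_minus)
  then show ?thesis
    by (simp add: frag_eval_superset[of ?A] lookup_minus left_diff_distrib sum_subtractf)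
qed

lemma frag_eval_add: "frag_eval f (c + d) = frag_eval f c + frag_eval f d"
  using frag_eval_diff[of f c "- d"] frag_eval_diff[of f 0 d] by simp

lemma frag_induct [case_names zero one diff]:
  assumes "P 0" "\<And>x. P (frag_of x)" "\<And>a b. P a \<Longrightarrow> P b \<Longrightarrow> P (a - b)"
  shows "P c"
  using frag_induction[of c UNIV P] assms by blast

text \<open>
  The multiplication of \<open>pair_ring\<close> for algebras whose multiplication is that of the ambient types.
\<close>

definition pair_mult :: "('a :: comm_ring_1 \<times> 'b :: comm_ring_1 \<Rightarrow>\<^sub>0 int) \<Rightarrow> ('a \<times> 'b \<Rightarrow>\<^sub>0 int) \<Rightarrow> ('a \<times> 'b \<Rightarrow>\<^sub>0 int)" where
  "pair_mult c d = frag_extend (\<lambda>(a, b). frag_extend (\<lambda>(a', b'). frag_of (a * a', b * b')) d) c"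

lemma pair_mult_of [simp]: "pair_mult (frag_of (a, b)) (frag_of (a', b')) = frag_of (a * a', b * b')"
  by (simp add: pair_mult_def)

lemma pair_mult_0 [simp]: "pair_mult 0 d = 0" "pair_mult c 0 = 0"
  by (simp_all add: pair_mult_def case_prod_unfold frag_extend_eq_0)

lemma pair_mult_diff_left: "pair_mult (c - c') d = pair_mult c d - pair_mult c' d"
  by (simp add: pair_mult_def frag_extend_diff)

lemma pair_mult_diff_right: "pair_mult c (d - d') = pair_mult c d - pair_mult c d'"
proof (induction c rule: frag_induct)
  case (one x)
  then show ?case by (cases x) (simp add: pair_mult_def frag_extend_diff)
qed (auto simp: pair_mult_diff_left)

lemma pair_mult_add:
  "pair_mult (c + c') d = pair_mult c d + pair_mult c' d" "pair_mult c (d + d') = pair_mult c d + pair_mult c d'"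
  using pair_mult_diff_left[of c "- c'" d] pair_mult_diff_left[of 0 c' d]
    pair_mult_diff_right[of c d "- d'"] pair_mult_diff_right[of c 0 d'] by simp_all

lemma pair_mult_assoc: "pair_mult (pair_mult c d) e = pair_mult c (pair_mult d e)"
proof (induction c rule: frag_induct)
  case (one x)
  show ?case
  proof (induction d rule: frag_induct)
    case (one y)
    show ?case
    proof (induction e rule: frag_induct)
      case (one z)
      show ?case by (cases x; cases y; cases z) (simp add: mult.assoc)
    qed (auto simp: pair_mult_diff_right)
  qed (auto simp: pair_mult_diff_left pair_mult_diff_right)
qed (auto simp: pair_mult_diff_left)

lemma pair_mult_one: "pair_mult (frag_of (1, 1)) c = c" "pair_mult c (frag_of (1, 1)) = c"
proof -
  show "pair_mult (frag_of (1, 1)) c = c"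
  proof (induction c rule: frag_induct)
    case (one x)
    then show ?case by (cases x) simp
  qed (auto simp: pair_mult_diff_right)
  show "pair_mult c (frag_of (1, 1)) = c"
  proof (induction c rule: frag_induct)
    case (one x)
    then show ?case by (cases x) simp
  qed (auto simp: pair_mult_diff_left)
qed

lemma keys_pair_mult:
  assumes "Poly_Mapping.keys c \<subseteq> S \<times> T" "Poly_Mapping.keys d \<subseteq> S \<times> T"
    and "\<And>a a'. a \<in> S \<Longrightarrow> a' \<in> S \<Longrightarrow> a * a' \<in> S" "\<And>b b'. b \<in> T \<Longrightarrow> b' \<in> T \<Longrightarrow> b * b' \<in> T"
  shows "Poly_Mapping.keys (pair_mult c d) \<subseteq> S \<times> T"
proof -
  have "Poly_Mapping.keys (frag_extend (\<lambda>(a', b'). frag_of (a * a', b * b')) d) \<subseteq> S \<times> T" if "(a, b) \<in> S \<times> T" for a b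
    by (rule order_trans[OF keys_frag_extend]) (use that assms in auto)
  then show ?thesis
    unfolding pair_mult_def
    by (intro order_trans[OF keys_frag_extend] UN_least) (use assms(1) in auto)
qed

text \<open>
  The tensor product of \<open>S\<close> over \<open>R\<close> with the field of fractions \<open>K\<close> of \<open>R\<close>.
\<close>

locale fraction_tensor =
  fixes S R :: "rat fps set"
  assumes S: "subring_set S" and R: "subring_set R" and RS: "R \<subseteq> S"
begin

abbreviation "K \<equiv> frac_carrier R"
abbreviation "FF \<equiv> frac_field S"
abbreviation "PR \<equiv> pair_ring (fps_subring S) (frac_field R)"
definition "NN = tensor_kernel (fps_subring S) (frac_field R) R id fps_to_fls"
abbreviation "TT \<equiv> tensor_algebra (fps_subring S) (frac_field R) R id fps_to_fls"
abbreviation "pure \<equiv> pure_tensor (fps_subring S) (frac_field R) R id fps_to_fls"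

text \<open>
  The multiplication map \<open>a \<otimes> q \<mapsto> a q\<close>, before passing to the quotient.
\<close>

definition mul_map :: "(rat fps \<times> rat fls \<Rightarrow>\<^sub>0 int) \<Rightarrow> rat fls" where
  "mul_map = frag_eval (\<lambda>(a, q). fps_to_fls a * q)"

lemmas S_closed = subring_setD[OF S]
lemmas R_closed = subring_setD[OF R]
lemmas K_subring = subring_set_frac_carrier(1)[OF R]
lemmas K_closed = subring_setD[OF K_subring]
lemmas FS_subring = subring_set_frac_carrier(1)[OF S]
lemmas FS_closed = subring_setD[OF FS_subring]

lemma K_subset: "K \<subseteq> frac_carrier S"
  using RS by (auto simp: frac_carrier_def)

lemma PR_simps [simp]:
  "carrier PR = {c. Poly_Mapping.keys c \<subseteq> S \<times> K}" "c \<otimes>\<^bsub>PR\<^esub> d = pair_mult c d"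
  "\<one>\<^bsub>PR\<^esub> = frag_of (1, 1)" "\<zero>\<^bsub>PR\<^esub> = 0" "c \<oplus>\<^bsub>PR\<^esub> d = c + d"
  by (simp_all add: pair_ring_def fps_subring_def frac_field_def pair_mult_def)

lemma PR_ring: "ring PR"
proof (rule ringI)
  show "abelian_group PR"
  proof (rule abelian_groupI)
    fix x assume "x \<in> carrier PR"
    then show "\<exists>y\<in>carrier PR. y \<oplus>\<^bsub>PR\<^esub> x = \<zero>\<^bsub>PR\<^esub>"
      by (intro bexI[of _ "- x"]) auto
  qed (auto simp: algebra_simps dest!: Poly_Mapping.keys_add[THEN subsetD])
  have "Poly_Mapping.keys x \<subseteq> S \<times> K \<Longrightarrow> Poly_Mapping.keys y \<subseteq> S \<times> K \<Longrightarrow>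
      Poly_Mapping.keys (pair_mult x y) \<subseteq> S \<times> K" for x y
    by (rule keys_pair_mult) (auto simp: S_closed K_closed)
  then show "monoid PR"
    by (intro monoidI) (simp_all add: pair_mult_assoc pair_mult_one S_closed K_closed)
qed (auto simp: pair_mult_add)

lemma FF_cring: "cring FF"
  unfolding frac_field_def by (rule subring_set_is_cring[OF FS_subring])

lemma FF_simps [simp]:
  "carrier FF = frac_carrier S" "x \<otimes>\<^bsub>FF\<^esub> y = x * y" "x \<oplus>\<^bsub>FF\<^esub> y = x + y" "\<one>\<^bsub>FF\<^esub> = 1" "\<zero>\<^bsub>FF\<^esub> = 0"
  by (simp_all add: frac_field_def)

lemma mul_map_in: 
  assumes "Poly_Mapping.keys c \<subseteq> S \<times> K"
  shows "mul_map c \<in> frac_carrier S"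
  using assms
proof (induction c rule: frag_induction)
  case (one x)
  then show ?case using K_subset subring_set_frac_carrier(3)[OF S] FS_closed(3)
    by (cases x) (auto simp: mul_map_def)
qed (auto simp: mul_map_def frag_eval_diff FS_closed)

lemma mul_map_mult: "mul_map (pair_mult c d) = mul_map c * mul_map d"
proof (induction c rule: frag_induct)
  case (one x)
  show ?case
  proof (induction d rule: frag_induct)
    case (one y)
    show ?case by (cases x; cases y) (simp add: mul_map_def fls_times_fps_to_fls mult_ac)
  qed (auto simp: pair_mult_diff_right mul_map_def frag_eval_diff right_diff_distrib)
qed (auto simp: pair_mult_diff_left mul_map_def frag_eval_diff left_diff_distrib)

lemma mul_map_hom: "ring_hom_ring PR FF mul_map"
proof (rule ring_hom_ringI)
  show "ring PR" by (rule PR_ring)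
  show "ring FF" using FF_cring by (rule cring.axioms(1))
qed (auto intro!: mul_map_in simp: mul_map_mult, auto simp: mul_map_def frag_eval_add)

lemma relations_in_PR: "tensor_relations (fps_subring S) (frac_field R) R id fps_to_fls \<subseteq> carrier PR"
proof -
  have two: "Poly_Mapping.keys (frag_of x - frag_of y) \<subseteq> S \<times> K"
    if "x \<in> S \<times> K" "y \<in> S \<times> K" for x y :: "rat fps \<times> rat fls"
    using that by (auto simp: in_keys_iff lookup_minus split: if_splits)
  have three: "Poly_Mapping.keys (frag_of x - frag_of y - frag_of z) \<subseteq> S \<times> K"
    if "x \<in> S \<times> K" "y \<in> S \<times> K" "z \<in> S \<times> K" for x y z :: "rat fps \<times> rat fls"
    using that by (auto simp: in_keys_iff lookup_minus split: if_splits)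
  have K: "r \<in> R \<Longrightarrow> fps_to_fls r \<in> K" for r
    by (rule subring_set_frac_carrier(3)[OF R])
  show ?thesis
    unfolding tensor_relations_def PR_simps
    by (rule subsetI, elim UnE CollectE exE conjE; hypsubst; intro CollectI three two)
      (use RS in \<open>auto simp: fps_subring_def frac_field_def S_closed K_closed K\<close>)
qed

lemma NN_subgroup: "subgroup NN (add_monoid PR)"
proof -
  interpret ring PR by (rule PR_ring)
  show ?thesis
    unfolding NN_def tensor_kernel_def using add.generate_is_subgroup relations_in_PR by simp
qed

lemma NN_closed:
  "0 \<in> NN" "c \<in> NN \<Longrightarrow> d \<in> NN \<Longrightarrow> c + d \<in> NN" "c \<in> NN \<Longrightarrow> - c \<in> NN" "c \<in> NN \<Longrightarrow> d \<in> NN \<Longrightarrow> c - d \<in> NN"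
proof -
  interpret ring PR by (rule PR_ring)
  interpret N: subgroup NN "add_monoid PR" by (rule NN_subgroup)
  show "0 \<in> NN" using N.one_closed by simp
  show add: "c \<in> NN \<Longrightarrow> d \<in> NN \<Longrightarrow> c + d \<in> NN" for c d using N.m_closed by simp
  show neg: "- c \<in> NN" if "c \<in> NN" for c
  proof -
    have "c \<in> carrier PR" using N.subset that by auto
    then have "\<ominus>\<^bsub>PR\<^esub> c = - c" by (intro minus_equality) auto
    with N.m_inv_closed[OF that] show ?thesis by (simp add: a_inv_def)
  qed
  show "c \<in> NN \<Longrightarrow> d \<in> NN \<Longrightarrow> c - d \<in> NN" using add[OF _ neg, of c d] by simp
qed

lemma NN_add:
  assumes "a \<in> S" "a' \<in> S" "b \<in> K"
  shows "frag_of (a + a', b) - frag_of (a, b) - frag_of (a', b) \<in> NN"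
  unfolding NN_def tensor_kernel_def tensor_relations_def
  by (rule generate.incl) (use assms in \<open>auto simp: fps_subring_def frac_field_def\<close>)

lemma NN_balance:
  assumes "r \<in> R" "a \<in> S" "b \<in> K"
  shows "frag_of (r * a, b) - frag_of (a, fps_to_fls r * b) \<in> NN"
  unfolding NN_def tensor_kernel_def tensor_relations_def
  by (rule generate.incl) (use assms in \<open>auto simp: fps_subring_def frac_field_def\<close>)

lemma NN_trans: "c - d \<in> NN \<Longrightarrow> d - e \<in> NN \<Longrightarrow> c - e \<in> NN"
  using NN_closed(2)[of "c - d" "d - e"] by simp

lemma NN_sym: "c - d \<in> NN \<Longrightarrow> d - c \<in> NN"
  using NN_closed(3)[of "c - d"] by simp

lemma NN_zero: "b \<in> K \<Longrightarrow> frag_of (0, b) \<in> NN"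
  using NN_closed(3)[OF NN_add[of 0 0 b]] S_closed(4) by simp

lemma NN_diff:
  assumes "a \<in> S" "a' \<in> S" "b \<in> K"
  shows "frag_of (a, b) - frag_of (a', b) - frag_of (a - a', b) \<in> NN"
  using NN_add[of "a - a'" a' b] assms S_closed(2) by (simp add: algebra_simps)

lemma inverse_in_K: "s \<in> R \<Longrightarrow> s \<noteq> 0 \<Longrightarrow> 1 / fps_to_fls s \<in> K"
  using subring_set_frac_carrier(2)[OF R, of "fps_to_fls s"] subring_set_frac_carrier(3)[OF R, of s]
  by (simp add: divide_inverse)

text \<open>
  Every tensor is pure, of the form \<open>a \<otimes> 1/s\<close>: common denominators can be moved across the tensor
  product. This makes the kernel of the multiplication map computable.
\<close>

lemma tensor_common_denominator:
  assumes "Poly_Mapping.keys c \<subseteq> S \<times> K"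
  shows "\<exists>a\<in>S. \<exists>s\<in>R. s \<noteq> 0 \<and> c - frag_of (a, 1 / fps_to_fls s) \<in> NN"
  using assms
proof (induction c rule: frag_induction)
  case zero
  have "0 - frag_of (0, 1 / fps_to_fls 1) \<in> NN"
    using NN_closed(3)[OF NN_zero[OF K_closed(1)]] by simp
  then have "1 \<noteq> (0 :: rat fps) \<and> 0 - frag_of (0, 1 / fps_to_fls 1) \<in> NN" by (rule conjI[OF one_neq_zero])
  then show ?case by (rule bexI[OF bexI[OF _ R_closed(1)] S_closed(4)])
next
  case (one x)
  then obtain a q where x: "x = (a, q)" "a \<in> S" "q \<in> K" by auto
  then obtain u s where q: "q = fps_to_fls u / fps_to_fls s" "u \<in> R" "s \<in> R" "s \<noteq> 0"
    by (auto simp: frac_carrier_def)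
  have "frag_of (u * a, 1 / fps_to_fls s) - frag_of (a, fps_to_fls u * (1 / fps_to_fls s)) \<in> NN"
    using q x by (intro NN_balance inverse_in_K)
  then have "frag_of (a, q) - frag_of (u * a, 1 / fps_to_fls s) \<in> NN"
    using NN_sym q by simp
  moreover have "u * a \<in> S" using q x RS S_closed(3) by blast
  ultimately show ?case using x q by blast
next
  case (diff c d)
  then obtain a s a' s' where c: "a \<in> S" "s \<in> R" "s \<noteq> 0" "c - frag_of (a, 1 / fps_to_fls s) \<in> NN"
    and d: "a' \<in> S" "s' \<in> R" "s' \<noteq> 0" "d - frag_of (a', 1 / fps_to_fls s') \<in> NN" by blast
  define b where "b = 1 / fps_to_fls (s * s')"
  have ss: "s * s' \<in> R" "s * s' \<noteq> 0" using c d R_closed(3) by auto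
  have bK: "b \<in> K" unfolding b_def by (rule inverse_in_K[OF ss])
  have "fps_to_fls s' * b = 1 / fps_to_fls s" "fps_to_fls s * b = 1 / fps_to_fls s'"
    using c d by (simp_all add: b_def fls_times_fps_to_fls)
  with NN_balance[OF d(2) c(1) bK] NN_balance[OF c(2) d(1) bK]
  have balanced: "frag_of (s' * a, b) - frag_of (a, 1 / fps_to_fls s) \<in> NN" "frag_of (s * a', b) - frag_of (a', 1 / fps_to_fls s') \<in> NN"
    by simp_all
  have cd: "c - frag_of (s' * a, b) \<in> NN" "d - frag_of (s * a', b) \<in> NN"
    by (rule NN_trans[OF c(4) NN_sym[OF balanced(1)]], rule NN_trans[OF d(4) NN_sym[OF balanced(2)]])
  have mem: "s' * a \<in> S" "s * a' \<in> S" using c d RS S_closed(3) by blast+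
  have "(c - d) - frag_of (s' * a - s * a', b) =
      (c - frag_of (s' * a, b)) - (d - frag_of (s * a', b))
      + (frag_of (s' * a, b) - frag_of (s * a', b) - frag_of (s' * a - s * a', b))" by simp
  also have "\<dots> \<in> NN" by (intro NN_closed(2) NN_closed(4) cd NN_diff mem bK)
  finally have "s * s' \<noteq> 0 \<and> c - d - frag_of (s' * a - s * a', 1 / fps_to_fls (s * s')) \<in> NN"
    using ss(2) unfolding b_def by (rule conjI[rotated])
  then show ?case by (rule bexI[OF bexI[OF _ ss(1)] S_closed(2)[OF mem]])
qed

lemma mul_map_relation:
  assumes "y \<in> tensor_relations (fps_subring S) (frac_field R) R id fps_to_fls"
  shows "mul_map y = 0"
  using assms unfolding tensor_relations_def fps_subring_def frac_field_def type_algebra_simps id_apply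
  by (elim UnE CollectE exE conjE; hypsubst)
    (simp_all add: mul_map_def frag_eval_diff fls_times_fps_to_fls ring_distribs mult_ac)

lemma mul_map_NN:
  assumes "c \<in> NN"
  shows "mul_map c = 0"
proof -
  interpret hom: ring_hom_ring PR FF mul_map by (rule mul_map_hom)
  interpret ideal "a_kernel PR FF mul_map" PR by (rule hom.kernel_is_ideal)
  have "tensor_relations (fps_subring S) (frac_field R) R id fps_to_fls \<subseteq> a_kernel PR FF mul_map"
  proof
    fix y assume y: "y \<in> tensor_relations (fps_subring S) (frac_field R) R id fps_to_fls"
    then have "mul_map y = 0" by (rule mul_map_relation)
    moreover have "y \<in> carrier PR" using y relations_in_PR by (rule subsetD[rotated])
    ultimately show "y \<in> a_kernel PR FF mul_map" unfolding a_kernel_def' FF_simps by (intro CollectI conjI)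
  qed
  then have "NN \<subseteq> a_kernel PR FF mul_map"
    unfolding NN_def tensor_kernel_def by (rule hom.R.add.generate_subgroup_incl[OF _ a_subgroup])
  then have "c \<in> a_kernel PR FF mul_map" using assms by (rule subsetD)
  then show ?thesis unfolding a_kernel_def' FF_simps by blast
qed

lemma mul_map_kernel: "a_kernel PR FF mul_map = NN"
proof
  show "NN \<subseteq> a_kernel PR FF mul_map"
    using mul_map_NN subgroup.subset[OF NN_subgroup] by (auto simp: a_kernel_def')
  show "a_kernel PR FF mul_map \<subseteq> NN"
  proof
    fix c assume "c \<in> a_kernel PR FF mul_map"
    then have c: "Poly_Mapping.keys c \<subseteq> S \<times> K" "mul_map c = 0" by (auto simp: a_kernel_def')
    obtain a s where as: "a \<in> S" "s \<in> R" "s \<noteq> 0" "c - frag_of (a, 1 / fps_to_fls s) \<in> NN"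
      using tensor_common_denominator[OF c(1)] by blast
    have "mul_map (c - frag_of (a, 1 / fps_to_fls s)) = - (fps_to_fls a / fps_to_fls s)"
      using c(2) by (simp add: mul_map_def frag_eval_diff)
    with mul_map_NN[OF as(4)] have "a = 0" using as(3) by simp
    then have "frag_of (a, 1 / fps_to_fls s) \<in> NN" using NN_zero inverse_in_K as by simp
    with NN_closed(2)[OF as(4)] show "c \<in> NN" by fastforce
  qed
qed

lemma mul_map_image: "mul_map ` carrier PR = {fps_to_fls a / fps_to_fls s | a s. a \<in> S \<and> s \<in> R \<and> s \<noteq> 0}"
proof
  show "mul_map ` carrier PR \<subseteq> {fps_to_fls a / fps_to_fls s | a s. a \<in> S \<and> s \<in> R \<and> s \<noteq> 0}"
  proof
    fix y assume "y \<in> mul_map ` carrier PR"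
    then obtain c where c: "Poly_Mapping.keys c \<subseteq> S \<times> K" "y = mul_map c" by auto
    obtain a s where as: "a \<in> S" "s \<in> R" "s \<noteq> 0" "c - frag_of (a, 1 / fps_to_fls s) \<in> NN"
      using tensor_common_denominator[OF c(1)] by blast
    have "y = fps_to_fls a / fps_to_fls s"
      using mul_map_NN[OF as(4)] by (simp add: c mul_map_def frag_eval_diff)
    with as show "y \<in> {fps_to_fls a / fps_to_fls s | a s. a \<in> S \<and> s \<in> R \<and> s \<noteq> 0}" by blast
  qed
  have "fps_to_fls a / fps_to_fls s \<in> mul_map ` carrier PR" if "a \<in> S" "s \<in> R" "s \<noteq> 0" for a s
  proof -
    have "fps_to_fls a / fps_to_fls s = mul_map (frag_of (a, 1 / fps_to_fls s))" by (simp add: mul_map_def)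
    moreover have "frag_of (a, 1 / fps_to_fls s) \<in> carrier PR" using that inverse_in_K by simp
    ultimately show ?thesis by blast
  qed
  then show "{fps_to_fls a / fps_to_fls s | a s. a \<in> S \<and> s \<in> R \<and> s \<noteq> 0} \<subseteq> mul_map ` carrier PR" by blast
qed

definition independent_over :: "nat \<Rightarrow> (nat \<Rightarrow> rat fps) \<Rightarrow> bool" where
  "independent_over m h \<longleftrightarrow>
     (\<forall>r. (\<forall>i<m. r i \<in> R) \<longrightarrow> (\<Sum>i<m. r i * h i) = 0 \<longrightarrow> (\<forall>i<m. r i = 0))"

end

text \<open>
  The hypothesis is that the rank of \<open>S\<close> over \<open>R\<close> is at most \<open>bound\<close>.
\<close>

locale bounded_fraction_tensor = fraction_tensor +
  fixes bound :: real
  assumes bound: "\<And>m h. (\<And>i. i < m \<Longrightarrow> h i \<in> S) \<Longrightarrow> independent_over m h \<Longrightarrow> real m \<le> bound"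
begin

lemma S_sum: "(\<And>i. i \<in> I \<Longrightarrow> f i \<in> S) \<Longrightarrow> sum f I \<in> S"
  by (induction I rule: infinite_finite_induct) (auto simp: S_closed)

text \<open>
  Take a non-trivial relation over \<open>R\<close> between the powers of \<open>b\<close>. Dividing by the lowest power that
  occurs expresses a non-zero element of \<open>R\<close> as a multiple of \<open>b\<close>.
\<close>

lemma inverse_denominator:
  assumes b: "b \<in> S" "b \<noteq> 0"
  shows "\<exists>w\<in>S. \<exists>r\<in>R. r \<noteq> 0 \<and> r = b * w"
proof -
  obtain m :: nat where m: "real m > bound" using reals_Archimedean2 by blast
  have "\<not> independent_over m (\<lambda>i. b ^ i)"
    using bound[of m "\<lambda>i. b ^ i"] S_closed(7)[OF b(1)] m by fastforce
  then obtain r where r: "\<And>i. i < m \<Longrightarrow> r i \<in> R" "(\<Sum>i<m. r i * b ^ i) = 0" "\<exists>i<m. r i \<noteq> 0"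
    unfolding independent_over_def by blast
  define i0 where "i0 = (LEAST i. i < m \<and> r i \<noteq> 0)"
  have i0: "i0 < m" "r i0 \<noteq> 0" using LeastI_ex[OF r(3)] by (auto simp: i0_def)
  have below: "r i = 0" if "i < i0" for i
    using not_less_Least[of i "\<lambda>i. i < m \<and> r i \<noteq> 0"] that i0(1) by (auto simp: i0_def)
  define w where "w = - (\<Sum>i\<in>{Suc i0..<m}. r i * b ^ (i - Suc i0))"
  have "(\<Sum>i<m. r i * b ^ i) = (\<Sum>i\<in>insert i0 {Suc i0..<m}. r i * b ^ i)"
    using i0 below by (intro sum.mono_neutral_right) (auto simp: not_less_eq_eq Suc_le_eq linorder_neq_iff)
  also have "\<dots> = b ^ i0 * r i0 + (\<Sum>i\<in>{Suc i0..<m}. b ^ i0 * (b * (r i * b ^ (i - Suc i0))))"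
  proof -
    have "b ^ i = b ^ i0 * (b * b ^ (i - Suc i0))" if "Suc i0 \<le> i" for i
      using that by (simp flip: power_Suc power_add)
    then show ?thesis by (simp add: mult_ac)
  qed
  also have "\<dots> = b ^ i0 * (r i0 - b * w)"
    by (simp add: w_def right_diff_distrib distrib_left flip: sum_distrib_left)
  finally have "r i0 = b * w" using r(2) b(2) by simp
  moreover have "w \<in> S"
    unfolding w_def using r(1) RS b(1)
    by (intro S_closed(5) S_sum S_closed(3) S_closed(7)) auto
  ultimately show ?thesis using i0 r(1) by blast
qed

end

context bounded_fraction_tensor
begin

text \<open>
  Multiplying numerator and denominator of \<open>a / b\<close> by a suitable element brings the denominator into \<open>R\<close>.
\<close>

lemma mul_map_surj: "mul_map ` carrier PR = carrier FF"
proof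
  show "mul_map ` carrier PR \<subseteq> carrier FF"
    using mul_map_in by auto
  show "carrier FF \<subseteq> mul_map ` carrier PR"
  proof
    fix q assume "q \<in> carrier FF"
    then obtain a b where q: "q = fps_to_fls a / fps_to_fls b" "a \<in> S" "b \<in> S" "b \<noteq> 0"
      by (auto simp: frac_carrier_def)
    obtain w r where wr: "w \<in> S" "r \<in> R" "r \<noteq> 0" "r = b * w"
      using inverse_denominator[OF q(3,4)] by blast
    have "w \<noteq> 0" using wr by auto
    then have "q = fps_to_fls (a * w) / fps_to_fls r"
      using q wr(4) by (simp add: fls_times_fps_to_fls)
    moreover have "a * w \<in> S" using q wr S_closed(3) by blast
    ultimately show "q \<in> mul_map ` carrier PR" unfolding mul_map_image using wr by blast
  qed
qed

lemma FF_subfield: "subfield K FF"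
  unfolding frac_field_def
  by (rule subfield_of_type_algebra[OF FS_subring K_subring K_subset subring_set_frac_carrier(2)[OF R]])

lemma exists_common_denominator:
  "set us \<subseteq> frac_carrier S \<Longrightarrow> \<exists>b\<in>S. b \<noteq> 0 \<and> (\<forall>u\<in>set us. \<exists>a\<in>S. u * fps_to_fls b = fps_to_fls a)"
proof (induction us)
  case Nil
  then show ?case using S_closed(1) by (intro bexI[of _ 1]) auto
next
  case (Cons v us)
  then obtain b where b: "b \<in> S" "b \<noteq> 0" "\<forall>u\<in>set us. \<exists>a\<in>S. u * fps_to_fls b = fps_to_fls a" by auto
  obtain c d where v: "v = fps_to_fls c / fps_to_fls d" "c \<in> S" "d \<in> S" "d \<noteq> 0"
    using Cons.prems by (auto simp: frac_carrier_def)
  have old: "\<exists>a\<in>S. u * fps_to_fls (b * d) = fps_to_fls a" if u: "u \<in> set us" for u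
  proof -
    obtain a where a: "a \<in> S" "u * fps_to_fls b = fps_to_fls a" using bspec[OF b(3) u] by (elim bexE)
    have "u * fps_to_fls (b * d) = (u * fps_to_fls b) * fps_to_fls d"
      by (simp only: fls_times_fps_to_fls mult.assoc)
    also have "\<dots> = fps_to_fls (a * d)" by (simp only: a(2) fls_times_fps_to_fls)
    finally show ?thesis by (rule bexI[OF _ S_closed(3)[OF a(1) v(3)]])
  qed
  have new: "\<exists>a\<in>S. v * fps_to_fls (b * d) = fps_to_fls a"
  proof (rule bexI[OF _ S_closed(3)[OF v(2) b(1)]])
    show "v * fps_to_fls (b * d) = fps_to_fls (c * b)"
      using v by (simp add: fls_times_fps_to_fls)
  qed
  have "\<forall>u\<in>set (v # us). \<exists>a\<in>S. u * fps_to_fls (b * d) = fps_to_fls a"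
  proof
    fix u assume "u \<in> set (v # us)"
    then consider "u = v" | "u \<in> set us" by auto
    then show "\<exists>a\<in>S. u * fps_to_fls (b * d) = fps_to_fls a" using old new by cases simp_all
  qed
  moreover have "b * d \<noteq> 0" using b v by simp
  ultimately show ?case by (intro bexI[OF _ S_closed(3)[OF b(1) v(3)]] conjI)
qed

lemma FF_combine:
  "length ks = length us \<Longrightarrow> ring.combine FF ks us = (\<Sum>i<length us. ks ! i * us ! i)"
proof (induction ks us rule: list_induct2)
  case Nil
  interpret FF: cring FF by (rule FF_cring)
  show ?case by simp
next
  case (Cons k ks u us)
  interpret FF: cring FF by (rule FF_cring)
  show ?case using Cons by (simp add: sum.lessThan_Suc_shift del: sum.lessThan_Suc)
qed

text \<open>
  Clearing denominators turns independent fractions into independent elements of \<open>S\<close>.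
\<close>

lemma FF_independent_length:
  assumes "ring.independent FF K us"
  shows "real (length us) \<le> bound"
proof -
  interpret FF: cring FF by (rule FF_cring)
  let ?m = "length us"
  have us: "set us \<subseteq> frac_carrier S" using FF.independent_in_carrier[OF assms] by simp
  obtain b where b: "b \<in> S" "b \<noteq> 0" "\<forall>u\<in>set us. \<exists>a\<in>S. u * fps_to_fls b = fps_to_fls a"
    using exists_common_denominator[OF us] by blast
  then have "\<forall>i. \<exists>a. i < ?m \<longrightarrow> a \<in> S \<and> us ! i * fps_to_fls b = fps_to_fls a" by (meson nth_mem)
  then obtain h where h: "\<And>i. i < ?m \<Longrightarrow> h i \<in> S" "\<And>i. i < ?m \<Longrightarrow> us ! i * fps_to_fls b = fps_to_fls (h i)"
    by metis
  have indep: "independent_over ?m h"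
    unfolding independent_over_def
  proof (intro allI impI)
    fix r i assume r: "\<forall>i<?m. r i \<in> R" and sum: "(\<Sum>i<?m. r i * h i) = 0" and i: "i < ?m"
    define ks where "ks = map (\<lambda>i. fps_to_fls (r i)) [0..<?m]"
    have "(\<Sum>i<?m. ks ! i * us ! i) * fps_to_fls b = (\<Sum>i<?m. fps_to_fls (r i) * (us ! i * fps_to_fls b))"
      by (simp add: ks_def sum_distrib_right mult.assoc)
    also have "\<dots> = fps_to_fls (\<Sum>i<?m. r i * h i)"
      by (simp add: h fps_to_fls_sum fls_times_fps_to_fls)
    finally have "(\<Sum>i<?m. ks ! i * us ! i) = 0" using sum b(2) by simp
    then have "FF.combine ks us = \<zero>\<^bsub>FF\<^esub>" using FF_combine[of ks us] by (simp add: ks_def)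
    moreover have "set ks \<subseteq> K" using r subring_set_frac_carrier(3)[OF R] by (auto simp: ks_def)
    ultimately have "set (take ?m ks) \<subseteq> {\<zero>\<^bsub>FF\<^esub>}"
      using FF.independent_imp_trivial_combine[OF FF_subfield assms] by blast
    moreover have "take ?m ks = ks" by (simp add: ks_def)
    moreover have "ks ! i \<in> set ks" by (rule nth_mem) (simp add: ks_def i)
    ultimately have "ks ! i = 0" by (metis FF_simps(5) singletonD subsetD)
    then show "r i = 0" using i by (simp add: ks_def)
  qed
  show ?thesis by (rule bound[OF h(1) indep])
qed

lemma FF_dimension: "\<exists>n. ring.dimension FF n K (carrier FF) \<and> real n \<le> bound"
proof -
  interpret FF: cring FF by (rule FF_cring)
  have upper: "\<forall>us. FF.independent K us \<longrightarrow> length us < Suc (nat \<lfloor>bound\<rfloor>)"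
    by (intro allI impI le_imp_less_Suc le_nat_floor FF_independent_length)
  have "\<exists>us. FF.independent K us \<and> (\<forall>vs. FF.independent K vs \<longrightarrow> length vs \<le> length us)"
    by (rule ex_has_greatest_nat[OF FF.li_Nil upper])
  then obtain us where us: "FF.independent K us" "\<forall>vs. FF.independent K vs \<longrightarrow> length vs \<le> length us"
    by (elim exE conjE)
  have "FF.Span K us = carrier FF"
  proof
    show "FF.Span K us \<subseteq> carrier FF"
      by (rule FF.Span_in_carrier[OF subfieldE(3)[OF FF_subfield] FF.independent_in_carrier[OF us(1)]])
    show "carrier FF \<subseteq> FF.Span K us"
    proof (rule ccontr)
      assume "\<not> carrier FF \<subseteq> FF.Span K us"
      then obtain u where "u \<in> carrier FF" "u \<notin> FF.Span K us" by blast
      then have "FF.independent K (u # us)" using us(1) by (rule FF.li_Cons)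
      with us(2) have "length (u # us) \<le> length us" by (elim allE impE)
      then show False by simp
    qed
  qed
  then have "FF.dimension (length us) K (carrier FF)" using FF.dimension_independent[OF us(1)] by (simp only:)
  with FF_independent_length[OF us(1)] show ?thesis by blast
qed

text \<open>
  The multiplication map induces the isomorphism, as its kernel consists of the tensor relations
  (\<open>mul_map_kernel\<close>) and its image is the whole field (\<open>mul_map_surj\<close>). The dimension is transported along the inverse isomorphism, which sends the scalars
  \<open>q\<close> to \<open>1 \<otimes> q\<close>.
\<close>

theorem tensor_is_fraction_field:
  shows "ring.finite_dimension TT (pure 1 ` K) (carrier TT)"
    and "real (ring.dim TT (pure 1 ` K) (carrier TT)) \<le> bound"
    and "\<exists>h\<in>ring_iso TT FF. \<forall>a\<in>S. \<forall>q\<in>K. h (pure a q) = fps_to_fls a * q"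
proof -
  define h where "h Y = the_elem (mul_map ` Y)" for Y
  have TT: "TT = PR Quot a_kernel PR FF mul_map"
    unfolding mul_map_kernel NN_def tensor_algebra_def by (rule refl)
  have pure: "pure a q = a_kernel PR FF mul_map +>\<^bsub>PR\<^esub> frag_of (a, q)" for a q
    unfolding mul_map_kernel NN_def pure_tensor_def by (rule refl)
  have in_PR: "frag_of (a, q) \<in> carrier PR" if "a \<in> S" "q \<in> K" for a q
    using that by simp
  have mul_map_of: "mul_map (frag_of (a, q)) = fps_to_fls a * q" for a q
    by (simp add: mul_map_def)
  have kernel_subset: "a_kernel PR FF mul_map \<subseteq> carrier PR" by (auto simp: a_kernel_def')
  have one_mult: "fps_to_fls 1 * q = q" for q :: "rat fls" by simp
  interpret hom: ring_hom_ring PR FF mul_map by (rule mul_map_hom)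
  have iso: "h \<in> ring_iso TT FF"
    using hom.FactRing_iso_set[OF mul_map_surj] unfolding TT h_def[abs_def] .
  have h_pure: "h (pure a q) = fps_to_fls a * q" if "a \<in> S" "q \<in> K" for a q
    unfolding h_def pure hom.the_elem_simp[OF in_PR[OF that]] by (rule mul_map_of)
  have pure_in: "pure a q \<in> carrier TT" if "a \<in> S" "q \<in> K" for a q
    using hom.R.a_rcosetsI[OF kernel_subset in_PR[OF that]]
    unfolding TT pure FactRing_def partial_object.select_convs .
  have TT_ring: "ring TT" unfolding TT by (rule ideal.quotient_is_ring[OF hom.kernel_is_ideal])
  define g where "g = inv_into (carrier TT) h"
  have g: "g \<in> ring_iso FF TT"
    unfolding g_def by (rule ring_iso_set_sym[OF TT_ring iso])
  then have g_bij: "bij_betw g (carrier FF) (carrier TT)" and g_hom: "g \<in> Ring.ring_hom FF TT"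
    unfolding ring_iso_def by blast+
  interpret ghom: ring_hom_ring FF TT g
    by (rule ring_hom_ringI2[OF hom.S.ring_axioms TT_ring g_hom])
  have one_nz: "\<one>\<^bsub>TT\<^esub> \<noteq> \<zero>\<^bsub>TT\<^esub>"
  proof
    assume "\<one>\<^bsub>TT\<^esub> = \<zero>\<^bsub>TT\<^esub>"
    then have "g \<one>\<^bsub>FF\<^esub> = g \<zero>\<^bsub>FF\<^esub>" by (simp only: ghom.hom_one ghom.hom_zero)
    from inj_onD[OF bij_betw_imp_inj_on[OF g_bij] this hom.S.one_closed hom.S.zero_closed]
    show False unfolding FF_simps by (rule notE[OF one_neq_zero])
  qed
  have scalars: "g ` K = pure 1 ` K"
  proof (rule image_cong[OF refl])
    fix q assume q: "q \<in> K"
    have inj: "inj_on h (carrier TT)" using iso unfolding ring_iso_def bij_betw_def by blast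
    have "h (pure 1 q) = q" unfolding h_pure[OF S_closed(1) q] by (rule one_mult)
    then show "g q = pure 1 q"
      unfolding g_def by (rule inv_into_f_eq[OF inj pure_in[OF S_closed(1) q]])
  qed
  obtain n where n: "ring.dimension FF n K (carrier FF)" "real n \<le> bound"
    using FF_dimension by (elim exE conjE)
  have dim: "ring.dimension TT n (pure 1 ` K) (carrier TT)"
    using ghom.inj_hom_dimension[OF FF_subfield one_nz bij_betw_imp_inj_on[OF g_bij] n(1)]
    unfolding bij_betw_imp_surj_on[OF g_bij] scalars .
  have sub: "subfield (pure 1 ` K) TT"
    using ghom.img_is_subfield(2)[OF FF_subfield one_nz] unfolding scalars .
  show "ring.finite_dimension TT (pure 1 ` K) (carrier TT)"
    by (rule ghom.S.finite_dimensionI[OF dim])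
  show "real (ring.dim TT (pure 1 ` K) (carrier TT)) \<le> bound"
    using n(2) unfolding ghom.S.dimI[OF sub dim, unfolded over_def] .
  show "\<exists>h\<in>ring_iso TT FF. \<forall>a\<in>S. \<forall>q\<in>K. h (pure a q) = fps_to_fls a * q"
    by (intro bexI[OF _ iso] ballI h_pure)
qed

end

section \<open>The bound for the holonomic algebra\<close>

lemma fps_poly_add: "fps_poly (P + Q) F = fps_poly P F + fps_poly Q F"
  by (induction P Q rule: poly_induct2) (simp_all add: algebra_simps fps_const_add[symmetric] del: fps_const_add)

lemma fps_poly_smult: "fps_poly (Polynomial.smult c Q) F = fps_const c * fps_poly Q F"
  by (induction Q) (simp_all add: algebra_simps fps_const_mult[symmetric] del: fps_const_mult)

lemma fps_poly_nth_0: "fps_nth (fps_poly Q F) 0 = poly Q (fps_nth F 0)"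
  by (induction Q) simp_all

text \<open>
  A non-constant series is transcendental: if \<open>P(F) = 0\<close>, then \<open>P\<close> vanishes at the constant term \<open>c\<close> of \<open>F\<close>, and the
  factor \<open>F - c\<close> of \<open>P(F)\<close> can be cancelled.
\<close>

lemma fps_poly_eq_0_imp:
  fixes F :: "'a :: field fps"
  assumes nonconst: "\<nexists>c. F = fps_const c" and "fps_poly P F = 0"
  shows "P = 0"
  using assms(2)
proof (induction "Polynomial.degree P" arbitrary: P rule: less_induct)
  case less
  show ?case
  proof (rule ccontr)
    assume "P \<noteq> 0"
    let ?c = "fps_nth F 0"
    have "poly P ?c = 0" using fps_poly_nth_0[of P F] less.prems by simp
    then obtain Q where Q: "P = [:- ?c, 1:] * Q" by (auto simp: poly_eq_0_iff_dvd)
    with \<open>P \<noteq> 0\<close> have "Q \<noteq> 0" by auto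
    have "fps_poly P F = (F - fps_const ?c) * fps_poly Q F"
      unfolding Q mult_pCons_left fps_poly_add fps_poly_smult
      by (simp add: left_diff_distrib flip: fps_const_neg)
    moreover have "F - fps_const ?c \<noteq> 0" using nonconst by auto
    ultimately have "fps_poly Q F = 0" using less.prems by simp
    moreover have "Polynomial.degree Q < Polynomial.degree P"
      using \<open>Q \<noteq> 0\<close> unfolding Q by (subst degree_mult_eq) auto
    ultimately show False using less.hyps[of Q] \<open>Q \<noteq> 0\<close> by blast
  qed
qed

lemma powers_of_nonconstant_independent:
  fixes F :: "'a :: field fps"
  assumes nonconst: "\<nexists>c. F = fps_const c" and "(\<Sum>k<D. fps_const (a k) * F ^ k) = 0" and "k < D"
  shows "a k = 0"
proof -
  define P where "P = (\<Sum>k<D. Polynomial.monom (a k) k)"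
  have coeff: "Polynomial.coeff P i = (if i < D then a i else 0)" for i
    by (simp add: P_def Polynomial.coeff_sum)
  have "Polynomial.degree P < D"
    using \<open>k < D\<close> by (intro le_less_trans[OF degree_le[of "D - 1"]]) (auto simp: coeff)
  then have "fps_poly P F = (\<Sum>k<D. fps_const (a k) * F ^ k)"
    by (subst fps_poly_altdef) (auto simp: coeff)
  with assms(2) have "P = 0" using fps_poly_eq_0_imp[OF nonconst] by simp
  then show ?thesis using coeff[of k] \<open>k < D\<close> by simp
qed

lemma int_polys_in_subring:
  shows "subring_set (int_polys_in f)" and "fps_const (of_int n) \<in> int_polys_in f" and "f \<in> int_polys_in f"
proof -
  have map_diff: "map_poly of_int (p - q) = map_poly of_int p - (map_poly of_int q :: rat fps poly)"
    and map_mult: "map_poly of_int (p * q) = map_poly of_int p * (map_poly of_int q :: rat fps poly)" for p q :: "int poly"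
    by (auto intro!: poly_eqI simp: coeff_map_poly Polynomial.coeff_mult)
  show "subring_set (int_polys_in f)"
    unfolding subring_set_def
  proof (intro conjI ballI)
    show "1 \<in> int_polys_in f" unfolding int_polys_in_def by (rule range_eqI[of _ _ 1]) simp
    fix a b assume "a \<in> int_polys_in f" "b \<in> int_polys_in f"
    then obtain p q where "a = poly (map_poly of_int p) f" "b = poly (map_poly of_int q) f"
      by (auto simp: int_polys_in_def)
    then have "a - b = poly (map_poly of_int (p - q)) f" "a * b = poly (map_poly of_int (p * q)) f"
      using map_diff[of p q] map_mult[of p q] by simp_all
    then show "a - b \<in> int_polys_in f" "a * b \<in> int_polys_in f" unfolding int_polys_in_def by blast+
  qed
  have "fps_const (of_int n) = poly (map_poly of_int [:n:]) f"
    by (simp add: map_poly_pCons fps_of_int)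
  then show "fps_const (of_int n) \<in> int_polys_in f" unfolding int_polys_in_def by blast
  have "f = poly (map_poly of_int [:0, 1:]) f"
    by (simp add: map_poly_pCons)
  then show "f \<in> int_polys_in f" unfolding int_polys_in_def by blast
qed

lemma int_polys_in_subset:
  assumes S: "subring_set S" and "f \<in> S" and int: "\<And>n. fps_const (of_int n) \<in> S"
  shows "int_polys_in f \<subseteq> S"
proof -
  have "poly (map_poly of_int p) f \<in> S" for p :: "int poly"
  proof (induction p)
    case (pCons a p)
    then have "fps_const (of_int a) + f * poly (map_poly of_int p) f \<in> S"
      by (intro subring_setD(6)[OF S] subring_setD(3)[OF S] assms)
    then show ?case using pCons.hyps by (simp add: map_poly_pCons fps_of_int)
  qed (simp add: subring_setD[OF S])
  then show ?thesis by (auto simp: int_polys_in_def)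
qed

lemma common_denominator_rat:
  fixes A :: "rat set"
  assumes "finite A"
  shows "\<exists>d::int. d \<noteq> 0 \<and> (\<forall>a\<in>A. of_int d * a \<in> \<int>)"
  using assms
proof (induction rule: finite_induct)
  case (insert a A)
  then obtain d :: int where d: "d \<noteq> 0" "\<forall>a\<in>A. of_int d * a \<in> \<int>" by blast
  obtain p q where a: "a = of_int p / of_int q" "q > 0" by (cases a) (auto simp: Fract_of_int_quotient)
  have "of_int (d * q) * a = (of_int (d * p) :: rat)" using a by simp
  moreover have "of_int (d * q) * b \<in> \<int>" if "b \<in> A" for b
    using Ints_mult[OF Ints_of_int[of q] bspec[OF d(2) that]] by (simp add: mult_ac)
  ultimately show ?case using d a by (intro exI[of _ "d * q"]) auto
qed (auto intro: exI[of _ 1])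

text \<open>
  Independence over \<open>\<int>[f]\<close> is independence over \<open>\<rat>\<close> of all the products \<open>f^k h\<^sub>i\<close>, because denominators can be cleared
  and the powers of \<open>f\<close> are independent.
\<close>

lemma rational_independence:
  fixes f :: "rat fps" and h :: "nat \<Rightarrow> rat fps"
  assumes nonconst: "\<nexists>c. f = fps_const c"
    and indep: "\<And>r. \<forall>i<m. r i \<in> int_polys_in f \<Longrightarrow> (\<Sum>i<m. r i * h i) = 0 \<Longrightarrow> \<forall>i<m. r i = 0"
    and sum: "(\<Sum>k<D. \<Sum>i<m. fps_const (c k i) * (f ^ k * h i)) = 0"
  shows "\<forall>k<D. \<forall>i<m. c k i = 0"
proof -
  note R = subring_setD[OF int_polys_in_subring(1)[of f]]
  have "finite (case_prod c ` ({..<D} \<times> {..<m}))" by simp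
  from common_denominator_rat[OF this] obtain d :: int where d: "d \<noteq> 0"
    "\<And>k i. k < D \<Longrightarrow> i < m \<Longrightarrow> of_int d * c k i \<in> \<int>" by auto
  define r where "r i = (\<Sum>k<D. fps_const (of_int d * c k i) * f ^ k)" for i
  have sum_in: "(\<And>k. k \<in> I \<Longrightarrow> g k \<in> int_polys_in f) \<Longrightarrow> sum g I \<in> int_polys_in f" for g :: "nat \<Rightarrow> rat fps" and I
    by (induction I rule: infinite_finite_induct) (auto simp: R)
  have "r i \<in> int_polys_in f" if "i < m" for i
    unfolding r_def
  proof (intro sum_in R(3) R(7) int_polys_in_subring(3))
    fix k assume "k \<in> {..<D}"
    then have "of_int d * c k i \<in> \<int>" using d(2) that by simp
    then obtain n where "of_int d * c k i = of_int n" by (elim Ints_cases)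
    then show "fps_const (of_int d * c k i) \<in> int_polys_in f" using int_polys_in_subring(2) by simp
  qed
  moreover have "(\<Sum>i<m. r i * h i) = 0"
  proof -
    have "(\<Sum>i<m. r i * h i) = (\<Sum>i<m. \<Sum>k<D. fps_const (of_int d) * (fps_const (c k i) * (f ^ k * h i)))"
      unfolding r_def sum_distrib_right by (intro sum.cong refl) (simp add: mult.assoc flip: fps_const_mult)
    also have "\<dots> = fps_const (of_int d) * (\<Sum>k<D. \<Sum>i<m. fps_const (c k i) * (f ^ k * h i))"
      by (subst sum.swap) (simp add: sum_distrib_left)
    finally show ?thesis using sum by simp
  qed
  ultimately have r0: "\<forall>i<m. r i = 0" using indep by blast
  show ?thesis
  proof (intro allI impI)
    fix k i assume "k < D" "i < m"
    have "of_int d * c k i = 0"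
      by (rule powers_of_nonconstant_independent[OF nonconst, of "\<lambda>k. of_int d * c k i" D])
        (use r0 \<open>k < D\<close> \<open>i < m\<close> in \<open>simp_all add: r_def\<close>)
    then show "c k i = 0" using d(1) by simp
  qed
qed

theorem corollary8p3p6:
  fixes U V :: "complex set" and x f :: "rat fps" and \<phi> :: "complex \<Rightarrow> complex"
  assumes "open U" and "connected U" and "0 \<in> U" and "\<And>z. z \<in> U \<Longrightarrow> cnj z \<in> U"
    and "fps_nth x 0 = 0" and "fps_nth x 1 = 1"
    and "open V" and "cball 0 1 \<subseteq> V" and "\<phi> holomorphic_on V" and "\<phi> ` V \<subseteq> U"
    and "\<And>z. z \<in> cball 0 1 \<Longrightarrow> \<phi> (cnj z) = cnj (\<phi> z)"
    and "\<phi> 0 = 0" and "cmod (deriv \<phi> 0) > 1"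
    and "f \<in> holonomic_algebra U x" and "\<nexists>c. f = fps_const c"
  shows "ring.finite_dimension (generic_fibre U x f) (generic_scalars U x f)
           (carrier (generic_fibre U x f)) \<and>
         (\<exists>h \<in> ring_iso (generic_fibre U x f) (frac_field (holonomic_algebra U x)).
            \<forall>a \<in> holonomic_algebra U x. \<forall>q \<in> frac_carrier (int_polys_in f).
              h (generic_tensor U x f a q) = fps_to_fls a * q) \<and>
         (\<exists>g. continues_composite f \<phi> g \<and>
            real (ring.dim (generic_fibre U x f) (generic_scalars U x f)
                    (carrier (generic_fibre U x f)))
            \<le> inverse (ln (cmod (deriv \<phi> 0))) *
               (LINT t : {0..1} \<times> {0..1} | lborel.
                  ln (cmod (g (cis (2 * pi * fst t)) - g (cis (2 * pi * snd t))))))"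
proof -
  let ?S = "holonomic_algebra U x" and ?R = "int_polys_in f"
  define \<Phi> where "\<Phi> = fps_expansion \<phi> 0"
  define F where "F = eval_fps (complexify f oo \<Phi>)"
  define I where "I = (LINT t : {0..1} \<times> {0..1} | lborel.
                  ln (cmod (F (cis (2 * pi * fst t)) - F (cis (2 * pi * snd t)))))"
  define b where "b = inverse (ln (cmod (deriv \<phi> 0))) * I"
  note closed = holonomic_algebra_closed[OF \<open>0 \<in> U\<close> \<open>fps_nth x 0 = 0\<close>]
  have S: "subring_set ?S"
    unfolding subring_set_def
  proof (intro conjI ballI)
    show "1 \<in> ?S" using closed(3)[of 1] by simp
    fix a c assume ac: "a \<in> ?S" "c \<in> ?S"
    show "a * c \<in> ?S" using closed(2)[OF ac] .
    show "a - c \<in> ?S" using closed(1)[OF ac(1) closed(2)[OF closed(3)[of "-1"] ac(2)]] by (simp flip: fps_const_neg)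
  qed
  have \<Phi>: "fps_nth \<Phi> 0 = 0" "fps_nth \<Phi> 1 = deriv \<phi> 0"
    using \<open>\<phi> 0 = 0\<close> by (simp_all add: \<Phi>_def fps_expansion_def)
  have ode: "satisfies_regular_ode U (complexify a)" if "a \<in> ?S" for a
    using that holonomic_on_iff_regular_ode[OF \<open>0 \<in> U\<close>] by (simp add: holonomic_algebra_def)
  have conv: "1 < fps_conv_radius (complexify a oo \<Phi>)" if "a \<in> ?S" for a
    unfolding \<Phi>_def by (rule regular_ode_continuation(1)[OF ode[OF that]]) fact+
  have integral: "fps_nth (a oo x) n \<in> \<int>" if "a \<in> ?S" for a n
    using that by (simp add: holonomic_algebra_def)
  have log_pos: "ln (cmod (deriv \<phi> 0)) > 0" using \<open>cmod (deriv \<phi> 0) > 1\<close> by (rule ln_gt_zero)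
  have rank: "m * ln (cmod (deriv \<phi> 0)) \<le> I"
    if "m > 0" "\<And>i. i < m \<Longrightarrow> h i \<in> ?S"
      "\<And>r. \<forall>i<m. r i \<in> ?R \<Longrightarrow> (\<Sum>i<m. r i * h i) = 0 \<Longrightarrow> \<forall>i<m. r i = 0" for m :: nat and h
  proof -
    interpret integral_family f x h m \<Phi>
    proof
      show "\<forall>k<D. \<forall>i<m. c k i = 0" if "(\<Sum>k<D. \<Sum>i<m. fps_const (c k i) * (f ^ k * h i)) = 0" for D c
        by (rule rational_independence[OF \<open>\<nexists>c. f = fps_const c\<close> _ that]) fact
      show "cmod (fps_nth \<Phi> 1) \<ge> 1" using \<open>cmod (deriv \<phi> 0) > 1\<close> \<Phi> by simp
    qed (use that(1,2) conv integral \<Phi> assms in auto)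
    have "m * ln (cmod (fps_nth \<Phi> 1)) \<le> I"
      unfolding I_def F_def by (rule rank_bound_integral[unfolded g_def])
    then show ?thesis by (simp only: \<Phi>)
  qed
  have bound: "real m \<le> b"
    if h: "\<And>i. i < m \<Longrightarrow> h i \<in> ?S"
      and indep: "\<And>r. \<forall>i<m. r i \<in> ?R \<Longrightarrow> (\<Sum>i<m. r i * h i) = 0 \<Longrightarrow> \<forall>i<m. r i = 0" for m :: nat and h
  proof -
    have one: "1 \<in> ?S" using subring_setD(1)[OF S] .
    \<comment> \<open>The single element \<open>1\<close> is independent, so the bound is positive; this covers \<open>m = 0\<close>.\<close>
    have "I > 0"
      using rank[of 1 "\<lambda>_. 1"] one log_pos by auto
    have "m * ln (cmod (deriv \<phi> 0)) \<le> I"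
    proof (cases "m = 0")
      case False
      then show ?thesis using rank[of m h] h indep by blast
    qed (use \<open>I > 0\<close> in simp)
    then show ?thesis using log_pos by (simp add: b_def field_simps)
  qed
  interpret bounded_fraction_tensor ?S ?R b
  proof
    show "subring_set ?S" by (rule S)
    show "subring_set ?R" by (rule int_polys_in_subring)
    show "?R \<subseteq> ?S" by (rule int_polys_in_subset[OF S \<open>f \<in> ?S\<close> closed(3)])
    show "real m \<le> b" if "\<And>i. i < m \<Longrightarrow> h i \<in> ?S" "fraction_tensor.independent_over ?R m h" for m h
    proof (rule bound[OF that(1)])
      interpret fraction_tensor ?S ?R
        by unfold_locales (rule S, rule int_polys_in_subring, rule int_polys_in_subset[OF S \<open>f \<in> ?S\<close> closed(3)])
      show "\<forall>i<m. r i = 0" if "\<forall>i<m. r i \<in> ?R" "(\<Sum>i<m. r i * h i) = 0" for r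
        using \<open>fraction_tensor.independent_over ?R m h\<close> that unfolding independent_over_def by blast
    qed
  qed
  have fibre: "generic_fibre U x f = TT" "generic_tensor U x f = pure" "generic_scalars U x f = pure 1 ` K"
    by (simp_all only: generic_fibre_def generic_tensor_def generic_scalars_def)
  have "continues_composite f \<phi> F"
    unfolding continues_composite_def
  proof (intro conjI)
    show "fps_conv_radius (complexify f) > 0"
      by (rule regular_ode_conv_radius_pos[OF ode]) fact+
    have "(cball 0 1 :: complex set) \<subseteq> eball 0 (fps_conv_radius (complexify f oo \<Phi>))"
    proof
      fix z :: complex assume "z \<in> cball 0 1"
      then have "ereal (cmod z) \<le> 1" by (simp add: one_ereal_def)
      also note conv[OF \<open>f \<in> ?S\<close>]
      finally show "z \<in> eball 0 (fps_conv_radius (complexify f oo \<Phi>))" by simp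
    qed
    moreover have "F analytic_on eball 0 (fps_conv_radius (complexify f oo \<Phi>))"
      unfolding F_def analytic_on_open[OF open_eball] by (rule holomorphic_on_eval_fps[OF subset_refl])
    ultimately show "F analytic_on cball 0 1" by (rule analytic_on_subset[rotated])
    show "\<forall>\<^sub>F z in nhds 0. F z = eval_fps (complexify f) (\<phi> z)"
      unfolding F_def \<Phi>_def by (rule regular_ode_continuation(2)[OF ode]) fact+
  qed
  moreover note tensor_is_fraction_field(2)[unfolded b_def I_def]
  ultimately show ?thesis
    unfolding fibre by (intro conjI tensor_is_fraction_field(1,3) exI[of _ F])
qed

end
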